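(* Consider the stochastic occupancy-ADMM described in the context, under the sampling, regularity and parameter conditions stated there, and let $A_T=\sum_{k=0}^{T-1}m_k^{-1}$. There are constants $C_1,C_2,C_3,C_{\mathrm{init}}$ independent of the batch schedule (and of $T$) such that $$\sup_{1\le k\le T}\mathbb E\Psi_k\le e^{C_1A_T}(C_{\mathrm{init}}+C_2A_T).$$ If $K$ is uniform on $\{1,\dots,T\}$ and independent of the algorithmic randomness, then $$\mathbb E\,G_K^{\mathrm{true}}\le C_3e^{C_1A_T}(1+A_T)\Big(\frac1T+\frac{A_T}T\Big).$$
   Context: Norms are Euclidean/spectral. $(\mathcal S,\mathcal A,P,r,\rho,\gamma)$ is a finite discounted MDP, $0<\gamma<1$, with known bounded rewards. $\Theta\subset\mathbb R^p$ is closed and convex, $\theta\mapsto\pi_\theta$ is a smooth policy map on a neighborhood of $\Theta$. $\psi_\Theta=\phi+\delta_\Theta$ ($\delta_\Theta$ the indicator) is proper, lower semicontinuous, bounded below; $\partial\psi_\Theta$ is the limiting subdifferential. $x=(q,d)$ with $q\in\mathbb R^{|\mathcal S||\mathcal A|}$, $d\in\mathbb R^{|\mathcal S|}$; $(P^{\mathsf T}q)(s')=\sum_{s,a}P(s'|s,a)q(s,a)$; $(\Pi_\theta d)(s,a)=\pi_\theta(a|s)d(s)$; $$K_\theta=\begin{bmatrix}-\gamma P^{\mathsf T} & I \\ I & -\Pi_\theta\end{bmatrix},\quad b=\begin{bmatrix}(1-\gamma)\rho \\ 0\end{bmatrix},\quad c_x=\begin{bmatrix}-r/(1-\gamma) \\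 0\end{bmatrix},\quad F(\theta,x)=K_\theta x-b.$$ True augmented Lagrangian: $\mathcal L^C_\beta(\theta,x,y)=\phi(\theta)+c_x^{\mathsf T}x+\langle y,F(\theta,x)\rangle+\frac\beta2\|F(\theta,x)\|^2$. $B_C(\theta)=\phi(\theta)+c_x^{\mathsf T}K_\theta^{-1}b$ is assumed bounded below on $\Theta$, with infimum $B_C^{\inf}$. Sampling: the reset distribution satisfies $\rho(s)\ge\rho_{\min}>0$, the sampling policies satisfy $\pi_\theta(a|s)\ge\pi_{\min}>0$, and $m_k\ge2$. At iteration $k$ a length-$m_k$ trajectory is run with frozen policy $\pi_{\theta^k}$: each step resets the state to a draw from $\rho$ with probability $1-\gamma$ and otherwise makes an environment transition $A\sim\pi_{\theta^k}(\cdot|S)$, $S'\sim P(\cdot|S,A)$; all reset coins, reset states, actions and transitions use fresh randomness. Split it into $L_k=\lfloor m_k/2\rfloor$ disjoint two-step blocks; a block is an anchor if its first step is a reset and its second step is an environment transition $(S,A,S')$. With $p_0=\gamma(1-\gamma)$, $Y_j(s,a,s')=\mathbf 1\{\text{block }j\text{ is an anchor with }S=s,A=a,S'=s'\}/(p_0\rho(s)\pi_{\theta^k}(a|s))$, $\bar P_k=L_k^{-1}\sum_jY_j$, and $\widehat P_k$ is obtained by Euclidean projection of each row $\bar P_k(\cdot|s,a)$ onto the probability simplex. $\widehat K_k(\theta)$ is $K_\theta$ with $P$ replaced by $\widehat P_k$; $\widehat F_k(\theta,x)=\widehat K_k(\theta)x-b$; $\delta_k=\sup_\theta\|\widehat K_k(\theta)-K_\theta\|$,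 $\delta_{-1}=0$. Algorithm: from deterministic $\theta^0\in\operatorname{dom}\psi_\Theta$, $x^0,y^0$, for $k\ge0$, with $\widehat h_k(\theta)=\langle y^k,\widehat F_k(\theta,x^k)\rangle+\frac\beta2\|\widehat F_k(\theta,x^k)\|^2$: $\theta^{k+1}\in\arg\min_{\theta\in\Theta}\{\phi(\theta)+\langle\nabla\widehat h_k(\theta^k),\theta-\theta^k\rangle+\frac1{2\eta_{\theta,k}}\|\theta-\theta^k\|^2\}$; $x^{k+1}=\arg\min_x\{c_x^{\mathsf T}x+\langle y^k,\widehat F_k(\theta^{k+1},x)\rangle+\frac\beta2\|\widehat F_k(\theta^{k+1},x)\|^2+\frac1{2\eta_x}\|x-x^k\|^2\}$; $y^{k+1}=y^k+\beta\widehat F_k(\theta^{k+1},x^{k+1})$. $\Delta x_k=x^k-x^{k-1}$, $\Delta x_0=0$. Regularity and parameters: $\bar\kappa_K<\infty$ bounds $\|K_\theta^{-1}\|$ and $\|\widehat K_k(\theta)^{-1}\|$ for all $\theta,k$ and all realizations (such a bound exists by row stochasticity); $\|K_\theta-K_{\theta'}\|\le L_K\|\theta-\theta'\|$; $D_\theta K_\theta$ is bounded; the gradients of the smooth augmented policy terms ($\theta\mapsto\langle y^k,F(\theta,x^k)\rangle+\frac\beta2\|F(\theta,x^k)\|^2$ and its empirical version $\widehat h_k$) have a common Lipschitz constant $\overline L$ on all policy comparison segments $[\theta^k,\theta^{k+1}]$; $\beta>36\bar\kappa_K^2/\eta_x$; $\tau=1/(8\eta_x)$; $0<\underline\eta\le\eta_{\theta,k}$;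 and $\frac1{2\eta_{\theta,k}}-\frac{\overline L}2-\frac{3A_C}{2\beta}\ge a_\theta>0$ with $A_C=9\bar\kappa_K^4L_K^2\|c_x\|^2$. Potential: $\Phi_k=\mathcal L^C_\beta(\theta^k,x^k,y^k)+\tau\|\Delta x_k\|^2$ and $\Psi_k=\Phi_k-B_C^{\inf}+1+C_0\delta_{k-1}^2$, where $C_0<\infty$ is a fixed constant (it exists, depending only on problem and algorithm parameters) such that for some $q_x>0$, $\Phi_k\ge B_C^{\inf}+\frac\beta4\|F(\theta^k,x^k)\|^2+q_x\|\Delta x_k\|^2-C_0\delta_{k-1}^2$ for all $k\ge1$. True squared KKT residual: $G_k^{\mathrm{true}}=\operatorname{dist}^2(0,\partial\psi_\Theta(\theta^k)+D_\theta F(\theta^k,x^k)^{\mathsf T}y^k)+\|c_x+K_{\theta^k}^{\mathsf T}y^k\|^2+\|F(\theta^k,x^k)\|^2$. *)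

theory Defs
  imports "HOL-Probability.Probability"
begin

section \<open>Problem data\<close>

record ('s, 'a, 'p::finite) occ_problem =
  trans_pmf :: "'s \<Rightarrow> 'a \<Rightarrow> 's pmf"
  reset_pmf :: "'s pmf"
  reward :: "'s \<Rightarrow> 'a \<Rightarrow> real"
  disc :: real
  pol :: "real^'p \<Rightarrow> 's \<Rightarrow> 'a \<Rightarrow> real"
  Theta :: "(real^'p) set"
  phi :: "real^'p \<Rightarrow> ereal"

text \<open>Transition kernels enter as plain arrays \<open>Q s a s'\<close>, because the empirical kernel is one.\<close>

definition true_kernel :: "('s, 'a, 'p::finite) occ_problem \<Rightarrow> 's \<Rightarrow> 'a \<Rightarrow> 's \<Rightarrow> real" where
  "true_kernel pb s a s' = pmf (trans_pmf pb s a) s'"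

definition spec_norm :: "real^'n^'m \<Rightarrow> real" where
  "spec_norm A = onorm ((*v) A)"

definition grad :: "(real^'p \<Rightarrow> real) \<Rightarrow> real^'p \<Rightarrow> real^'p" where
  "grad f u = (THE D. GDERIV f u :> D)"

definition psi :: "('s, 'a, 'p::finite) occ_problem \<Rightarrow> real^'p \<Rightarrow> ereal" where
  "psi pb \<theta> = phi pb \<theta> + (if \<theta> \<in> Theta pb then 0 else \<infinity>)"

definition proper :: "('b \<Rightarrow> ereal) \<Rightarrow> bool" where
  "proper f \<longleftrightarrow> (\<forall>u. f u \<noteq> -\<infinity>) \<and> (\<exists>u. f u \<noteq> \<infinity>)"

definition lsc :: "('b::t2_space \<Rightarrow> ereal) \<Rightarrow> bool" where
  "lsc f \<longleftrightarrow> (\<forall>u. f u \<le> Liminf (at u) f)"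

definition regular_subdiff :: "('b::real_inner \<Rightarrow> ereal) \<Rightarrow> 'b \<Rightarrow> 'b set" where
  "regular_subdiff f u = {v. \<bar>f u\<bar> \<noteq> \<infinity> \<and>
     (\<forall>\<epsilon>>0. \<forall>\<^sub>F z in at u. f u + ereal (v \<bullet> (z - u) - \<epsilon> * norm (z - u)) \<le> f z)}"

definition limiting_subdiff :: "('b::real_inner \<Rightarrow> ereal) \<Rightarrow> 'b \<Rightarrow> 'b set" where
  "limiting_subdiff f u = {v. \<bar>f u\<bar> \<noteq> \<infinity> \<and>
     (\<exists>z w. z \<longlonglongrightarrow> u \<and> (\<lambda>n. f (z n)) \<longlonglongrightarrow> f u \<and>
            (\<forall>n. w n \<in> regular_subdiff f (z n)) \<and> w \<longlonglongrightarrow> v)}"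

text \<open>Distance from the origin with value \<open>\<infinity>\<close> at the empty set, unlike \<^const>\<open>infdist\<close>.\<close>

definition dist0 :: "'b::real_normed_vector set \<Rightarrow> ennreal" where
  "dist0 S = (INF v\<in>S. ennreal (norm v))"

text \<open>
  The primal variable \<open>x = (q, d)\<close> is a vector over the index type \<open>('s \<times> 'a) + 's\<close>;
  the constraints and multipliers are vectors over \<open>'s + ('s \<times> 'a)\<close>.
\<close>

definition Kmat :: "('s::finite, 'a::finite, 'p::finite) occ_problem \<Rightarrow> ('s \<Rightarrow> 'a \<Rightarrow> 's \<Rightarrow> real)
    \<Rightarrow> real^'p \<Rightarrow> real^(('s \<times> 'a) + 's)^('s + ('s \<times> 'a))" where
  "Kmat pb Q \<theta> = (\<chi> i j. case i of
       Inl s' \<Rightarrow> (case j of Inl (s, a) \<Rightarrow> - disc pb * Q s a s'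
                         | Inr s \<Rightarrow> of_bool (s = s'))
     | Inr (s, a) \<Rightarrow> (case j of Inl sa \<Rightarrow> of_bool (sa = (s, a))
                             | Inr t \<Rightarrow> if t = s then - pol pb \<theta> s a else 0))"

definition bvec :: "('s::finite, 'a::finite, 'p::finite) occ_problem \<Rightarrow> real^('s + ('s \<times> 'a))" where
  "bvec pb = (\<chi> i. case i of Inl s \<Rightarrow> (1 - disc pb) * pmf (reset_pmf pb) s | Inr _ \<Rightarrow> 0)"

definition cvec :: "('s::finite, 'a::finite, 'p::finite) occ_problem \<Rightarrow> real^(('s \<times> 'a) + 's)" where
  "cvec pb = (\<chi> j. case j of Inl (s, a) \<Rightarrow> - reward pb s a / (1 - disc pb) | Inr _ \<Rightarrow> 0)"

definition Fmap :: "('s::finite, 'a::finite, 'p::finite) occ_problem \<Rightarrow> ('s \<Rightarrow> 'a \<Rightarrow> 's \<Rightarrow> real)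
    \<Rightarrow> real^'p \<Rightarrow> real^(('s \<times> 'a) + 's) \<Rightarrow> real^('s + ('s \<times> 'a))" where
  "Fmap pb Q \<theta> x = Kmat pb Q \<theta> *v x - bvec pb"

definition aug_term :: "('s::finite, 'a::finite, 'p::finite) occ_problem \<Rightarrow> real
    \<Rightarrow> ('s \<Rightarrow> 'a \<Rightarrow> 's \<Rightarrow> real) \<Rightarrow> real^(('s \<times> 'a) + 's) \<Rightarrow> real^('s + ('s \<times> 'a))
    \<Rightarrow> real^'p \<Rightarrow> real" where
  "aug_term pb \<beta> Q x y \<theta> = y \<bullet> Fmap pb Q \<theta> x + \<beta> / 2 * (norm (Fmap pb Q \<theta> x))\<^sup>2"

text \<open>\<^const>\<open>real_of_ereal\<close> is harmless below: the iterates stay in the domain of \<open>psi\<close>.\<close>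

definition aug_lagrangian :: "('s::finite, 'a::finite, 'p::finite) occ_problem \<Rightarrow> real
    \<Rightarrow> real^'p \<Rightarrow> real^(('s \<times> 'a) + 's) \<Rightarrow> real^('s + ('s \<times> 'a)) \<Rightarrow> real" where
  "aug_lagrangian pb \<beta> \<theta> x y =
     real_of_ereal (phi pb \<theta>) + cvec pb \<bullet> x + aug_term pb \<beta> (true_kernel pb) x y \<theta>"

definition B_C :: "('s::finite, 'a::finite, 'p::finite) occ_problem \<Rightarrow> real^'p \<Rightarrow> ereal" where
  "B_C pb \<theta> = phi pb \<theta> +
     ereal (cvec pb \<bullet> (matrix_inv (Kmat pb (true_kernel pb) \<theta>) *v bvec pb))"

definition B_C_inf :: "('s::finite, 'a::finite, 'p::finite) occ_problem \<Rightarrow> ereal" where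
  "B_C_inf pb = (INF \<theta>\<in>Theta pb. B_C pb \<theta>)"

definition problem_ok :: "('s::finite, 'a::finite, 'p::finite) occ_problem \<Rightarrow> bool" where
  "problem_ok pb \<longleftrightarrow>
     0 < disc pb \<and> disc pb < 1 \<and>
     closed (Theta pb) \<and> convex (Theta pb) \<and>
     (\<forall>\<theta>\<in>Theta pb. \<forall>s. (\<forall>a. 0 \<le> pol pb \<theta> s a) \<and> (\<Sum>a\<in>UNIV. pol pb \<theta> s a) = 1) \<and>
     (\<exists>U. open U \<and> Theta pb \<subseteq> U \<and>
        (\<forall>s a. (\<lambda>\<theta>. pol pb \<theta> s a) differentiable_on U \<and>
               continuous_on U (grad (\<lambda>\<theta>. pol pb \<theta> s a)))) \<and>
     proper (psi pb) \<and> lsc (psi pb) \<and> (\<exists>c::real. \<forall>\<theta>. ereal c \<le> psi pb \<theta>) \<and>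
     B_C_inf pb \<noteq> -\<infinity>"


section \<open>Trajectories and the empirical kernel\<close>

text \<open>One step: a reset to a new state, or an action together with the next state.\<close>

datatype ('s, 'a) step = Reset 's | Env 'a 's

fun step_target :: "('s, 'a) step \<Rightarrow> 's" where
  "step_target (Reset s') = s'"
| "step_target (Env a s') = s'"

fun step_prob :: "('s, 'a, 'p::finite) occ_problem \<Rightarrow> real^'p \<Rightarrow> 's \<Rightarrow> ('s, 'a) step \<Rightarrow> real" where
  "step_prob pb \<theta> s (Reset s') = (1 - disc pb) * pmf (reset_pmf pb) s'"
| "step_prob pb \<theta> s (Env a s') = disc pb * pol pb \<theta> s a * true_kernel pb s a s'"

fun traj_prob :: "('s, 'a, 'p::finite) occ_problem \<Rightarrow> real^'p \<Rightarrow> 's \<Rightarrow> ('s, 'a) step list \<Rightarrow> real" where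
  "traj_prob pb \<theta> s [] = 1"
| "traj_prob pb \<theta> s (z # zs) = step_prob pb \<theta> s z * traj_prob pb \<theta> (step_target z) zs"

text \<open>Block \<open>j\<close> consists of the steps with (zero-based) indices \<open>2 j\<close> and \<open>2 j + 1\<close>.\<close>

definition block_weight :: "('s, 'a, 'p::finite) occ_problem \<Rightarrow> real^'p \<Rightarrow> ('s, 'a) step list
    \<Rightarrow> nat \<Rightarrow> 's \<Rightarrow> 'a \<Rightarrow> 's \<Rightarrow> real" where
  "block_weight pb \<theta> zs j s a s' =
     of_bool (zs ! (2 * j) = Reset s \<and> zs ! (2 * j + 1) = Env a s')
       / (disc pb * (1 - disc pb) * pmf (reset_pmf pb) s * pol pb \<theta> s a)"

definition raw_kernel :: "('s, 'a, 'p::finite) occ_problem \<Rightarrow> real^'p \<Rightarrow> ('s, 'a) step list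
    \<Rightarrow> 's \<Rightarrow> 'a \<Rightarrow> 's \<Rightarrow> real" where
  "raw_kernel pb \<theta> zs s a s' =
     (\<Sum>j<length zs div 2. block_weight pb \<theta> zs j s a s') / real (length zs div 2)"

definition prob_simplex :: "(real^'s::finite) set" where
  "prob_simplex = {v. (\<forall>s. 0 \<le> v $ s) \<and> (\<Sum>s\<in>UNIV. v $ s) = 1}"

definition emp_kernel :: "('s::finite, 'a, 'p::finite) occ_problem \<Rightarrow> real^'p \<Rightarrow> ('s, 'a) step list
    \<Rightarrow> 's \<Rightarrow> 'a \<Rightarrow> 's \<Rightarrow> real" where
  "emp_kernel pb \<theta> zs s a s' =
     closest_point prob_simplex (\<chi> t. raw_kernel pb \<theta> zs s a t) $ s'"


section \<open>Parameters and runs\<close>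

record admm_params =
  pen :: real          \<comment> \<open>\<open>\<beta>\<close>\<close>
  eta_x :: real
  eta_low :: real
  L_bar :: real
  a_theta :: real
  kappa :: real
  L_K :: real
  rho_min :: real
  pi_min :: real
  C0 :: real
  q_x :: real

definition A_C :: "('s::finite, 'a::finite, 'p::finite) occ_problem \<Rightarrow> admm_params \<Rightarrow> real" where
  "A_C pb pr = 9 * kappa pr ^ 4 * (L_K pr)\<^sup>2 * (norm (cvec pb))\<^sup>2"

definition params_ok :: "('s::finite, 'a::finite, 'p::finite) occ_problem \<Rightarrow> admm_params \<Rightarrow> bool" where
  "params_ok pb pr \<longleftrightarrow>
     0 < rho_min pr \<and> (\<forall>s. rho_min pr \<le> pmf (reset_pmf pb) s) \<and>
     0 < pi_min pr \<and>
     (\<forall>\<theta>\<in>Theta pb. spec_norm (matrix_inv (Kmat pb (true_kernel pb) \<theta>)) \<le> kappa pr) \<and>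
     (\<forall>\<theta>\<in>Theta pb. \<forall>\<theta>'\<in>Theta pb.
        spec_norm (Kmat pb (true_kernel pb) \<theta> - Kmat pb (true_kernel pb) \<theta>')
          \<le> L_K pr * norm (\<theta> - \<theta>')) \<and>
     (\<exists>D. \<forall>\<theta>\<in>Theta pb. \<forall>h.
        spec_norm (frechet_derivative (Kmat pb (true_kernel pb)) (at \<theta>) h) \<le> D * norm h) \<and>
     0 < eta_x pr \<and> pen pr > 36 * (kappa pr)\<^sup>2 / eta_x pr \<and>
     0 < eta_low pr \<and> 0 < a_theta pr \<and> 0 < q_x pr"

text \<open>
  A run: batch schedule, policy step sizes, history filtration, and the random initial states,
  trajectories and iterates. Iteration \<open>k\<close> starts from history \<open>filt k\<close>.
\<close>

record ('w, 's, 'a, 'p::finite) run =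
  batch :: "nat \<Rightarrow> nat"
  eta :: "nat \<Rightarrow> real"
  filt :: "nat \<Rightarrow> 'w measure"
  start :: "nat \<Rightarrow> 'w \<Rightarrow> 's"
  traj :: "nat \<Rightarrow> 'w \<Rightarrow> ('s, 'a) step list"
  th :: "nat \<Rightarrow> 'w \<Rightarrow> real^'p"
  xx :: "nat \<Rightarrow> 'w \<Rightarrow> real^(('s \<times> 'a) + 's)"
  yy :: "nat \<Rightarrow> 'w \<Rightarrow> real^('s + ('s \<times> 'a))"

definition Phat :: "('s::finite, 'a, 'p::finite) occ_problem \<Rightarrow> ('w, 's, 'a, 'p) run
    \<Rightarrow> nat \<Rightarrow> 'w \<Rightarrow> 's \<Rightarrow> 'a \<Rightarrow> 's \<Rightarrow> real" where
  "Phat pb R k \<omega> = emp_kernel pb (th R k \<omega>) (traj R k \<omega>)"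

definition delta :: "('s::finite, 'a::finite, 'p::finite) occ_problem \<Rightarrow> ('w, 's, 'a, 'p) run
    \<Rightarrow> nat \<Rightarrow> 'w \<Rightarrow> real" where
  "delta pb R k \<omega> = (SUP \<theta>\<in>Theta pb.
     spec_norm (Kmat pb (Phat pb R k \<omega>) \<theta> - Kmat pb (true_kernel pb) \<theta>))"

text \<open>\<open>delta_prev k\<close> and \<open>dx k\<close> are \<open>\<delta>\<^bsub>k-1\<^esub>\<close> and \<open>\<Delta>x\<^sub>k\<close>, both zero at \<open>k = 0\<close>.\<close>

definition delta_prev :: "('s::finite, 'a::finite, 'p::finite) occ_problem \<Rightarrow> ('w, 's, 'a, 'p) run
    \<Rightarrow> nat \<Rightarrow> 'w \<Rightarrow> real" where
  "delta_prev pb R k \<omega> = (if k = 0 then 0 else delta pb R (k - 1) \<omega>)"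

definition dx :: "('w, 's, 'a, 'p::finite) run \<Rightarrow> nat \<Rightarrow> 'w \<Rightarrow> real^(('s::finite \<times> 'a::finite) + 's)" where
  "dx R k \<omega> = (if k = 0 then 0 else xx R k \<omega> - xx R (k - 1) \<omega>)"

definition Phi :: "('s::finite, 'a::finite, 'p::finite) occ_problem \<Rightarrow> admm_params
    \<Rightarrow> ('w, 's, 'a, 'p) run \<Rightarrow> nat \<Rightarrow> 'w \<Rightarrow> real" where
  "Phi pb pr R k \<omega> = aug_lagrangian pb (pen pr) (th R k \<omega>) (xx R k \<omega>) (yy R k \<omega>)
     + 1 / (8 * eta_x pr) * (norm (dx R k \<omega>))\<^sup>2"

definition Psi :: "('s::finite, 'a::finite, 'p::finite) occ_problem \<Rightarrow> admm_params
    \<Rightarrow> ('w, 's, 'a, 'p) run \<Rightarrow> nat \<Rightarrow> 'w \<Rightarrow> real" where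
  "Psi pb pr R k \<omega> = Phi pb pr R k \<omega> - real_of_ereal (B_C_inf pb) + 1
     + C0 pr * (delta_prev pb R k \<omega>)\<^sup>2"

definition G_true :: "('s::finite, 'a::finite, 'p::finite) occ_problem
    \<Rightarrow> ('w, 's, 'a, 'p) run \<Rightarrow> nat \<Rightarrow> 'w \<Rightarrow> ennreal" where
  "G_true pb R k \<omega> =
     (let \<theta> = th R k \<omega>; x = xx R k \<omega>; y = yy R k \<omega>;
          J = jacobian (\<lambda>t. Fmap pb (true_kernel pb) t x) (at \<theta>)
      in (dist0 ((\<lambda>v. v + transpose J *v y) ` limiting_subdiff (psi pb) \<theta>))\<^sup>2
         + ennreal ((norm (cvec pb + transpose (Kmat pb (true_kernel pb) \<theta>) *v y))\<^sup>2)
         + ennreal ((norm (Fmap pb (true_kernel pb) \<theta> x))\<^sup>2))"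

text \<open>
  Sampling. Fresh randomness means: given the history up to iteration \<open>k\<close>, which determines
  \<open>\<theta>\<^sup>k\<close> and the initial state, the trajectory has the law of the reset chain under the frozen
  policy. The filtration may be larger than the one generated by the data, so ties in the policy
  step may be broken at random.
\<close>

definition sampling_ok :: "('s::finite, 'a::finite, 'p::finite) occ_problem \<Rightarrow> admm_params
    \<Rightarrow> 'w measure \<Rightarrow> ('w, 's, 'a, 'p) run \<Rightarrow> bool" where
  "sampling_ok pb pr M R \<longleftrightarrow>
     prob_space M \<and> filtration (space M) (filt R) \<and>
     (\<forall>k. subalgebra M (filt R k)) \<and>
     (\<forall>k. th R k \<in> borel_measurable (filt R k) \<and> xx R k \<in> borel_measurable (filt R k) \<and>
          yy R k \<in> borel_measurable (filt R k) \<and>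
          start R k \<in> measurable (filt R k) (count_space UNIV) \<and>
          traj R k \<in> measurable (filt R (Suc k)) (count_space UNIV)) \<and>
     (\<forall>k. 2 \<le> batch R k) \<and>
     (\<forall>k. \<forall>\<omega>\<in>space M. length (traj R k \<omega>) = batch R k) \<and>
     (\<forall>k. \<forall>\<omega>\<in>space M. \<forall>s a. pi_min pr \<le> pol pb (th R k \<omega>) s a) \<and>
     (\<forall>k zs. length zs = batch R k \<longrightarrow>
        (AE \<omega> in M. real_cond_exp M (filt R k) (indicator {\<omega>'\<in>space M. traj R k \<omega>' = zs}) \<omega>
                    = traj_prob pb (th R k \<omega>) (start R k \<omega>) zs))"

definition updates_ok :: "('s::finite, 'a::finite, 'p::finite) occ_problem \<Rightarrow> admm_params
    \<Rightarrow> real^'p \<Rightarrow> real^(('s \<times> 'a) + 's) \<Rightarrow> real^('s + ('s \<times> 'a))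
    \<Rightarrow> 'w measure \<Rightarrow> ('w, 's, 'a, 'p) run \<Rightarrow> bool" where
  "updates_ok pb pr \<theta>0 x0 y0 M R \<longleftrightarrow>
     (\<forall>\<omega>\<in>space M.
        th R 0 \<omega> = \<theta>0 \<and> xx R 0 \<omega> = x0 \<and> yy R 0 \<omega> = y0 \<and>
        (\<forall>k. let Q = Phat pb R k \<omega>; \<theta> = th R k \<omega>; x = xx R k \<omega>; y = yy R k \<omega>;
                 \<theta>' = th R (Suc k) \<omega>; x' = xx R (Suc k) \<omega>; y' = yy R (Suc k) \<omega>
             in is_arg_min
                  (\<lambda>t. phi pb t + ereal (grad (aug_term pb (pen pr) Q x y) \<theta> \<bullet> (t - \<theta>)
                                           + 1 / (2 * eta R k) * (norm (t - \<theta>))\<^sup>2))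
                  (\<lambda>t. t \<in> Theta pb) \<theta>' \<and>
                is_arg_min
                  (\<lambda>u. cvec pb \<bullet> u + aug_term pb (pen pr) Q u y \<theta>'
                        + 1 / (2 * eta_x pr) * (norm (u - x))\<^sup>2)
                  (\<lambda>_. True) x' \<and>
                y' = y + pen pr *\<^sub>R Fmap pb Q \<theta>' x'))"

text \<open>
  The last clause is the defining property of \<open>C0\<close>, with \<open>q_x\<close> as the accompanying
  positive coefficient.
\<close>

definition regularity_ok :: "('s::finite, 'a::finite, 'p::finite) occ_problem \<Rightarrow> admm_params
    \<Rightarrow> 'w measure \<Rightarrow> ('w, 's, 'a, 'p) run \<Rightarrow> bool" where
  "regularity_ok pb pr M R \<longleftrightarrow>
     (\<forall>k. eta_low pr \<le> eta R k \<and>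
          a_theta pr \<le> 1 / (2 * eta R k) - L_bar pr / 2 - 3 * A_C pb pr / (2 * pen pr)) \<and>
     (\<forall>\<omega>\<in>space M. \<forall>k.
        (\<forall>\<theta>\<in>Theta pb. spec_norm (matrix_inv (Kmat pb (Phat pb R k \<omega>) \<theta>)) \<le> kappa pr) \<and>
        (\<forall>Q\<in>{true_kernel pb, Phat pb R k \<omega>}.
         \<forall>u\<in>closed_segment (th R k \<omega>) (th R (Suc k) \<omega>).
         \<forall>v\<in>closed_segment (th R k \<omega>) (th R (Suc k) \<omega>).
           norm (grad (aug_term pb (pen pr) Q (xx R k \<omega>) (yy R k \<omega>)) u
                 - grad (aug_term pb (pen pr) Q (xx R k \<omega>) (yy R k \<omega>)) v)
             \<le> L_bar pr * norm (u - v))) \<and>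
     (\<forall>\<omega>\<in>space M. \<forall>k\<ge>1.
        Phi pb pr R k \<omega> \<ge> real_of_ereal (B_C_inf pb)
          + pen pr / 4 * (norm (Fmap pb (true_kernel pb) (th R k \<omega>) (xx R k \<omega>)))\<^sup>2
          + q_x pr * (norm (dx R k \<omega>))\<^sup>2 - C0 pr * (delta_prev pb R k \<omega>)\<^sup>2)"

definition uniform_index :: "'w measure \<Rightarrow> ('w, 's, 'a, 'p::finite) run \<Rightarrow> nat \<Rightarrow> ('w \<Rightarrow> nat) \<Rightarrow> bool" where
  "uniform_index M R T \<kappa> \<longleftrightarrow>
     \<kappa> \<in> measurable M (count_space UNIV) \<and>
     distr M (count_space UNIV) \<kappa> = measure_pmf (pmf_of_set {1..T}) \<and>
     prob_space.indep_set M {\<kappa> -` B \<inter> space M |B. True}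
       (sigma_sets (space M) (\<Union>k. sets (filt R k)))"

end

theory Submission
  imports Defs
begin

text \<open>
  Optimality of the primal step reads \<open>K\<^sup>T y = - c - \<Delta>x / \<eta>\<close> for the empirical matrix \<open>K\<close>, and the
  multiplier step reads \<open>K x = b + \<Delta>y / \<beta>\<close>. Together with \<open>\<beta> > 36 \<kappa>\<^sup>2 / \<eta>\<close> they give a contractive
  recursion for the norm of \<open>x\<close>, so all iterates are bounded by a deterministic constant. The
  empirical augmented Lagrangian decreases in the first two blocks, and its increase in the
  multiplier block is controlled by the primal and policy steps through the first identity.
  Since the iterates are bounded, replacing the empirical by the true kernel changes the decrement
  by at most \<open>O(\<delta>)\<close> times the step lengths, which Young's inequality turns into \<open>O(\<delta>\<^sup>2)\<close>. Hence, along every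
  realization, the potential and the sum of the squared residuals up to time \<open>T\<close> are at most a
  constant times \<open>1 + \<Sum> \<delta>\<^sub>k\<^sup>2\<close>.

  Anchors start with a reset, so the block errors are uncorrelated; as projecting onto the simplex
  is nonexpansive, \<open>\<delta>\<^sub>k\<^sup>2\<close> has expectation \<open>O(1 / m\<^sub>k)\<close>. The bounds therefore hold even with \<open>C1 = 0\<close>.
\<close>

subsection \<open>Spectral norm\<close>

text \<open>The factor e^(C1 A_T) is what a Gronwall argument for the potential would cost.
  Boundedness of the iterates along every realization avoids it; this rests on \<open>kappa\<close>
  bounding the inverses for all realizations at once. Kernel and policy occupy different blocks of
  K, so the empirical matrix minus the true one is a matrix D_k free of \<theta>. Hence delta_k is
  simply the norm of D_k, the derivative of F in \<theta> is free of sampling error, and the same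
  D_k acts at both ends of a step. The last point is essential: at a single point the two
  Lagrangians differ by O(delta_k), and a sum of such terms would be of order sum m_k^(-1/2). Only
  the change of that difference along a step carries the extra factor of a step length. The initial
  multiplier satisfies no stationarity identity, so the first dual increment is bounded crudely;
  this is the source of all \<open>of_bool (k = 0)\<close> terms. The residual contains an infimum
  over a limiting subdifferential, whose measurability is not evident. Expectations are therefore
  taken of a majorant built from step lengths and kernel errors.\<close>

lemma norm_matrix_vector_le: "norm (A *v x) \<le> spec_norm A * norm x"
  unfolding spec_norm_def by (rule onorm) (rule matrix_vector_mul_bounded_linear)

lemma spec_norm_nonneg: "0 \<le> spec_norm A"
  unfolding spec_norm_def by (rule onorm_pos_le) (rule matrix_vector_mul_bounded_linear)

lemma spec_norm_leI: "(\<And>x. norm (A *v x) \<le> B * norm x) \<Longrightarrow> spec_norm A \<le> B"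
  unfolding spec_norm_def by (rule onorm_le)

lemma spec_norm_triangle: "spec_norm (A + B) \<le> spec_norm A + spec_norm B"
proof (rule spec_norm_leI)
  fix x
  have "norm ((A + B) *v x) \<le> norm (A *v x) + norm (B *v x)"
    by (simp add: matrix_vector_mult_add_rdistrib norm_triangle_ineq)
  then show "norm ((A + B) *v x) \<le> (spec_norm A + spec_norm B) * norm x"
    using norm_matrix_vector_le[of A x] norm_matrix_vector_le[of B x] by (simp add: distrib_right)
qed

lemma spec_norm_minus: "spec_norm (- A) = spec_norm A"
proof -
  have "(*v) (- A) = (\<lambda>x. - (A *v x))"
    using matrix_vector_mult_diff_rdistrib[of 0 A] by (auto simp: fun_eq_iff)
  then show ?thesis by (simp add: spec_norm_def onorm_neg)
qed

lemma spec_norm_diff_commute: "spec_norm (A - B) = spec_norm (B - A)"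
  using spec_norm_minus[of "A - B"] by simp

lemma spec_norm_triangle_diff: "spec_norm (A - C) \<le> spec_norm (A - B) + spec_norm (B - C)"
  using spec_norm_triangle[of "A - B" "B - C"] by simp

text \<open>Writing the squared norm of the transposed product as an inner product moves the matrix
  to the other side, where the bound for \<open>A\<close> applies; one factor then cancels.\<close>

lemma norm_transpose_vector_le: "norm (transpose A *v y) \<le> spec_norm A * norm y"
proof -
  let ?v = "transpose A *v y"
  have "norm ?v * norm ?v = ?v \<bullet> ?v" by (simp add: power2_norm_eq_inner flip: power2_eq_square)
  also have "\<dots> = y \<bullet> (A *v ?v)" using dot_lmul_matrix[of y A ?v] by simp
  also have "\<dots> \<le> norm y * norm (A *v ?v)" by (rule norm_cauchy_schwarz)
  also have "\<dots> \<le> norm y * (spec_norm A * norm ?v)"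
    by (intro mult_left_mono norm_matrix_vector_le) auto
  finally have "norm ?v * norm ?v \<le> (spec_norm A * norm y) * norm ?v" by (simp add: ac_simps)
  then show ?thesis
    by (cases "norm ?v = 0") (auto simp: spec_norm_nonneg)
qed

lemma inner_transpose_vector: "(transpose A *v y) \<bullet> x = y \<bullet> (A *v x)" for A :: "real^'n^'m"
  using dot_lmul_matrix[of y A x] by simp

lemma spec_norm_le_entries:
  fixes A :: "real^'n^'m"
  assumes "\<And>i j. \<bar>A $ i $ j\<bar> \<le> B"
  shows "spec_norm A \<le> real (CARD('m)) * real (CARD('n)) * B"
  unfolding spec_norm_def using assms by (rule onorm_le_matrix_component)

text \<open>Continuity suffices: by the reverse triangle inequality and the entrywise bound,
  \<open>spec_norm\<close> is Lipschitz for the norm of the matrix type, which is the Frobenius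
  norm.\<close>

lemma borel_measurable_spec_norm: "(spec_norm :: real^'n^'m \<Rightarrow> real) \<in> borel_measurable borel"
proof -
  let ?N = "real (CARD('m)) * real (CARD('n))"
  have lip: "\<bar>spec_norm A - spec_norm B\<bar> \<le> ?N * dist A B" for A B :: "real^'n^'m"
  proof -
    have "\<bar>(A - B) $ i $ j\<bar> \<le> norm (A - B)" for i j
      by (rule order_trans[OF component_le_norm_cart Finite_Cartesian_Product.norm_nth_le])
    then have "spec_norm (A - B) \<le> ?N * norm (A - B)" by (rule spec_norm_le_entries)
    moreover have "spec_norm A \<le> spec_norm (A - B) + spec_norm B"
      using spec_norm_triangle[of "A - B" B] by simp
    moreover have "spec_norm B \<le> spec_norm (A - B) + spec_norm A"
      using spec_norm_triangle[of "B - A" A] by (simp add: spec_norm_diff_commute)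
    ultimately show ?thesis by (simp add: dist_norm)
  qed
  have "?N-lipschitz_on UNIV (spec_norm :: real^'n^'m \<Rightarrow> real)"
    by (rule lipschitz_onI) (auto simp: dist_real_def lip)
  then show ?thesis
    by (intro borel_measurable_continuous_onI lipschitz_on_continuous_on)
qed

text \<open>Rows and columns of the occupancy matrix are indexed by different types of equal
  cardinality. Squareness is thus an equation of cardinals, and the rank turns injectivity into
  surjectivity.\<close>

lemma invertible_if_injective:
  fixes A :: "real^'n^'m"
  assumes card: "CARD('n) = CARD('m)" and inj: "\<And>x. A *v x = 0 \<Longrightarrow> x = 0"
  shows "matrix_inv A ** A = mat 1" "A ** matrix_inv A = mat 1"
proof -
  have "inj ((*v) A)"
    using inj by (simp add: vec.inj_iff_eq_0)
  then have "rank A = CARD('n)" by (simp add: full_rank_injective)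
  then have s: "surj ((*v) A)" using card by (simp add: full_rank_surjective)
  obtain B where B: "B ** A = mat 1"
    using \<open>inj _\<close> by (auto simp: matrix_left_invertible_injective[symmetric])
  obtain C where C: "A ** C = mat 1"
    using s by (auto simp: matrix_right_invertible_surjective[symmetric])
  have "B = B ** (A ** C)" by (simp add: C)
  also have "\<dots> = C" by (simp add: matrix_mul_assoc B)
  finally have "A ** B = mat 1 \<and> B ** A = mat 1" using B C by simp
  then have "A ** matrix_inv A = mat 1 \<and> matrix_inv A ** A = mat 1"
    unfolding matrix_inv_def by (rule someI)
  then show "matrix_inv A ** A = mat 1" "A ** matrix_inv A = mat 1" by auto
qed

lemma norm_le_spec_norm_inv:
  assumes "matrix_inv A ** A = mat 1"
  shows "norm x \<le> spec_norm (matrix_inv A) * norm (A *v x)"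
  using norm_matrix_vector_le[of "matrix_inv A" "A *v x"] assms
  by (simp add: matrix_vector_mul_assoc)

lemma transpose_inv_vector:
  fixes A :: "real^'n^'m"
  assumes "matrix_inv A ** A = mat 1"
  shows "transpose A *v (transpose (matrix_inv A) *v y) = y"
proof -
  have "transpose A *v (transpose (matrix_inv A) *v y) = transpose (matrix_inv A ** A) *v y"
    by (simp only: matrix_transpose_mul matrix_vector_mul_assoc)
  then show ?thesis by (simp only: assms transpose_mat matrix_vector_mul_lid)
qed

lemma norm_le_spec_norm_inv_transpose:
  assumes "A ** matrix_inv A = mat 1"
  shows "norm y \<le> spec_norm (matrix_inv A) * norm (transpose A *v y)"
proof -
  have "transpose (matrix_inv A) *v (transpose A *v y) = y"
    using assms by (metis matrix_transpose_mul matrix_vector_mul_assoc matrix_vector_mul_lid transpose_mat)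
  then show ?thesis using norm_transpose_vector_le[of "matrix_inv A" "transpose A *v y"] by simp
qed

subsection \<open>The matrices of the occupancy constraints\<close>

definition stochastic_kernel :: "('s::finite \<Rightarrow> 'a \<Rightarrow> 's \<Rightarrow> real) \<Rightarrow> bool" where
  "stochastic_kernel Q \<longleftrightarrow> (\<forall>s a. (\<forall>s'. 0 \<le> Q s a s') \<and> (\<Sum>s'\<in>UNIV. Q s a s') = 1)"

lemma stochastic_true_kernel: "stochastic_kernel (true_kernel pb)" for pb :: "('s::finite, 'a, 'p::finite) occ_problem"
  by (simp add: stochastic_kernel_def true_kernel_def sum_pmf_eq_1)

lemma stochastic_kernel_le_1:
  assumes "stochastic_kernel Q" shows "\<bar>Q s a s'\<bar> \<le> 1"
proof -
  have "Q s a s' \<le> (\<Sum>t\<in>UNIV. Q s a t)"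
    using assms by (intro member_le_sum) (auto simp: stochastic_kernel_def)
  then show ?thesis using assms by (auto simp: stochastic_kernel_def)
qed

lemma Kmat_diff_entry:
  "(Kmat pb Q \<theta> - Kmat pb Q' \<theta>) $ i $ j =
     (case i of Inl s' \<Rightarrow> (case j of Inl (s, a) \<Rightarrow> - disc pb * (Q s a s' - Q' s a s') | Inr s \<Rightarrow> 0) | Inr (s, a) \<Rightarrow> 0)"
  by (auto simp: Kmat_def algebra_simps split: sum.splits prod.splits)

text \<open>The kernel enters only the upper left block and the policy only the lower right one. The
  supremum that defines \<open>delta\<close> is therefore taken over a constant.\<close>

lemma Kmat_diff_indep: "Kmat pb Q \<theta> - Kmat pb Q' \<theta> = Kmat pb Q \<theta>' - Kmat pb Q' \<theta>'"
  by (simp only: vec_eq_iff Kmat_diff_entry simp_thms)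

text \<open>On the null space the second block row gives q = Pi d, and the first then says that d is
  the discount factor times a stochastic matrix applied to d. Comparing l1 norms forces d = 0,
  because the discount is below 1.\<close>

lemma inj_Kmat:
  fixes pb :: "('s::finite, 'a::finite, 'p::finite) occ_problem"
  assumes disc: "0 < disc pb" "disc pb < 1" and Q: "stochastic_kernel Q"
    and pol: "\<And>s a. 0 \<le> pol pb \<theta> s a" "\<And>s. (\<Sum>a\<in>UNIV. pol pb \<theta> s a) = 1"
    and z: "Kmat pb Q \<theta> *v x = 0"
  shows "x = 0"
proof -
  have sum_UNIV: "(\<Sum>j\<in>UNIV. g j) = (\<Sum>sa\<in>UNIV. g (Inl sa)) + (\<Sum>s\<in>UNIV. g (Inr s))"
    for g :: "('s \<times> 'a) + 's \<Rightarrow> real"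
    using sum.Plus[of "UNIV :: ('s \<times> 'a) set" "UNIV :: 's set" g] by simp
  have q: "x $ Inl (s, a) = pol pb \<theta> s a * x $ Inr s" for s a
  proof -
    have "0 = (Kmat pb Q \<theta> *v x) $ Inr (s, a)" by (simp add: z)
    also have "\<dots> = (\<Sum>sa\<in>UNIV. of_bool (sa = (s, a)) * x $ Inl sa)
        + (\<Sum>t\<in>UNIV. (if t = s then - pol pb \<theta> s a else 0) * x $ Inr t)"
      by (simp add: matrix_vector_mult_def Kmat_def sum_UNIV)
    also have "\<dots> = x $ Inl (s, a) - pol pb \<theta> s a * x $ Inr s"
      by (simp add: of_bool_def if_distrib if_distribR sum.delta cong: if_cong)
    finally show ?thesis by simp
  qed
  have d: "x $ Inr s' = disc pb * (\<Sum>s\<in>UNIV. \<Sum>a\<in>UNIV. Q s a s' * pol pb \<theta> s a * x $ Inr s)" for s'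
  proof -
    have "0 = (Kmat pb Q \<theta> *v x) $ Inl s'" by (simp add: z)
    also have "\<dots> = (\<Sum>sa\<in>UNIV. (case sa of (s, a) \<Rightarrow> - disc pb * Q s a s') * x $ Inl sa)
        + (\<Sum>t\<in>UNIV. of_bool (t = s') * x $ Inr t)"
      by (simp add: matrix_vector_mult_def Kmat_def sum_UNIV)
    also have "(\<Sum>t\<in>UNIV. of_bool (t = s') * x $ Inr t) = x $ Inr s'"
      by (simp add: of_bool_def if_distrib if_distribR sum.delta cong: if_cong)
    also have "(\<Sum>sa\<in>UNIV. (case sa of (s, a) \<Rightarrow> - disc pb * Q s a s') * x $ Inl sa)
        = (\<Sum>s\<in>UNIV. \<Sum>a\<in>UNIV. - disc pb * Q s a s' * x $ Inl (s, a))"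
      by (simp add: sum.cartesian_product UNIV_Times_UNIV[symmetric] case_prod_unfold del: UNIV_Times_UNIV)
    also have "\<dots> = - disc pb * (\<Sum>s\<in>UNIV. \<Sum>a\<in>UNIV. Q s a s' * pol pb \<theta> s a * x $ Inr s)"
      by (simp add: q sum_distrib_left mult.assoc sum_negf)
    finally show ?thesis by simp
  qed
  let ?n = "\<Sum>s\<in>UNIV. \<bar>x $ Inr s\<bar>"
  have "?n \<le> (\<Sum>s'\<in>UNIV. disc pb * (\<Sum>s\<in>UNIV. \<Sum>a\<in>UNIV. Q s a s' * pol pb \<theta> s a * \<bar>x $ Inr s\<bar>))"
  proof (rule sum_mono)
    fix s'
    have "\<bar>\<Sum>s\<in>UNIV. \<Sum>a\<in>UNIV. Q s a s' * pol pb \<theta> s a * x $ Inr s\<bar>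
        \<le> (\<Sum>s\<in>UNIV. \<Sum>a\<in>UNIV. \<bar>Q s a s' * pol pb \<theta> s a * x $ Inr s\<bar>)"
      by (intro order_trans[OF sum_abs] sum_mono sum_abs)
    also have "\<dots> = (\<Sum>s\<in>UNIV. \<Sum>a\<in>UNIV. Q s a s' * pol pb \<theta> s a * \<bar>x $ Inr s\<bar>)"
      using Q pol by (simp add: abs_mult stochastic_kernel_def)
    finally show "\<bar>x $ Inr s'\<bar> \<le> disc pb * (\<Sum>s\<in>UNIV. \<Sum>a\<in>UNIV. Q s a s' * pol pb \<theta> s a * \<bar>x $ Inr s\<bar>)"
      using disc by (subst d) (simp add: abs_mult)
  qed
  also have "\<dots> = disc pb * (\<Sum>s\<in>UNIV. \<Sum>a\<in>UNIV. \<Sum>s'\<in>UNIV. Q s a s' * (pol pb \<theta> s a * \<bar>x $ Inr s\<bar>))"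
    unfolding sum_distrib_left[symmetric]
    by (subst sum.swap, intro arg_cong[where f="\<lambda>t. disc pb * t"] sum.cong refl, subst sum.swap) (simp add: mult.assoc)
  also have "\<dots> = disc pb * ?n"
    using Q pol by (simp add: sum_distrib_right[symmetric] stochastic_kernel_def)
  finally have "(1 - disc pb) * ?n \<le> 0" by (simp add: algebra_simps)
  then have "?n \<le> 0" using disc by (simp add: mult_le_0_iff)
  then have "?n = 0" by (intro antisym) (auto intro: sum_nonneg)
  then have r: "x $ Inr s = 0" for s by (simp add: sum_nonneg_eq_0_iff)
  have "x $ j = 0" for j by (cases j) (auto simp: r q split: prod.splits)
  then show ?thesis by (simp add: vec_eq_iff)
qed

lemma spec_norm_Kmat_le:
  fixes pb :: "('s::finite, 'a::finite, 'p::finite) occ_problem"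
  assumes disc: "0 < disc pb" "disc pb < 1" and Q: "stochastic_kernel Q"
    and pol: "\<And>s a. 0 \<le> pol pb \<theta> s a" "\<And>s. (\<Sum>a\<in>UNIV. pol pb \<theta> s a) = 1"
  shows "spec_norm (Kmat pb Q \<theta>) \<le> real (CARD('s + ('s \<times> 'a))) * real (CARD(('s \<times> 'a) + 's))"
proof -
  have pol1: "pol pb \<theta> s a \<le> 1" for s a
    using member_le_sum[of a UNIV "pol pb \<theta> s"] pol by simp
  have "\<bar>disc pb * Q s a s'\<bar> \<le> 1" for s a s'
    using disc stochastic_kernel_le_1[OF Q, of s a s'] by (simp add: abs_mult mult_le_one)
  then have "\<bar>Kmat pb Q \<theta> $ i $ j\<bar> \<le> 1" for i j
    using pol(1) pol1 by (auto simp: Kmat_def split: sum.splits prod.splits)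
  from spec_norm_le_entries[OF this] show ?thesis by simp
qed

subsection \<open>Smooth and proximal steps\<close>

lemma gderiv_unique: "GDERIV f u :> D \<Longrightarrow> GDERIV f u :> D' \<Longrightarrow> D = D'"
  unfolding gderiv_def by (drule (1) has_derivative_unique) (simp add: fun_eq_iff vector_eq_ldot)

lemma grad_eq: "GDERIV f u :> D \<Longrightarrow> grad f u = D"
  unfolding grad_def by (rule the_equality) (auto intro: gderiv_unique)

text \<open>The descent lemma on a single segment, since the Lipschitz constant of the gradient is
  assumed only between consecutive policy iterates.\<close>

lemma lipschitz_gradient_upper_bound:
  fixes f :: "'a::real_inner \<Rightarrow> real"
  assumes deriv: "\<And>u. u \<in> closed_segment a b \<Longrightarrow> GDERIV f u :> g u"
    and lip: "\<And>u v. u \<in> closed_segment a b \<Longrightarrow> v \<in> closed_segment a b \<Longrightarrow>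
      norm (g u - g v) \<le> L * norm (u - v)"
  shows "f b \<le> f a + g a \<bullet> (b - a) + L / 2 * (norm (b - a))\<^sup>2"
proof -
  let ?d = "b - a"
  \<comment> \<open>Along the segment this is the function minus its claimed quadratic majorant, up
    to a constant; the Lipschitz bound makes its derivative nonpositive.\<close>
  define h where "h t = f (a + t *\<^sub>R ?d) - t * (g a \<bullet> ?d) - L / 2 * t\<^sup>2 * (norm ?d)\<^sup>2" for t :: real
  have "h 1 \<le> h 0"
  proof (rule DERIV_nonpos_imp_nonincreasing[where f=h and a=0 and b=1])
    fix t :: real assume t: "0 \<le> t" "t \<le> 1"
    let ?u = "a + t *\<^sub>R ?d"
    have seg: "?u \<in> closed_segment a b" "a \<in> closed_segment a b"
      using t by (auto simp: in_segment algebra_simps intro!: exI[of _ t])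
    have "((\<lambda>t. f (a + t *\<^sub>R ?d)) has_derivative (\<lambda>s. (s *\<^sub>R ?d) \<bullet> g ?u)) (at t)"
      using deriv[OF seg(1)] unfolding gderiv_def
      by (rule has_derivative_compose[rotated, where g=f]) (auto intro!: derivative_eq_intros)
    then have D: "((\<lambda>t. f (a + t *\<^sub>R ?d)) has_real_derivative g ?u \<bullet> ?d) (at t)"
      by (simp add: has_field_derivative_def inner_commute mult_commute_abs)
    have "(h has_real_derivative (g ?u \<bullet> ?d - g a \<bullet> ?d - L / 2 * (2 * t) * (norm ?d)\<^sup>2)) (at t)"
      unfolding h_def by (rule derivative_eq_intros D refl | simp)+
    moreover have "g ?u \<bullet> ?d - g a \<bullet> ?d \<le> L * t * (norm ?d)\<^sup>2"
    proof -
      have "g ?u \<bullet> ?d - g a \<bullet> ?d \<le> norm (g ?u - g a) * norm ?d"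
        using norm_cauchy_schwarz[of "g ?u - g a" ?d] by (simp add: inner_diff_left)
      also have "\<dots> \<le> (L * norm (?u - a)) * norm ?d"
        by (intro mult_right_mono lip seg) auto
      finally show ?thesis using t by (simp add: power2_eq_square mult.assoc)
    qed
    ultimately show "\<exists>y. (h has_real_derivative y) (at t) \<and> y \<le> 0"
      by (auto intro!: exI)
  qed simp
  then show ?thesis by (simp add: h_def)
qed

lemma linear_le_quadratic_imp_zero:
  fixes N C :: real
  assumes "0 \<le> C" "\<And>t. t * N \<le> t\<^sup>2 * C"
  shows "N = 0"
proof (rule ccontr)
  assume "N \<noteq> 0"
  \<comment> \<open>With this t the left side becomes t^2 (C + 1), which exceeds t^2 C unless t = 0.
    The added 1 keeps the denominator positive for C = 0.\<close>
  define t where "t = N / (C + 1)"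
  have N: "N = t * (C + 1)" using assms(1) by (simp add: t_def)
  have "t * (t * (C + 1)) \<le> t\<^sup>2 * C" using assms(2)[of t] by (simp add: N)
  then have "t * t \<le> 0" by (simp add: power2_eq_square algebra_simps)
  then have "t = 0" by (auto simp: mult_le_0_iff)
  then show False using \<open>N \<noteq> 0\<close> N by simp
qed

lemma norm_diff_scaleR_sq:
  fixes v w :: "'a::real_inner"
  shows "(norm (v - t *\<^sub>R w))\<^sup>2 = (norm v)\<^sup>2 - 2 * t * (v \<bullet> w) + t\<^sup>2 * (norm w)\<^sup>2"
  unfolding power2_norm_eq_inner inner_diff_left inner_diff_right inner_scaleR_left inner_scaleR_right
    inner_commute[of w v] by (simp add: power2_eq_square algebra_simps)

text \<open>The objective is exactly quadratic, so a move by -t g along its gradient g at the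
  minimizer changes it by -t |g|^2 + t^2 C. Minimality for all t forces g = 0.\<close>

lemma prox_step_stationary:
  fixes A :: "real^'n^'m"
  assumes min: "is_arg_min (\<lambda>u. c \<bullet> u + (y \<bullet> (A *v u - b) + \<beta> / 2 * (norm (A *v u - b))\<^sup>2)
      + 1 / (2 * e) * (norm (u - x))\<^sup>2) (\<lambda>_. True) x'"
    and e: "0 < e" and \<beta>: "0 < \<beta>"
  shows "c + transpose A *v (y + \<beta> *\<^sub>R (A *v x' - b)) + (1 / e) *\<^sub>R (x' - x) = 0"
proof -
  let ?f = "\<lambda>u. c \<bullet> u + (y \<bullet> (A *v u - b) + \<beta> / 2 * (norm (A *v u - b))\<^sup>2)
      + 1 / (2 * e) * (norm (u - x))\<^sup>2"
  define g where "g = c + transpose A *v (y + \<beta> *\<^sub>R (A *v x' - b)) + (1 / e) *\<^sub>R (x' - x)"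
  define C where "C = \<beta> / 2 * (norm (A *v g))\<^sup>2 + 1 / (2 * e) * (norm g)\<^sup>2"
  have "t * (g \<bullet> g) \<le> t\<^sup>2 * C" for t
  proof -
    have "?f x' \<le> ?f (x' - t *\<^sub>R g)"
      using min unfolding is_arg_min_def by (simp add: not_less)
    also have "?f (x' - t *\<^sub>R g) = ?f x' - t * (g \<bullet> g) + t\<^sup>2 * C"
    proof -
      have 1: "A *v (x' - t *\<^sub>R g) - b = (A *v x' - b) - t *\<^sub>R (A *v g)"
        by (simp add: matrix_vector_mult_diff_distrib matrix_vector_mult_scaleR)
      have 2: "x' - t *\<^sub>R g - x = (x' - x) - t *\<^sub>R g" by simp
      have 3: "g \<bullet> g = c \<bullet> g + (y \<bullet> (A *v g) + \<beta> * ((A *v x' - b) \<bullet> (A *v g))) + (1 / e) * ((x' - x) \<bullet> g)"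
        by (subst (1) g_def) (simp add: inner_add_left inner_transpose_vector del: transpose_matrix_vector)
      note 4 = norm_diff_scaleR_sq
      show ?thesis
        unfolding 1 2 4 C_def inner_diff_right inner_scaleR_right 3
        using e by (simp add: field_simps)
    qed
    finally show ?thesis by simp
  qed
  moreover have "0 \<le> C" using e \<beta> by (simp add: C_def)
  ultimately have "g \<bullet> g = 0" by (rule linear_le_quadratic_imp_zero[rotated])
  then show ?thesis by (simp add: g_def)
qed

text \<open>Fermat's rule for a proximal step without convexity. The quadratic term is o(|t - u|),
  so the vector is already a regular subgradient, and constant sequences witness the limit.\<close>

lemma limiting_subdiff_prox_step:
  fixes f :: "'b::real_inner \<Rightarrow> ereal"
  assumes fin: "\<bar>f u\<bar> \<noteq> \<infinity>" and e: "0 < e"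
    and min: "\<And>t. f u + ereal (g \<bullet> (u - z) + 1 / (2 * e) * (norm (u - z))\<^sup>2)
        \<le> f t + ereal (g \<bullet> (t - z) + 1 / (2 * e) * (norm (t - z))\<^sup>2)"
  shows "- (g + (1 / e) *\<^sub>R (u - z)) \<in> limiting_subdiff f u"
proof -
  let ?v = "- (g + (1 / e) *\<^sub>R (u - z))"
  obtain fu where fu: "f u = ereal fu" using fin by auto
  have "?v \<in> regular_subdiff f u"
    unfolding regular_subdiff_def
  proof (safe intro!: fin)
    fix \<epsilon> :: real assume \<epsilon>: "0 < \<epsilon>"
    \<comment> \<open>Within this radius the quadratic remainder |t - u|^2 / (2 e) is at most
      \<epsilon> |t - u|.\<close>
    have "\<forall>\<^sub>F t in at u. dist t u < 2 * e * \<epsilon>"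
      using e \<epsilon> by (auto simp: eventually_at intro!: exI[of _ "2 * e * \<epsilon>"])
    then show "\<forall>\<^sub>F t in at u. f u + ereal (?v \<bullet> (t - u) - \<epsilon> * norm (t - u)) \<le> f t"
    proof eventually_elim
      case (elim t)
      let ?n = "norm (t - u)"
      have "?n * ?n \<le> (2 * e * \<epsilon>) * ?n"
        using elim by (intro mult_right_mono) (auto simp: dist_norm)
      then have n: "1 / (2 * e) * ?n\<^sup>2 \<le> \<epsilon> * ?n"
        using e by (simp add: power2_eq_square field_simps)
      have sq_add: "(norm (p + r))\<^sup>2 = (norm p)\<^sup>2 + 2 * (r \<bullet> p) + (norm r)\<^sup>2" for p r :: 'b
        by (simp add: power2_norm_eq_inner inner_add_left inner_add_right inner_commute)
      have sq: "(norm (t - z))\<^sup>2 = ?n\<^sup>2 + 2 * ((u - z) \<bullet> (t - u)) + (norm (u - z))\<^sup>2"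
        using sq_add[of "t - u" "u - z"] by simp
      have gt: "g \<bullet> (t - z) = g \<bullet> (t - u) + g \<bullet> (u - z)" by (simp add: inner_diff_right)
      have vt: "?v \<bullet> (t - u) = - (g \<bullet> (t - u)) - (1 / e) * ((u - z) \<bullet> (t - u))"
        by (simp add: inner_diff_left)
      show ?case
      proof (cases "f t")
        case (real ft)
        have "fu + (g \<bullet> (u - z) + 1 / (2 * e) * (norm (u - z))\<^sup>2)
            \<le> ft + (g \<bullet> (t - z) + 1 / (2 * e) * (norm (t - z))\<^sup>2)"
          using min[of t] by (simp add: fu real)
        moreover have "1 / (2 * e) * (norm (t - z))\<^sup>2
            = 1 / (2 * e) * ?n\<^sup>2 + (1 / e) * ((u - z) \<bullet> (t - u)) + 1 / (2 * e) * (norm (u - z))\<^sup>2"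
          unfolding sq using e by (simp add: field_simps)
        ultimately have "fu + (?v \<bullet> (t - u) - \<epsilon> * ?n) \<le> ft"
          unfolding gt vt using n by linarith
        then show ?thesis by (simp add: fu real)
      next
        case MInf
        then show ?thesis using min[of t] by (simp add: fu)
      qed simp
    qed
  qed
  then show ?thesis
    unfolding limiting_subdiff_def using fin
    by (intro CollectI conjI exI[of _ "\<lambda>_. u"] exI[of _ "\<lambda>_. ?v"]) auto
qed

lemma dist0_le: "v \<in> S \<Longrightarrow> dist0 S \<le> ennreal (norm v)"
  unfolding dist0_def by (rule INF_lower)

subsection \<open>Dependence of the constraints on the policy parameter\<close>

text \<open>The matrix is affine in the policy probabilities: \<open>K0\<close> collects the entries
  free of \<theta>, and \<open>E sa\<close> is the coefficient of the probability of
  \<open>sa\<close>.\<close>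

lemma Kmat_differentiable:
  fixes pb :: "('s::finite, 'a::finite, 'p::finite) occ_problem"
  assumes "\<And>s a. (\<lambda>\<theta>. pol pb \<theta> s a) differentiable (at \<theta>)"
  shows "Kmat pb Q differentiable (at \<theta>)"
proof -
  define K0 :: "real^(('s \<times> 'a) + 's)^('s + ('s \<times> 'a))" where
    "K0 = (\<chi> i j. case i of Inl s' \<Rightarrow> (case j of Inl (s, a) \<Rightarrow> - disc pb * Q s a s' | Inr s \<Rightarrow> of_bool (s = s'))
      | Inr sa' \<Rightarrow> (case j of Inl sa \<Rightarrow> of_bool (sa = sa') | Inr t \<Rightarrow> 0))"
  define E :: "('s \<times> 'a) \<Rightarrow> real^(('s \<times> 'a) + 's)^('s + ('s \<times> 'a))" where
    "E sa = (\<chi> i j. case i of Inl s' \<Rightarrow> 0 | Inr sa' \<Rightarrow> (case j of Inl _ \<Rightarrow> 0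
       | Inr t \<Rightarrow> if sa = sa' then (if t = fst sa' then - 1 else 0) else 0))" for sa
  have eq: "Kmat pb Q = (\<lambda>\<theta>. K0 + (\<Sum>sa\<in>UNIV. pol pb \<theta> (fst sa) (snd sa) *\<^sub>R E sa))"
  proof (intro ext, unfold vec_eq_iff, intro allI)
    fix \<theta> i j
    have "(\<Sum>sa\<in>UNIV. pol pb \<theta> (fst sa) (snd sa) * E sa $ i $ j)
        = (case i of Inl _ \<Rightarrow> 0 | Inr (s, a) \<Rightarrow> (case j of Inl _ \<Rightarrow> 0 | Inr t \<Rightarrow> if t = s then - pol pb \<theta> s a else 0))"
      by (cases i; cases j)
        (auto simp: E_def if_distrib sum.delta case_prod_unfold cong: if_cong)
    then show "Kmat pb Q \<theta> $ i $ j = (K0 + (\<Sum>sa\<in>UNIV. pol pb \<theta> (fst sa) (snd sa) *\<^sub>R E sa)) $ i $ j"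
      by (cases i; cases j) (auto simp: sum_component Kmat_def K0_def split: prod.splits)
  qed
  show ?thesis unfolding eq
    by (intro differentiable_add differentiable_const differentiable_sum differentiable_scaleR ballI assms) auto
qed

definition policy_gradient :: "('s::finite, 'a::finite, 'p::finite) occ_problem \<Rightarrow> real^'p
    \<Rightarrow> real^(('s \<times> 'a) + 's) \<Rightarrow> real^('s + ('s \<times> 'a)) \<Rightarrow> real^'p" where
  "policy_gradient pb \<theta> x w = transpose (jacobian (\<lambda>t. Fmap pb (true_kernel pb) t x) (at \<theta>)) *v w"

context
  fixes pb :: "('s::finite, 'a::finite, 'p::finite) occ_problem" and \<theta> :: "real^'p"
  assumes pol_diff: "\<And>s a. (\<lambda>\<theta>. pol pb \<theta> s a) differentiable (at \<theta>)"
begin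

text \<open>Exchanging the kernel shifts the matrix by a constant, so the derivative taken with the
  true kernel serves every \<open>Q\<close>, in particular the empirical one.\<close>

lemma Fmap_has_derivative:
  "((\<lambda>t. Fmap pb Q t x) has_derivative
      (\<lambda>h. frechet_derivative (Kmat pb (true_kernel pb)) (at \<theta>) h *v x)) (at \<theta>)"
proof -
  let ?K' = "frechet_derivative (Kmat pb (true_kernel pb)) (at \<theta>)"
  have "(Kmat pb (true_kernel pb) has_derivative ?K') (at \<theta>)"
    using Kmat_differentiable[OF pol_diff] by (simp add: frechet_derivative_works)
  then have "((\<lambda>t. Kmat pb (true_kernel pb) t + (Kmat pb Q \<theta> - Kmat pb (true_kernel pb) \<theta>))
      has_derivative ?K') (at \<theta>)"
    by (auto intro!: derivative_eq_intros)
  moreover have "(\<lambda>t. Kmat pb (true_kernel pb) t + (Kmat pb Q \<theta> - Kmat pb (true_kernel pb) \<theta>)) = Kmat pb Q"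
  proof
    fix t
    show "Kmat pb (true_kernel pb) t + (Kmat pb Q \<theta> - Kmat pb (true_kernel pb) \<theta>) = Kmat pb Q t"
      unfolding Kmat_diff_indep[of pb Q \<theta> _ t] by simp
  qed
  ultimately have K: "(Kmat pb Q has_derivative ?K') (at \<theta>)" by simp
  have "linear (\<lambda>A :: real^(('s \<times> 'a) + 's)^('s + ('s \<times> 'a)). A *v x)"
    by (rule linearI) (auto simp: matrix_vector_mult_add_rdistrib scaleR_matrix_vector_assoc)
  then have "bounded_linear (\<lambda>A :: real^(('s \<times> 'a) + 's)^('s + ('s \<times> 'a)). A *v x)"
    by (simp add: linear_conv_bounded_linear)
  from bounded_linear.has_derivative[OF this K] show ?thesis
    unfolding Fmap_def by (auto intro!: derivative_eq_intros)
qed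

lemma inner_policy_gradient:
  "policy_gradient pb \<theta> x w \<bullet> h = w \<bullet> (frechet_derivative (Kmat pb (true_kernel pb)) (at \<theta>) h *v x)"
proof -
  let ?F = "\<lambda>t. Fmap pb (true_kernel pb) t x"
  have "?F differentiable (at \<theta>)" using Fmap_has_derivative by (rule differentiableI)
  then have "(?F has_derivative (\<lambda>h. jacobian ?F (at \<theta>) *v h)) (at \<theta>)" by (simp add: jacobian_works)
  then have "jacobian ?F (at \<theta>) *v h = frechet_derivative (Kmat pb (true_kernel pb)) (at \<theta>) h *v x"
    using has_derivative_unique[OF Fmap_has_derivative] by metis
  then show ?thesis
    by (simp add: policy_gradient_def inner_transpose_vector del: transpose_matrix_vector)
qed

lemma policy_gradient_diff:
  "policy_gradient pb \<theta> x w - policy_gradient pb \<theta> x' w' =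
     policy_gradient pb \<theta> (x - x') w + policy_gradient pb \<theta> x' (w - w')"
  by (rule vector_eq_rdot[THEN iffD1], intro allI)
    (simp add: inner_diff_left inner_add_left inner_policy_gradient matrix_vector_mult_diff_distrib inner_diff_right)

lemma norm_policy_gradient_le:
  assumes D: "\<And>h. spec_norm (frechet_derivative (Kmat pb (true_kernel pb)) (at \<theta>) h) \<le> D * norm h"
  shows "norm (policy_gradient pb \<theta> x w) \<le> D * norm x * norm w"
proof -
  let ?v = "policy_gradient pb \<theta> x w" and ?K' = "frechet_derivative (Kmat pb (true_kernel pb)) (at \<theta>)"
  have "norm ?v * norm ?v = w \<bullet> (?K' ?v *v x)"
    using inner_policy_gradient[of x w ?v] by (simp add: power2_norm_eq_inner flip: power2_eq_square)
  also have "\<dots> \<le> norm w * norm (?K' ?v *v x)" by (rule norm_cauchy_schwarz)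
  also have "\<dots> \<le> norm w * (spec_norm (?K' ?v) * norm x)"
    by (intro mult_left_mono norm_matrix_vector_le) auto
  also have "\<dots> \<le> norm w * ((D * norm ?v) * norm x)"
    by (intro mult_left_mono mult_right_mono D) auto
  finally have *: "norm ?v * norm ?v \<le> (D * norm x * norm w) * norm ?v" by (simp add: ac_simps)
  show ?thesis
  proof (cases "?v = 0")
    case True
    \<comment> \<open>When the gradient vanishes, the claim needs \<open>D\<close> to be
      nonnegative; a unit vector in the hypothesis shows it.\<close>
    have "0 \<le> D * norm (axis undefined 1 :: real^'p)"
      using D[of "axis undefined 1"] spec_norm_nonneg order_trans by blast
    then have "0 \<le> D" by (simp add: norm_axis_1)
    then show ?thesis using True by simp
  qed (use * in auto)
qed

text \<open>The derivative is paired with y + \<beta> F, the value that a dual update would give.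
  Comparing it with the multiplier of the next iterate therefore costs only the change of x.\<close>

lemma gderiv_aug_term:
  "GDERIV (aug_term pb \<beta> Q x y) \<theta> :> policy_gradient pb \<theta> x (y + \<beta> *\<^sub>R Fmap pb Q \<theta> x)"
proof -
  let ?K' = "frechet_derivative (Kmat pb (true_kernel pb)) (at \<theta>)"
  let ?F = "Fmap pb Q \<theta> x"
  have "((\<lambda>t. y \<bullet> Fmap pb Q t x + \<beta> / 2 * (Fmap pb Q t x \<bullet> Fmap pb Q t x)) has_derivative
     (\<lambda>h. y \<bullet> (?K' h *v x) + \<beta> / 2 * (?F \<bullet> (?K' h *v x) + (?K' h *v x) \<bullet> ?F))) (at \<theta>)"
    by (auto intro!: derivative_eq_intros Fmap_has_derivative)
  moreover have "y \<bullet> (?K' h *v x) + \<beta> / 2 * (?F \<bullet> (?K' h *v x) + (?K' h *v x) \<bullet> ?F)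
      = h \<bullet> policy_gradient pb \<theta> x (y + \<beta> *\<^sub>R ?F)" for h
    unfolding inner_commute[of h] inner_policy_gradient
    by (simp add: inner_add_left inner_commute[of "_ *v _" ?F])
  moreover have "aug_term pb \<beta> Q x y = (\<lambda>t. y \<bullet> Fmap pb Q t x + \<beta> / 2 * (Fmap pb Q t x \<bullet> Fmap pb Q t x))"
    by (simp add: fun_eq_iff aug_term_def power2_norm_eq_inner)
  ultimately show ?thesis by (simp add: gderiv_def)
qed

lemmas grad_aug_term = grad_eq[OF gderiv_aug_term]

end

subsection \<open>Projected kernels are stochastic\<close>

lemma prob_simplex_closed: "closed (prob_simplex :: (real^'s::finite) set)"
proof -
  have "prob_simplex = (\<Inter>s. {v :: real^'s. 0 \<le> v $ s}) \<inter> {v. (\<Sum>s\<in>UNIV. v $ s) = 1}"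
    by (auto simp: prob_simplex_def)
  also have "closed \<dots>"
    by (intro closed_Int closed_INT ballI closed_Collect_le closed_Collect_eq continuous_intros)
  finally show ?thesis .
qed

lemma prob_simplex_convex: "convex (prob_simplex :: (real^'s::finite) set)"
  by (rule convexI) (auto simp: prob_simplex_def sum.distrib sum_distrib_left[symmetric])

lemma prob_simplex_nonempty: "(prob_simplex :: (real^'s::finite) set) \<noteq> {}"
proof -
  have "axis undefined 1 \<in> (prob_simplex :: (real^'s::finite) set)"
    by (auto simp: prob_simplex_def axis_def)
  then show ?thesis by blast
qed

lemma stochastic_emp_kernel: "stochastic_kernel (emp_kernel pb \<theta> zs)"
  for pb :: "('s::finite, 'a, 'p::finite) occ_problem"
proof -
  have "closest_point prob_simplex v \<in> prob_simplex" for v :: "real^'s"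
    by (rule closest_point_in_set[OF prob_simplex_closed prob_simplex_nonempty])
  then show ?thesis
    by (auto simp: stochastic_kernel_def emp_kernel_def prob_simplex_def)
qed

subsection \<open>Elementary inequalities\<close>

lemma power2_sum2_le: "(a + b)\<^sup>2 \<le> 2 * (a\<^sup>2 + b\<^sup>2)" for a b :: real
  using sum_squares_bound[of a b] by (simp add: power2_sum)

lemma power2_sum3_le: "(a + b + c)\<^sup>2 \<le> 3 * (a\<^sup>2 + b\<^sup>2 + c\<^sup>2)" for a b c :: real
proof -
  have "3 * (a\<^sup>2 + b\<^sup>2 + c\<^sup>2) - (a + b + c)\<^sup>2 = (a - b)\<^sup>2 + (b - c)\<^sup>2 + (a - c)\<^sup>2"
    by (simp add: power2_eq_square algebra_simps)
  then show ?thesis by (smt (verit) zero_le_power2)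
qed

lemma young: "0 < \<epsilon> \<Longrightarrow> d * (C * t) \<le> \<epsilon> * t\<^sup>2 + C\<^sup>2 / (4 * \<epsilon>) * d\<^sup>2" for \<epsilon> C d t :: real
proof -
  assume e: "0 < \<epsilon>"
  have "0 \<le> \<epsilon> * (t - C * d / (2 * \<epsilon>))\<^sup>2" using e by simp
  also have "\<dots> = \<epsilon> * t\<^sup>2 + C\<^sup>2 / (4 * \<epsilon>) * d\<^sup>2 - d * (C * t)"
    using e by (simp add: power2_eq_square field_simps)
  finally show ?thesis by simp
qed

subsection \<open>Problem data and constants\<close>

locale occ_setup =
  fixes pb :: "('s::finite, 'a::finite, 'p::finite) occ_problem"
    and pr :: admm_params
    and \<theta>0 :: "real^'p"
    and x0 :: "real^(('s \<times> 'a) + 's)"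
    and y0 :: "real^('s + ('s \<times> 'a))"
  assumes pb_ok: "problem_ok pb" and pr_ok: "params_ok pb pr" and psi_\<theta>0: "psi pb \<theta>0 < \<infinity>"
begin

abbreviation "P \<equiv> true_kernel pb"
abbreviation "\<beta> \<equiv> pen pr"
abbreviation "e \<equiv> eta_x pr"
abbreviation "\<kappa> \<equiv> kappa pr"
abbreviation "c \<equiv> cvec pb"
abbreviation "b \<equiv> bvec pb"
abbreviation "a \<equiv> a_theta pr"

section \<open>Constants of the deterministic estimates\<close>

text \<open>The number of matrix entries: entries of modulus at most 1 give a spectral norm of at
  most this size, and entrywise kernel errors are scaled by the same number.\<close>

definition "K_bound = real (CARD('s + ('s \<times> 'a))) * real (CARD(('s \<times> 'a) + 's))"
text \<open>The part of the recursion for the norm of x that is free of previous iterates. The last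
  summand accounts for the initial multiplier.\<close>

definition "x_offset = \<kappa> * norm b + 2 * \<kappa>\<^sup>2 * norm c / \<beta> + \<kappa> * norm y0 / \<beta>"
definition "x_radius = 2 * x_offset + norm x0"
definition "y_radius = \<kappa> * (norm c + 2 * x_radius / e) + norm y0"
definition "F_radius = K_bound * x_radius + norm b"
text \<open>The parameter conditions assert only that some derivative bound exists; this selects one
  that is also nonnegative.\<close>

definition "K_deriv_bound = (SOME D. 0 \<le> D \<and> (\<forall>\<theta>\<in>Theta pb. \<forall>h.
  spec_norm (frechet_derivative (Kmat pb P) (at \<theta>) h) \<le> D * norm h))"
definition "initial_Phi = aug_lagrangian pb \<beta> \<theta>0 x0 y0"
text \<open>These two constants are the coefficients of delta times the primal step and of delta
  times the policy step when the kernel is exchanged, see \<open>kernel_error_diff\<close>.\<close>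

definition "x_coupling = y_radius + \<beta> * x_radius * K_bound + \<beta> * F_radius"
definition "theta_coupling = \<beta> * x_radius\<^sup>2 * L_K pr"
text \<open>In order: Young's inequality for the multiplier coupling, the quadratic kernel error,
  Young's inequality for the primal and the policy coupling, the kernel errors in the dual
  increment, and the crude bound for the first dual increment.\<close>

definition "descent_const = \<beta> / 2 * x_radius\<^sup>2 + \<beta> / 2 * x_radius\<^sup>2 + 2 * e * x_coupling\<^sup>2 + theta_coupling\<^sup>2 / (2 * a)
  + 3 / (2 * \<beta>) * (9 * \<kappa> ^ 4 * (norm c)\<^sup>2) + 3 / (2 * \<beta>) * (4 * y_radius\<^sup>2)"
text \<open>Absolute values absorb the unknown signs of the initial potential, of the infimum and of
  \<open>C0\<close>.\<close>

definition "potential_const = \<bar>initial_Phi\<bar> + \<bar>real_of_ereal (B_C_inf pb)\<bar> + 1 + 2 * descent_const + \<bar>C0 pr\<bar>"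
definition "policy_const = 2 * (\<bar>L_bar pr\<bar> + 1 / eta_low pr)\<^sup>2 + 2 * (K_deriv_bound * y_radius + K_deriv_bound * x_radius * (\<beta> * K_bound))\<^sup>2"
definition "dual_const = 3 * \<kappa>\<^sup>2 / e\<^sup>2 + A_C pb pr + 9 * \<kappa> ^ 4 * (norm c)\<^sup>2 + 4 * y_radius\<^sup>2"
definition "kkt_const = policy_const + (2 * y_radius\<^sup>2 + 2 / e\<^sup>2) + (2 * x_radius\<^sup>2 + 2 / \<beta>\<^sup>2 * dual_const)"
definition "descent_rate = min (a / 2) (1 / (8 * e))"
definition "kkt_sum_const = kkt_const * (2 * (potential_const / descent_rate) + 3)"

lemma disc: "0 < disc pb" "disc pb < 1"
  and Theta_convex: "convex (Theta pb)"
  and pol_nonneg: "\<theta> \<in> Theta pb \<Longrightarrow> 0 \<le> pol pb \<theta> s u"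
  and pol_sum: "\<theta> \<in> Theta pb \<Longrightarrow> (\<Sum>u\<in>UNIV. pol pb \<theta> s u) = 1"
  and psi_proper: "proper (psi pb)" and psi_lsc: "lsc (psi pb)"
  using pb_ok unfolding problem_ok_def by blast+

lemma pol_differentiable: "\<theta> \<in> Theta pb \<Longrightarrow> (\<lambda>\<theta>. pol pb \<theta> s u) differentiable (at \<theta>)"
  using pb_ok unfolding problem_ok_def by (metis differentiable_on_eq_differentiable_at subsetD)

lemma \<theta>0_in: "\<theta>0 \<in> Theta pb"
  using psi_\<theta>0 psi_proper by (auto simp: psi_def proper_def split: if_splits)

lemma psi_eq: "\<theta> \<in> Theta pb \<Longrightarrow> psi pb \<theta> = phi pb \<theta>"
  by (simp add: psi_def)

lemma phi_not_MInf: "\<theta> \<in> Theta pb \<Longrightarrow> phi pb \<theta> \<noteq> -\<infinity>"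
  using psi_proper psi_eq by (metis proper_def)

lemma phi_\<theta>0: "\<bar>phi pb \<theta>0\<bar> \<noteq> \<infinity>"
  using psi_\<theta>0 phi_not_MInf[OF \<theta>0_in] psi_eq[OF \<theta>0_in] by auto

lemma params: "0 < rho_min pr" "\<And>s. rho_min pr \<le> pmf (reset_pmf pb) s" "0 < pi_min pr"
  "0 < e" "36 * \<kappa>\<^sup>2 / e < \<beta>" "0 < eta_low pr" "0 < a" "0 < q_x pr"
  and K_lipschitz: "\<theta> \<in> Theta pb \<Longrightarrow> \<theta>' \<in> Theta pb \<Longrightarrow>
     spec_norm (Kmat pb P \<theta> - Kmat pb P \<theta>') \<le> L_K pr * norm (\<theta> - \<theta>')"
  and K_inv_le: "\<theta> \<in> Theta pb \<Longrightarrow> spec_norm (matrix_inv (Kmat pb P \<theta>)) \<le> \<kappa>"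
  using pr_ok unfolding params_ok_def by auto

lemma e_pos: "0 < e" by (rule params)

lemma \<kappa>_nonneg: "0 \<le> \<kappa>"
  using K_inv_le[OF \<theta>0_in] spec_norm_nonneg order_trans by blast

lemma \<beta>_pos: "0 < \<beta>"
proof -
  have "0 \<le> 36 * \<kappa>\<^sup>2 / e" using params by simp
  then show ?thesis using params by linarith
qed

text \<open>This ratio is the contraction factor for the primal iterates and also the price of the
  multiplier ascent: 9 / (2 e) times it is at most 1 / (8 e), one quarter of the decrease from the
  primal proximal term.\<close>

lemma penalty_ratio: "\<kappa>\<^sup>2 / (\<beta> * e) \<le> 1 / 36"
  using params \<beta>_pos by (simp add: field_simps)

lemma K_bound_nonneg: "0 \<le> K_bound" by (simp add: K_bound_def)

lemma x_offset_nonneg: "0 \<le> x_offset" using \<kappa>_nonneg \<beta>_pos by (simp add: x_offset_def)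

lemma x_radius_nonneg: "0 \<le> x_radius" using x_offset_nonneg by (simp add: x_radius_def)

lemma y_radius_nonneg: "0 \<le> y_radius" using \<kappa>_nonneg x_radius_nonneg e_pos by (simp add: y_radius_def)

lemma F_radius_nonneg: "0 \<le> F_radius" using K_bound_nonneg x_radius_nonneg by (simp add: F_radius_def)

lemma A_C_nonneg: "0 \<le> A_C pb pr" using \<kappa>_nonneg by (simp add: A_C_def)

lemma K_deriv_bound: "0 \<le> K_deriv_bound"
  "\<theta> \<in> Theta pb \<Longrightarrow> spec_norm (frechet_derivative (Kmat pb P) (at \<theta>) h) \<le> K_deriv_bound * norm h"
proof -
  obtain D where D: "\<forall>\<theta>\<in>Theta pb. \<forall>h. spec_norm (frechet_derivative (Kmat pb P) (at \<theta>) h) \<le> D * norm h"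
    using pr_ok unfolding params_ok_def by blast
  have "D * norm h \<le> \<bar>D\<bar> * norm h" for h :: "real^'p"
    by (intro mult_right_mono) auto
  then have "0 \<le> \<bar>D\<bar> \<and> (\<forall>\<theta>\<in>Theta pb. \<forall>h. spec_norm (frechet_derivative (Kmat pb P) (at \<theta>) h) \<le> \<bar>D\<bar> * norm h)"
    using D order_trans by fastforce
  then have "0 \<le> K_deriv_bound \<and> (\<forall>\<theta>\<in>Theta pb. \<forall>h. spec_norm (frechet_derivative (Kmat pb P) (at \<theta>) h) \<le> K_deriv_bound * norm h)"
    unfolding K_deriv_bound_def by (rule someI)
  then show "0 \<le> K_deriv_bound"
    "\<theta> \<in> Theta pb \<Longrightarrow> spec_norm (frechet_derivative (Kmat pb P) (at \<theta>) h) \<le> K_deriv_bound * norm h"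
    by auto
qed

lemma descent_const_nonneg: "0 \<le> descent_const"
  using \<beta>_pos e_pos params(7) by (simp add: descent_const_def)

lemma potential_const_nonneg: "0 \<le> potential_const" unfolding potential_const_def
  by (intro add_nonneg_nonneg mult_nonneg_nonneg abs_ge_zero descent_const_nonneg) auto

lemma policy_const_nonneg: "0 \<le> policy_const" by (simp add: policy_const_def)

lemma dual_const_nonneg: "0 \<le> dual_const" using A_C_nonneg by (simp add: dual_const_def)

lemma kkt_const_nonneg: "0 \<le> kkt_const" using policy_const_nonneg dual_const_nonneg by (simp add: kkt_const_def)

lemma descent_rate_pos: "0 < descent_rate" using params(7) e_pos by (simp add: descent_rate_def)

lemma Kmat_bound: "stochastic_kernel Q \<Longrightarrow> \<theta> \<in> Theta pb \<Longrightarrow> spec_norm (Kmat pb Q \<theta>) \<le> K_bound"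
  unfolding K_bound_def by (intro spec_norm_Kmat_le disc pol_nonneg pol_sum)

lemma Kmat_invertible:
  assumes "stochastic_kernel Q" "\<theta> \<in> Theta pb"
  shows "matrix_inv (Kmat pb Q \<theta>) ** Kmat pb Q \<theta> = mat 1"
    "Kmat pb Q \<theta> ** matrix_inv (Kmat pb Q \<theta>) = mat 1"
proof -
  have "Kmat pb Q \<theta> *v x = 0 \<Longrightarrow> x = 0" for x
    by (rule inj_Kmat) (use assms disc pol_nonneg pol_sum in auto)
  from invertible_if_injective[of "Kmat pb Q \<theta>", OF _ this]
  show "matrix_inv (Kmat pb Q \<theta>) ** Kmat pb Q \<theta> = mat 1"
    "Kmat pb Q \<theta> ** matrix_inv (Kmat pb Q \<theta>) = mat 1"
    by (auto simp: card_UNIV_sum)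
qed

end

subsection \<open>One realization of the algorithm\<close>

locale admm_path = occ_setup pb pr \<theta>0 x0 y0
  for pb :: "('s::finite, 'a::finite, 'p::finite) occ_problem" and pr \<theta>0 x0 y0 +
  fixes M :: "'w measure" and R :: "('w, 's, 'a, 'p) run" and \<omega> :: 'w
  assumes updates: "updates_ok pb pr \<theta>0 x0 y0 M R" and regular: "regularity_ok pb pr M R"
    and \<omega>_in: "\<omega> \<in> space M"
begin

abbreviation "thp k \<equiv> th R k \<omega>"
abbreviation "xp k \<equiv> xx R k \<omega>"
abbreviation "yp k \<equiv> yy R k \<omega>"
abbreviation "Qp k \<equiv> Phat pb R k \<omega>"
abbreviation "dl k \<equiv> delta pb R k \<omega>"
abbreviation "dlp k \<equiv> delta_prev pb R k \<omega>"
abbreviation "dth k \<equiv> thp (Suc k) - thp k"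
abbreviation "dxx k \<equiv> xp (Suc k) - xp k"
abbreviation "dyy k \<equiv> yp (Suc k) - yp k"

lemma init: "thp 0 = \<theta>0" "xp 0 = x0" "yp 0 = y0"
  and theta_min: "is_arg_min (\<lambda>t. phi pb t + ereal (grad (aug_term pb \<beta> (Qp k) (xp k) (yp k)) (thp k) \<bullet> (t - thp k)
        + 1 / (2 * eta R k) * (norm (t - thp k))\<^sup>2)) (\<lambda>t. t \<in> Theta pb) (thp (Suc k))"
  and x_min: "is_arg_min (\<lambda>u. c \<bullet> u + aug_term pb \<beta> (Qp k) u (yp k) (thp (Suc k))
        + 1 / (2 * e) * (norm (u - xp k))\<^sup>2) (\<lambda>_. True) (xp (Suc k))"
  and y_step: "yp (Suc k) = yp k + \<beta> *\<^sub>R Fmap pb (Qp k) (thp (Suc k)) (xp (Suc k))"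
proof -
  note u = bspec[OF updates[unfolded updates_ok_def Let_def] \<omega>_in]
  note v = u[THEN conjunct2, THEN conjunct2, THEN conjunct2, THEN spec, of k]
  show "thp 0 = \<theta>0" "xp 0 = x0" "yp 0 = y0" using u by simp_all
  show "is_arg_min (\<lambda>t. phi pb t + ereal (grad (aug_term pb \<beta> (Qp k) (xp k) (yp k)) (thp k) \<bullet> (t - thp k)
        + 1 / (2 * eta R k) * (norm (t - thp k))\<^sup>2)) (\<lambda>t. t \<in> Theta pb) (thp (Suc k))"
    by (rule v[THEN conjunct1])
  show "is_arg_min (\<lambda>u. c \<bullet> u + aug_term pb \<beta> (Qp k) u (yp k) (thp (Suc k))
        + 1 / (2 * e) * (norm (u - xp k))\<^sup>2) (\<lambda>_. True) (xp (Suc k))"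
    by (rule v[THEN conjunct2, THEN conjunct1])
  show "yp (Suc k) = yp k + \<beta> *\<^sub>R Fmap pb (Qp k) (thp (Suc k)) (xp (Suc k))"
    by (rule v[THEN conjunct2, THEN conjunct2])
qed

lemma thp_in: "thp k \<in> Theta pb"
proof (cases k)
  case 0
  then show ?thesis using init \<theta>0_in by simp
next
  case (Suc j)
  then show ?thesis using theta_min[of j, unfolded is_arg_min_def] by blast
qed

lemma eta_props: "eta_low pr \<le> eta R k" "0 < eta R k"
  "a \<le> 1 / (2 * eta R k) - L_bar pr / 2 - 3 * A_C pb pr / (2 * \<beta>)"
  using regular params(6) unfolding regularity_ok_def by (auto intro: less_le_trans)

lemma Qp_stochastic: "stochastic_kernel (Qp k)"
  unfolding Phat_def by (rule stochastic_emp_kernel)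

lemma Khat_inv_le: "\<theta> \<in> Theta pb \<Longrightarrow> spec_norm (matrix_inv (Kmat pb (Qp k) \<theta>)) \<le> \<kappa>"
  and segment_lipschitz: "Q \<in> {P, Qp k} \<Longrightarrow> u \<in> closed_segment (thp k) (thp (Suc k)) \<Longrightarrow>
    v \<in> closed_segment (thp k) (thp (Suc k)) \<Longrightarrow>
    norm (grad (aug_term pb \<beta> Q (xp k) (yp k)) u - grad (aug_term pb \<beta> Q (xp k) (yp k)) v) \<le> L_bar pr * norm (u - v)"
  and Phi_lower: "1 \<le> k \<Longrightarrow> Phi pb pr R k \<omega> \<ge> real_of_ereal (B_C_inf pb)
          + \<beta> / 4 * (norm (Fmap pb P (thp k) (xp k)))\<^sup>2
          + q_x pr * (norm (dx R k \<omega>))\<^sup>2 - C0 pr * (dlp k)\<^sup>2"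
proof -
  note r = regular[unfolded regularity_ok_def]
  note s = bspec[OF r[THEN conjunct2, THEN conjunct1] \<omega>_in, THEN spec, of k]
  show "\<theta> \<in> Theta pb \<Longrightarrow> spec_norm (matrix_inv (Kmat pb (Qp k) \<theta>)) \<le> \<kappa>"
    using s[THEN conjunct1] by simp
  show "Q \<in> {P, Qp k} \<Longrightarrow> u \<in> closed_segment (thp k) (thp (Suc k)) \<Longrightarrow>
    v \<in> closed_segment (thp k) (thp (Suc k)) \<Longrightarrow>
    norm (grad (aug_term pb \<beta> Q (xp k) (yp k)) u - grad (aug_term pb \<beta> Q (xp k) (yp k)) v) \<le> L_bar pr * norm (u - v)"
    by (rule s[THEN conjunct2, THEN bspec, THEN bspec, THEN bspec])
  show "1 \<le> k \<Longrightarrow> Phi pb pr R k \<omega> \<ge> real_of_ereal (B_C_inf pb)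
          + \<beta> / 4 * (norm (Fmap pb P (thp k) (xp k)))\<^sup>2
          + q_x pr * (norm (dx R k \<omega>))\<^sup>2 - C0 pr * (dlp k)\<^sup>2"
    using bspec[OF r[THEN conjunct2, THEN conjunct2] \<omega>_in] by blast
qed

lemma delta_eq:
  assumes "\<theta> \<in> Theta pb" shows "dl k = spec_norm (Kmat pb (Qp k) \<theta> - Kmat pb P \<theta>)"
proof -
  have "dl k = (SUP \<theta>'\<in>Theta pb. spec_norm (Kmat pb (Qp k) \<theta> - Kmat pb P \<theta>))"
    unfolding delta_def by (intro SUP_cong refl arg_cong[where f=spec_norm] Kmat_diff_indep)
  also have "\<dots> = spec_norm (Kmat pb (Qp k) \<theta> - Kmat pb P \<theta>)"
    using assms by (intro cSUP_const) auto
  finally show ?thesis .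
qed

lemma delta_nonneg: "0 \<le> dl k"
  using delta_eq[OF \<theta>0_in] spec_norm_nonneg by simp

text \<open>A deterministic bound, used to obtain integrability of all random quantities.\<close>

lemma delta_le: "dl k \<le> 2 * K_bound"
proof -
  have "dl k \<le> spec_norm (Kmat pb (Qp k) \<theta>0) + spec_norm (Kmat pb P \<theta>0)"
    using spec_norm_triangle[of "Kmat pb (Qp k) \<theta>0" "- Kmat pb P \<theta>0"] delta_eq[OF \<theta>0_in]
    by (simp add: spec_norm_minus)
  then show ?thesis
    using Kmat_bound[OF Qp_stochastic \<theta>0_in, of k] Kmat_bound[OF stochastic_true_kernel[of pb] \<theta>0_in] by linarith
qed

lemma Khat_diff:
  assumes "\<theta> \<in> Theta pb" shows "norm ((Kmat pb (Qp k) \<theta> - Kmat pb P \<theta>) *v x) \<le> dl k * norm x"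
  unfolding delta_eq[OF assms] by (rule norm_matrix_vector_le)

section \<open>Boundedness of the iterates\<close>

text \<open>The penalty contributes \<beta> F to the multiplier in the optimality condition, and
  this is exactly the dual increment. So only the new multiplier appears.\<close>

lemma x_stationary: "transpose (Kmat pb (Qp k) (thp (Suc k))) *v yp (Suc k) = - c - (1 / e) *\<^sub>R dxx k"
proof -
  have "c + transpose (Kmat pb (Qp k) (thp (Suc k))) *v (yp k + \<beta> *\<^sub>R (Kmat pb (Qp k) (thp (Suc k)) *v xp (Suc k) - b))
      + (1 / e) *\<^sub>R dxx k = 0"
    by (rule prox_step_stationary[OF _ e_pos \<beta>_pos])
      (use x_min[of k] in \<open>simp only: aug_term_def Fmap_def\<close>)
  then have "c + transpose (Kmat pb (Qp k) (thp (Suc k))) *v yp (Suc k) + (1 / e) *\<^sub>R dxx k = 0"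
    unfolding y_step Fmap_def .
  then show ?thesis by (simp add: eq_neg_iff_add_eq_0 algebra_simps)
qed

lemma norm_dual_le:
  assumes "\<theta> \<in> Theta pb"
  shows "norm y \<le> \<kappa> * norm (transpose (Kmat pb (Qp k) \<theta>) *v y)"
  by (rule order_trans[OF norm_le_spec_norm_inv_transpose[OF Kmat_invertible(2)[OF Qp_stochastic[of k] assms]]])
    (intro mult_right_mono Khat_inv_le assms norm_ge_zero)

lemma norm_primal_le:
  assumes "\<theta> \<in> Theta pb"
  shows "norm x \<le> \<kappa> * norm (Kmat pb (Qp k) \<theta> *v x)"
  by (rule order_trans[OF norm_le_spec_norm_inv[OF Kmat_invertible(1)[OF Qp_stochastic[of k] assms]]])
    (intro mult_right_mono Khat_inv_le assms norm_ge_zero)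

lemma norm_yp_Suc: "norm (yp (Suc k)) \<le> \<kappa> * (norm c + norm (dxx k) / e)"
proof -
  have "norm (yp (Suc k)) \<le> \<kappa> * norm (- c - (1 / e) *\<^sub>R dxx k)"
    using norm_dual_le[OF thp_in[of "Suc k"], of "yp (Suc k)" k] unfolding x_stationary .
  also have "\<dots> \<le> \<kappa> * (norm c + norm (dxx k) / e)"
    using norm_triangle_ineq4[of "- c" "(1 / e) *\<^sub>R dxx k"] e_pos
    by (intro mult_left_mono \<kappa>_nonneg) simp
  finally show ?thesis .
qed

lemma Khat_xp_Suc: "Kmat pb (Qp k) (thp (Suc k)) *v xp (Suc k) = b + (1 / \<beta>) *\<^sub>R dyy k"
  using y_step[of k] \<beta>_pos by (simp add: Fmap_def)

lemma norm_xp_Suc: "norm (xp (Suc k)) \<le> \<kappa> * norm b + \<kappa> / \<beta> * norm (dyy k)"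
proof -
  have "norm (xp (Suc k)) \<le> \<kappa> * norm (b + (1 / \<beta>) *\<^sub>R dyy k)"
    using norm_primal_le[OF thp_in[of "Suc k"], of "xp (Suc k)" k] unfolding Khat_xp_Suc .
  also have "\<dots> \<le> \<kappa> * (norm b + norm (dyy k) / \<beta>)"
    using norm_triangle_ineq[of b "(1 / \<beta>) *\<^sub>R dyy k"] \<beta>_pos
    by (intro mult_left_mono \<kappa>_nonneg) simp
  finally show ?thesis by (simp add: algebra_simps)
qed

text \<open>The penalty condition makes the recursion for the norm of the primal iterates a contraction.\<close>

lemma norm_xp_le: "norm (xp k) \<le> x_radius"
proof -
  let ?q = "\<kappa>\<^sup>2 / (\<beta> * e)"
  \<comment> \<open>The bound on the current multiplier is a hypothesis because its origin varies:
    for k = 0 it is built into \<open>x_offset\<close>, later it follows from stationarity with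
    \<open>s\<close> the previous primal step.\<close>
  have step: "35 * norm (xp (Suc k)) \<le> 36 * x_offset + r"
    if y: "\<kappa> / \<beta> * norm (yp k) \<le> x_offset - \<kappa> * norm b - \<kappa>\<^sup>2 * norm c / \<beta> + ?q * s"
      and r: "norm (xp k) + s \<le> r" and s: "0 \<le> s" for k r s
  proof -
    have "norm (xp (Suc k)) \<le> \<kappa> * norm b + \<kappa> / \<beta> * (norm (yp (Suc k)) + norm (yp k))"
      using norm_xp_Suc[of k] mult_left_mono[OF norm_triangle_ineq4[of "yp (Suc k)" "yp k"], of "\<kappa> / \<beta>"] \<kappa>_nonneg \<beta>_pos
      by simp
    also have "\<dots> = \<kappa> * norm b + \<kappa> / \<beta> * norm (yp (Suc k)) + \<kappa> / \<beta> * norm (yp k)"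
      by (simp add: algebra_simps)
    also have "\<kappa> / \<beta> * norm (yp (Suc k)) \<le> \<kappa> / \<beta> * (\<kappa> * (norm c + norm (dxx k) / e))"
      using \<kappa>_nonneg \<beta>_pos by (intro mult_left_mono norm_yp_Suc) simp
    also have "\<dots> = \<kappa>\<^sup>2 * norm c / \<beta> + ?q * norm (dxx k)"
      using \<beta>_pos e_pos by (simp add: power2_eq_square field_simps)
    finally have "norm (xp (Suc k)) \<le> x_offset + ?q * (norm (dxx k) + s)"
      using y by (simp add: algebra_simps)
    also have "\<dots> \<le> x_offset + 1 / 36 * (norm (dxx k) + s)"
      using s by (intro add_left_mono mult_right_mono penalty_ratio) simp
    \<comment> \<open>After multiplication by 36, the triangle inequality for the primal step
      returns one copy of the new norm to the left side, which leaves 35.\<close>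
    finally show ?thesis
      using norm_triangle_ineq4[of "xp (Suc k)" "xp k"] r by (simp add: field_simps)
  qed
  have 1: "35 * norm (xp (Suc 0)) \<le> 36 * x_offset + norm x0"
  proof -
    have "\<kappa> / \<beta> * norm (yp 0) \<le> x_offset - \<kappa> * norm b - \<kappa>\<^sup>2 * norm c / \<beta> + ?q * 0"
      using \<beta>_pos by (simp add: init x_offset_def)
    from step[OF this, of "norm x0"] show ?thesis by (simp add: init)
  qed
  \<comment> \<open>Two consecutive iterates are carried along because the recursion involves the
    last two primal steps.\<close>
  have "norm (xp k) \<le> x_radius \<and> norm (xp (Suc k)) \<le> x_radius" for k
  proof (induction k)
    case 0
    show ?case using 1 x_offset_nonneg norm_ge_zero[of x0] unfolding x_radius_def init(2) by linarith
  next
    case (Suc k)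
    have "\<kappa> / \<beta> * norm (yp (Suc k)) \<le> \<kappa> / \<beta> * (\<kappa> * (norm c + norm (dxx k) / e))"
      using \<kappa>_nonneg \<beta>_pos by (intro mult_left_mono norm_yp_Suc) simp
    also have "\<dots> = \<kappa>\<^sup>2 * norm c / \<beta> + ?q * norm (dxx k)"
      using \<beta>_pos e_pos by (simp add: power2_eq_square field_simps)
    also have "\<dots> \<le> x_offset - \<kappa> * norm b - \<kappa>\<^sup>2 * norm c / \<beta> + ?q * norm (dxx k)"
      using \<beta>_pos \<kappa>_nonneg by (simp add: x_offset_def mult.commute)
    finally have "35 * norm (xp (Suc (Suc k))) \<le> 36 * x_offset + 3 * x_radius"
      using step[of "Suc k" "norm (dxx k)" "3 * x_radius"] Suc norm_triangle_ineq4[of "xp (Suc k)" "xp k"] by simp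
    \<comment> \<open>It remains that 36 \<open>x_offset\<close> is at most 32
      \<open>x_radius\<close>, which holds because the radius is at least twice the offset.\<close>
    then have "35 * norm (xp (Suc (Suc k))) \<le> 35 * x_radius"
      using x_offset_nonneg norm_ge_zero[of x0] unfolding x_radius_def distrib_left by linarith
    then show ?case using Suc by simp
  qed
  then show ?thesis by blast
qed

lemma norm_yp_le: "norm (yp k) \<le> y_radius"
proof (cases k)
  case 0
  then show ?thesis using \<kappa>_nonneg x_radius_nonneg e_pos by (simp add: init y_radius_def)
next
  case (Suc j)
  have "norm (dxx j) \<le> 2 * x_radius"
    using norm_triangle_ineq4[of "xp (Suc j)" "xp j"] norm_xp_le[of j] norm_xp_le[of "Suc j"] by linarith
  then have "\<kappa> * (norm c + norm (dxx j) / e) \<le> \<kappa> * (norm c + 2 * x_radius / e)"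
    using e_pos by (intro mult_left_mono add_left_mono divide_right_mono \<kappa>_nonneg) auto
  then show ?thesis using norm_yp_Suc[of j] norm_ge_zero[of y0] unfolding Suc y_radius_def by linarith
qed

section \<open>Increments of the multiplier\<close>

text \<open>Stationarity makes each multiplier equal to minus the inverse transpose applied to c, up
  to an error of order of the primal step. Two consecutive main terms \<open>u\<close> and
  \<open>u'\<close> differ by a perturbation of the inverse, hence by the policy step and the two
  kernel errors.\<close>

lemma dual_diff_Suc:
  "norm (dyy (Suc k)) \<le> \<kappa> / e * norm (dxx (Suc k)) + \<kappa> / e * norm (dxx k)
     + \<kappa>\<^sup>2 * norm c * (L_K pr * norm (dth (Suc k)) + dl (Suc k) + dl k)"
proof -
  let ?A = "Kmat pb (Qp k) (thp (Suc k))" and ?A' = "Kmat pb (Qp (Suc k)) (thp (Suc (Suc k)))"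
  define u where "u = transpose (matrix_inv ?A) *v c"
  define u' where "u' = transpose (matrix_inv ?A') *v c"
  have u: "transpose ?A *v u = c"
    unfolding u_def by (rule transpose_inv_vector[OF Kmat_invertible(1)[OF Qp_stochastic thp_in]])
  have u': "transpose ?A' *v u' = c"
    unfolding u'_def by (rule transpose_inv_vector[OF Kmat_invertible(1)[OF Qp_stochastic thp_in]])
  have p: "norm (yp (Suc k) + u) \<le> \<kappa> / e * norm (dxx k)"
  proof -
    have "transpose ?A *v (yp (Suc k) + u) = - (1 / e) *\<^sub>R dxx k"
      unfolding matrix_vector_right_distrib x_stationary u by simp
    then show ?thesis using norm_dual_le[OF thp_in[of "Suc k"], of "yp (Suc k) + u" k] e_pos by simp
  qed
  have p': "norm (yp (Suc (Suc k)) + u') \<le> \<kappa> / e * norm (dxx (Suc k))"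
  proof -
    have "transpose ?A' *v (yp (Suc (Suc k)) + u') = - (1 / e) *\<^sub>R dxx (Suc k)"
      unfolding matrix_vector_right_distrib x_stationary u' by simp
    then show ?thesis
      using norm_dual_le[OF thp_in[of "Suc (Suc k)"], of "yp (Suc (Suc k)) + u'" "Suc k"] e_pos by simp
  qed
  have "spec_norm (?A - ?A') \<le> spec_norm (?A - Kmat pb P (thp (Suc k)))
      + (spec_norm (Kmat pb P (thp (Suc k)) - Kmat pb P (thp (Suc (Suc k)))) + spec_norm (Kmat pb P (thp (Suc (Suc k))) - ?A'))"
    by (rule order_trans[OF spec_norm_triangle_diff add_left_mono[OF spec_norm_triangle_diff]])
  also have "\<dots> \<le> dl k + (L_K pr * norm (dth (Suc k)) + dl (Suc k))"
    using K_lipschitz[OF thp_in thp_in, of "Suc k" "Suc (Suc k)"]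
    unfolding delta_eq[OF thp_in[of "Suc k"], of k] delta_eq[OF thp_in[of "Suc (Suc k)"], of "Suc k"]
    by (simp add: spec_norm_diff_commute norm_minus_commute)
  finally have AA: "spec_norm (?A - ?A') \<le> L_K pr * norm (dth (Suc k)) + dl (Suc k) + dl k" by simp
  have "norm (u' - u) \<le> \<kappa> * (spec_norm (?A - ?A') * (\<kappa> * norm c))"
  proof -
    \<comment> \<open>The resolvent identity: both \<open>u\<close> and \<open>u'\<close> are sent
      to c by their own transposed matrices.\<close>
    have "transpose ?A' *v (u' - u) = transpose (?A - ?A') *v u"
      unfolding matrix_vector_mult_diff_distrib u'
      by (subst u[symmetric]) (simp add: vector_matrix_mult_def matrix_vector_mult_def transpose_def vec_eq_iff algebra_simps sum_subtractf)
    then have "norm (u' - u) \<le> \<kappa> * norm (transpose (?A - ?A') *v u)"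
      using norm_dual_le[OF thp_in[of "Suc (Suc k)"], of "u' - u" "Suc k"] by simp
    also have "\<dots> \<le> \<kappa> * (spec_norm (?A - ?A') * norm u)"
      by (intro mult_left_mono norm_transpose_vector_le \<kappa>_nonneg)
    also have "\<dots> \<le> \<kappa> * (spec_norm (?A - ?A') * (\<kappa> * norm c))"
      using norm_dual_le[OF thp_in[of "Suc k"], of u k] unfolding u
      by (intro mult_left_mono \<kappa>_nonneg spec_norm_nonneg)
    finally show ?thesis .
  qed
  also have "\<dots> \<le> \<kappa> * ((L_K pr * norm (dth (Suc k)) + dl (Suc k) + dl k) * (\<kappa> * norm c))"
    using \<kappa>_nonneg by (intro mult_left_mono mult_right_mono AA) auto
  also have "\<dots> = \<kappa>\<^sup>2 * norm c * (L_K pr * norm (dth (Suc k)) + dl (Suc k) + dl k)"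
    by (simp add: power2_eq_square)
  finally have uu: "norm (u' - u) \<le> \<kappa>\<^sup>2 * norm c * (L_K pr * norm (dth (Suc k)) + dl (Suc k) + dl k)" .
  have "norm (dyy (Suc k)) = norm ((yp (Suc (Suc k)) + u') - (yp (Suc k) + u) - (u' - u))" by simp
  then have "norm (dyy (Suc k)) \<le> norm (yp (Suc (Suc k)) + u') + norm (yp (Suc k) + u) + norm (u' - u)"
    using norm_triangle_ineq4[of "(yp (Suc (Suc k)) + u') - (yp (Suc k) + u)" "u' - u"]
      norm_triangle_ineq4[of "yp (Suc (Suc k)) + u'" "yp (Suc k) + u"] by linarith
  then show ?thesis using p p' uu by linarith
qed

text \<open>The factor 9 in \<open>A_C\<close> is 3 times 3, from splitting a square of three terms
  twice. For k = 0 there is no earlier stationarity identity, so the increment is bounded by the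
  diameter of the ball that contains the multipliers.\<close>

lemma dual_diff_sq:
  "(norm (dyy k))\<^sup>2 \<le> 3 * \<kappa>\<^sup>2 / e\<^sup>2 * ((norm (dxx k))\<^sup>2 + (norm (dx R k \<omega>))\<^sup>2)
     + A_C pb pr * (norm (dth k))\<^sup>2 + 9 * \<kappa> ^ 4 * (norm c)\<^sup>2 * ((dl k)\<^sup>2 + (dlp k)\<^sup>2) + 4 * y_radius\<^sup>2 * of_bool (k = 0)"
proof (cases k)
  case 0
  have "norm (dyy 0) \<le> 2 * y_radius"
    using norm_triangle_ineq4[of "yp (Suc 0)" "yp 0"] norm_yp_le[of 0] norm_yp_le[of "Suc 0"] by linarith
  then have "(norm (dyy 0))\<^sup>2 \<le> (2 * y_radius)\<^sup>2" by (intro power_mono) auto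
  moreover have "0 \<le> 3 * \<kappa>\<^sup>2 / e\<^sup>2 * ((norm (dxx k))\<^sup>2 + (norm (dx R k \<omega>))\<^sup>2)
     + A_C pb pr * (norm (dth k))\<^sup>2 + 9 * \<kappa> ^ 4 * (norm c)\<^sup>2 * ((dl k)\<^sup>2 + (dlp k)\<^sup>2)"
    using A_C_nonneg by (intro add_nonneg_nonneg mult_nonneg_nonneg) auto
  ultimately show ?thesis using 0 by (simp add: power_mult_distrib)
next
  case (Suc j)
  let ?X = "norm (dxx (Suc j))" and ?Y = "norm (dxx j)" and ?t = "L_K pr * norm (dth (Suc j))"
  define S where "S = ?t + dl (Suc j) + dl j"
  have "(norm (dyy k))\<^sup>2 \<le> (\<kappa> / e * ?X + \<kappa> / e * ?Y + \<kappa>\<^sup>2 * norm c * S)\<^sup>2"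
    unfolding Suc S_def by (intro power_mono dual_diff_Suc) auto
  also have "\<dots> \<le> 3 * ((\<kappa> / e * ?X)\<^sup>2 + (\<kappa> / e * ?Y)\<^sup>2 + (\<kappa>\<^sup>2 * norm c * S)\<^sup>2)"
    by (rule power2_sum3_le)
  also have "\<dots> = 3 * \<kappa>\<^sup>2 / e\<^sup>2 * (?X\<^sup>2 + ?Y\<^sup>2) + 3 * (\<kappa> ^ 4 * (norm c)\<^sup>2) * S\<^sup>2"
    by (simp add: power_mult_distrib power_divide algebra_simps)
  also have "3 * (\<kappa> ^ 4 * (norm c)\<^sup>2) * S\<^sup>2
      \<le> 3 * (\<kappa> ^ 4 * (norm c)\<^sup>2) * (3 * (?t\<^sup>2 + (dl (Suc j))\<^sup>2 + (dl j)\<^sup>2))"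
    unfolding S_def by (intro mult_left_mono power2_sum3_le) auto
  also have "\<dots> = A_C pb pr * (norm (dth k))\<^sup>2 + 9 * \<kappa> ^ 4 * (norm c)\<^sup>2 * ((dl k)\<^sup>2 + (dlp k)\<^sup>2)"
    by (simp add: Suc delta_prev_def A_C_def power_mult_distrib algebra_simps)
  finally show ?thesis by (simp add: Suc dx_def)
qed

section \<open>Change of the empirical Lagrangian in the three blocks\<close>

lemma phi_step:
  "phi pb (thp (Suc k)) + ereal (grad (aug_term pb \<beta> (Qp k) (xp k) (yp k)) (thp k) \<bullet> dth k
        + 1 / (2 * eta R k) * (norm (dth k))\<^sup>2) \<le> phi pb (thp k)"
proof -
  let ?f = "\<lambda>t. phi pb t + ereal (grad (aug_term pb \<beta> (Qp k) (xp k) (yp k)) (thp k) \<bullet> (t - thp k)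
        + 1 / (2 * eta R k) * (norm (t - thp k))\<^sup>2)"
  have "?f (thp (Suc k)) \<le> ?f (thp k)"
    using theta_min[of k] thp_in[of k] unfolding is_arg_min_def not_less[symmetric] by blast
  then show ?thesis by simp
qed

text \<open>Minimality bounds the new value of \<open>phi\<close> by the finite old one, so
  finiteness propagates from the start and the conversions to reals lose nothing.\<close>

lemma phi_finite: "\<bar>phi pb (thp k)\<bar> \<noteq> \<infinity>"
proof (induction k)
  case 0
  then show ?case using phi_\<theta>0 by (simp add: init)
next
  case (Suc k)
  show ?case
    using phi_step[of k] Suc phi_not_MInf[OF thp_in[of "Suc k"]] by (cases "phi pb (thp (Suc k))") auto
qed

text \<open>As \<open>phi\<close> need not be convex, the proximal objective is only compared with
  its value at the old point; this gives 1 / (2 eta), from which the linearization takes half the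
  Lipschitz constant.\<close>

lemma theta_descent:
  "real_of_ereal (phi pb (thp (Suc k))) + aug_term pb \<beta> (Qp k) (xp k) (yp k) (thp (Suc k))
   \<le> real_of_ereal (phi pb (thp k)) + aug_term pb \<beta> (Qp k) (xp k) (yp k) (thp k)
     - (1 / (2 * eta R k) - L_bar pr / 2) * (norm (dth k))\<^sup>2"
proof -
  let ?f = "aug_term pb \<beta> (Qp k) (xp k) (yp k)"
  have seg: "u \<in> Theta pb" if "u \<in> closed_segment (thp k) (thp (Suc k))" for u
    using that Theta_convex thp_in by (meson closed_segment_subset subsetD)
  have "GDERIV ?f u :> grad ?f u" if "u \<in> closed_segment (thp k) (thp (Suc k))" for u
    using gderiv_aug_term[OF pol_differentiable[OF seg[OF that]]] by (simp add: grad_aug_term[OF pol_differentiable[OF seg[OF that]]])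
  then have 1: "?f (thp (Suc k)) \<le> ?f (thp k) + grad ?f (thp k) \<bullet> dth k + L_bar pr / 2 * (norm (dth k))\<^sup>2"
    by (rule lipschitz_gradient_upper_bound) (use segment_lipschitz[of "Qp k"] in auto)
  obtain p p' where p: "phi pb (thp k) = ereal p" "phi pb (thp (Suc k)) = ereal p'"
    using phi_finite[of k] phi_finite[of "Suc k"] by auto
  have "p' + (grad ?f (thp k) \<bullet> dth k + 1 / (2 * eta R k) * (norm (dth k))\<^sup>2) \<le> p"
    using phi_step[of k] by (simp add: p)
  with 1 show ?thesis by (simp add: p left_diff_distrib)
qed

lemma x_descent:
  "c \<bullet> xp (Suc k) + aug_term pb \<beta> (Qp k) (xp (Suc k)) (yp k) (thp (Suc k)) + 1 / (2 * e) * (norm (dxx k))\<^sup>2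
   \<le> c \<bullet> xp k + aug_term pb \<beta> (Qp k) (xp k) (yp k) (thp (Suc k))"
proof -
  let ?f = "\<lambda>u. c \<bullet> u + aug_term pb \<beta> (Qp k) u (yp k) (thp (Suc k)) + 1 / (2 * e) * (norm (u - xp k))\<^sup>2"
  have "\<not> ?f (xp k) < ?f (xp (Suc k))"
    using x_min[of k] unfolding is_arg_min_def by blast
  then show ?thesis by simp
qed

lemma y_ascent:
  "aug_term pb \<beta> (Qp k) (xp (Suc k)) (yp (Suc k)) (thp (Suc k))
   = aug_term pb \<beta> (Qp k) (xp (Suc k)) (yp k) (thp (Suc k)) + 1 / \<beta> * (norm (dyy k))\<^sup>2"
proof -
  let ?F = "Fmap pb (Qp k) (thp (Suc k)) (xp (Suc k))"
  have "dyy k = \<beta> *\<^sub>R ?F" using y_step[of k] by simp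
  then have 1: "1 / \<beta> * (norm (dyy k))\<^sup>2 = \<beta> * (norm ?F)\<^sup>2"
    using \<beta>_pos by (simp add: power_mult_distrib power2_eq_square)
  have "yp (Suc k) \<bullet> ?F = yp k \<bullet> ?F + \<beta> * (norm ?F)\<^sup>2"
    by (subst y_step) (simp add: inner_add_left power2_norm_eq_inner)
  then show ?thesis unfolding aug_term_def 1 by simp
qed

section \<open>Exchange of the empirical and the true kernel\<close>

lemma kernel_error:
  fixes u :: "real^(('s \<times> 'a) + 's)" and v \<theta> k
  defines "w \<equiv> (Kmat pb (Qp k) \<theta> - Kmat pb P \<theta>) *v u"
  shows "aug_term pb \<beta> P u v \<theta> - aug_term pb \<beta> (Qp k) u v \<theta>
    = - (v \<bullet> w) - \<beta> * (Fmap pb P \<theta> u \<bullet> w) - \<beta> / 2 * (norm w)\<^sup>2"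
proof -
  have F: "Fmap pb (Qp k) \<theta> u = Fmap pb P \<theta> u + w"
    by (simp add: Fmap_def w_def matrix_vector_mult_diff_rdistrib)
  show ?thesis
    unfolding aug_term_def F
    by (simp add: power2_norm_eq_inner inner_add_left inner_add_right inner_commute[of w "Fmap pb P \<theta> u"] algebra_simps)
qed

lemma norm_F_le: "norm (Fmap pb P (thp k) (xp k)) \<le> F_radius"
proof -
  have "norm (Kmat pb P (thp k) *v xp k) \<le> K_bound * x_radius"
    by (intro order_trans[OF norm_matrix_vector_le] mult_mono Kmat_bound stochastic_true_kernel thp_in norm_xp_le K_bound_nonneg norm_ge_zero)
  then show ?thesis
    using norm_triangle_ineq4[of "Kmat pb P (thp k) *v xp k" b] by (simp add: Fmap_def F_radius_def)
qed

lemma norm_F_diff_le: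
  "norm (Fmap pb P (thp (Suc k)) (xp (Suc k)) - Fmap pb P (thp k) (xp k))
   \<le> K_bound * norm (dxx k) + L_K pr * norm (dth k) * x_radius"
proof -
  let ?K = "Kmat pb P (thp k)" and ?K' = "Kmat pb P (thp (Suc k))"
  have eq: "Fmap pb P (thp (Suc k)) (xp (Suc k)) - Fmap pb P (thp k) (xp k) = ?K' *v dxx k + (?K' - ?K) *v xp k"
    by (simp add: Fmap_def matrix_vector_mult_diff_rdistrib matrix_vector_mult_diff_distrib)
  have "norm (?K' *v dxx k) \<le> K_bound * norm (dxx k)"
    by (intro order_trans[OF norm_matrix_vector_le] mult_right_mono Kmat_bound stochastic_true_kernel thp_in norm_ge_zero)
  moreover have "norm ((?K' - ?K) *v xp k) \<le> L_K pr * norm (dth k) * x_radius"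
    using K_lipschitz[OF thp_in thp_in, of "Suc k" k]
    by (intro order_trans[OF norm_matrix_vector_le] mult_mono norm_xp_le norm_ge_zero order_trans[OF spec_norm_nonneg])
  ultimately show ?thesis unfolding eq using norm_triangle_le add_mono by blast
qed

text \<open>Both brackets are only of order delta. By \<open>Kmat_diff_indep\<close> the same matrix
  \<open>?D\<close> occurs in both, so the bilinear terms can be differenced and each difference
  gains the length of a step.\<close>

lemma kernel_error_diff:
  "(aug_term pb \<beta> P (xp (Suc k)) (yp (Suc k)) (thp (Suc k)) - aug_term pb \<beta> (Qp k) (xp (Suc k)) (yp (Suc k)) (thp (Suc k)))
   - (aug_term pb \<beta> P (xp k) (yp k) (thp k) - aug_term pb \<beta> (Qp k) (xp k) (yp k) (thp k))
   \<le> dl k * (x_radius * norm (dyy k)) + dl k * (x_coupling * norm (dxx k)) + dl k * (theta_coupling * norm (dth k)) + \<beta> / 2 * x_radius\<^sup>2 * (dl k)\<^sup>2"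
proof -
  let ?D = "Kmat pb (Qp k) (thp k) - Kmat pb P (thp k)"
  let ?F = "Fmap pb P (thp k) (xp k)" and ?F' = "Fmap pb P (thp (Suc k)) (xp (Suc k))"
  define w where "w = ?D *v xp k"
  define w' where "w' = ?D *v xp (Suc k)"
  have D: "Kmat pb (Qp k) (thp (Suc k)) - Kmat pb P (thp (Suc k)) = ?D" by (rule Kmat_diff_indep)
  have dw: "w' - w = ?D *v dxx k" by (simp add: w_def w'_def matrix_vector_mult_diff_distrib)
  have nw: "norm w \<le> dl k * x_radius" and nw': "norm w' \<le> dl k * x_radius"
    unfolding w_def w'_def
    by (rule order_trans[OF Khat_diff[OF thp_in] mult_left_mono[OF norm_xp_le delta_nonneg]])+
  have ndw: "norm (w' - w) \<le> dl k * norm (dxx k)"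
    unfolding dw by (rule Khat_diff[OF thp_in])
  have t1: "- (dyy k \<bullet> w') \<le> norm (dyy k) * (dl k * x_radius)"
    using norm_cauchy_schwarz[of "- dyy k" w'] mult_left_mono[OF nw' norm_ge_zero[of "dyy k"]]
    by (simp del: minus_diff_eq)
  have t2: "- (yp k \<bullet> (w' - w)) \<le> y_radius * (dl k * norm (dxx k))"
    using norm_cauchy_schwarz[of "- yp k" "w' - w"]
      mult_mono[OF norm_yp_le[of k] ndw y_radius_nonneg norm_ge_zero] by simp
  have t3: "- ((?F' - ?F) \<bullet> w') \<le> (K_bound * norm (dxx k) + L_K pr * norm (dth k) * x_radius) * (dl k * x_radius)"
    using norm_cauchy_schwarz[of "- (?F' - ?F)" w']
      mult_mono[OF norm_F_diff_le[of k] nw' order_trans[OF norm_ge_zero norm_F_diff_le] norm_ge_zero]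
    unfolding inner_minus_left norm_minus_cancel by linarith
  have t4: "- (?F \<bullet> (w' - w)) \<le> F_radius * (dl k * norm (dxx k))"
    using norm_cauchy_schwarz[of "- ?F" "w' - w"]
      mult_mono[OF norm_F_le[of k] ndw F_radius_nonneg norm_ge_zero]
    unfolding inner_minus_left norm_minus_cancel by linarith
  have t5: "(norm w)\<^sup>2 \<le> (dl k * x_radius)\<^sup>2" using nw by (intro power_mono) auto
  have "(aug_term pb \<beta> P (xp (Suc k)) (yp (Suc k)) (thp (Suc k)) - aug_term pb \<beta> (Qp k) (xp (Suc k)) (yp (Suc k)) (thp (Suc k)))
   - (aug_term pb \<beta> P (xp k) (yp k) (thp k) - aug_term pb \<beta> (Qp k) (xp k) (yp k) (thp k))
   = (- (dyy k \<bullet> w') + - (yp k \<bullet> (w' - w))) + \<beta> * (- ((?F' - ?F) \<bullet> w') + - (?F \<bullet> (w' - w)))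
     + \<beta> / 2 * ((norm w)\<^sup>2 - (norm w')\<^sup>2)"
    unfolding kernel_error D w_def[symmetric] w'_def[symmetric]
    by (simp add: inner_diff_left inner_diff_right algebra_simps)
  \<comment> \<open>The square of the norm of \<open>w'\<close> has a favourable sign and is
    dropped; the other square is already of order delta squared.\<close>
  also have "\<dots> \<le> (norm (dyy k) * (dl k * x_radius) + y_radius * (dl k * norm (dxx k)))
     + \<beta> * ((K_bound * norm (dxx k) + L_K pr * norm (dth k) * x_radius) * (dl k * x_radius) + F_radius * (dl k * norm (dxx k)))
     + \<beta> / 2 * (dl k * x_radius)\<^sup>2"
    using \<beta>_pos t5 zero_le_power2[of "norm w'"]
    by (intro add_mono t1 t2 t3 t4 mult_left_mono) linarith+
  also have "\<dots> = dl k * (x_radius * norm (dyy k)) + dl k * (x_coupling * norm (dxx k)) + dl k * (theta_coupling * norm (dth k)) + \<beta> / 2 * x_radius\<^sup>2 * (dl k)\<^sup>2"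
    by (simp add: x_coupling_def theta_coupling_def power2_eq_square algebra_simps)
  finally show ?thesis .
qed

section \<open>Descent of the potential and its summation\<close>

text \<open>The primal step provides 1 / (2 e), that is four units of 1 / (8 e): one enters the new
  potential, one pays for Young's inequality, one for the multiplier ascent, and one remains. The
  previous primal step inside the dual increment is paid by the term \<tau> |dx|^2 of the old
  potential. On the policy side, the \<open>A_C\<close> part of the step size condition cancels the
  dual increment, and half of \<open>a\<close> pays for Young's inequality.\<close>

lemma Phi_descent:
  "Phi pb pr R (Suc k) \<omega> \<le> Phi pb pr R k \<omega> - descent_rate * ((norm (dth k))\<^sup>2 + (norm (dxx k))\<^sup>2)
     + descent_const * ((dl k)\<^sup>2 + (dlp k)\<^sup>2 + of_bool (k = 0))"
proof -
  let ?t = "norm (dth k)" and ?x = "norm (dxx k)" and ?y = "norm (dyy k)" and ?d = "norm (dx R k \<omega>)"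
  let ?i = "of_bool (k = 0) :: real"
  have dxS: "dx R (Suc k) \<omega> = dxx k" by (simp add: dx_def)
  have y1: "dl k * (x_radius * ?y) \<le> 1 / (2 * \<beta>) * ?y\<^sup>2 + \<beta> / 2 * x_radius\<^sup>2 * (dl k)\<^sup>2"
    using young[of "1 / (2 * \<beta>)" "dl k" x_radius ?y] \<beta>_pos by (simp add: field_simps)
  have y2: "dl k * (x_coupling * ?x) \<le> 1 / (8 * e) * ?x\<^sup>2 + 2 * e * x_coupling\<^sup>2 * (dl k)\<^sup>2"
    using young[of "1 / (8 * e)" "dl k" x_coupling ?x] e_pos by (simp add: field_simps)
  have y3: "dl k * (theta_coupling * ?t) \<le> a / 2 * ?t\<^sup>2 + theta_coupling\<^sup>2 / (2 * a) * (dl k)\<^sup>2"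
    using young[of "a / 2" "dl k" theta_coupling ?t] params(7) by simp
  \<comment> \<open>The ascent of the multiplier block costs 1 / \<beta>, and Young's inequality for
    its coupling with the kernel error adds 1 / (2 \<beta>).\<close>
  let ?r = "3 / (2 * \<beta>)"
  have "?r * ?y\<^sup>2 \<le> ?r * (3 * \<kappa>\<^sup>2 / e\<^sup>2 * (?x\<^sup>2 + ?d\<^sup>2)
     + A_C pb pr * ?t\<^sup>2 + 9 * \<kappa> ^ 4 * (norm c)\<^sup>2 * ((dl k)\<^sup>2 + (dlp k)\<^sup>2) + 4 * y_radius\<^sup>2 * ?i)"
    using \<beta>_pos by (intro mult_left_mono dual_diff_sq) simp
  also have "\<dots> = (\<kappa>\<^sup>2 / (\<beta> * e)) * (9 / (2 * e) * (?x\<^sup>2 + ?d\<^sup>2)) + 3 * A_C pb pr / (2 * \<beta>) * ?t\<^sup>2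
      + ?r * (9 * \<kappa> ^ 4 * (norm c)\<^sup>2) * ((dl k)\<^sup>2 + (dlp k)\<^sup>2) + ?r * (4 * y_radius\<^sup>2) * ?i"
    using \<beta>_pos e_pos by (simp add: field_simps power2_eq_square)
  also have "(\<kappa>\<^sup>2 / (\<beta> * e)) * (9 / (2 * e) * (?x\<^sup>2 + ?d\<^sup>2)) \<le> 1 / 36 * (9 / (2 * e) * (?x\<^sup>2 + ?d\<^sup>2))"
    using e_pos by (intro mult_right_mono penalty_ratio) simp
  also have "1 / 36 * (9 / (2 * e) * (?x\<^sup>2 + ?d\<^sup>2)) = 1 / (8 * e) * ?x\<^sup>2 + 1 / (8 * e) * ?d\<^sup>2"
    using e_pos by (simp add: field_simps)
  finally have y4: "?r * ?y\<^sup>2 \<le> 1 / (8 * e) * ?x\<^sup>2 + 1 / (8 * e) * ?d\<^sup>2 + 3 * A_C pb pr / (2 * \<beta>) * ?t\<^sup>2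
      + ?r * (9 * \<kappa> ^ 4 * (norm c)\<^sup>2) * ((dl k)\<^sup>2 + (dlp k)\<^sup>2) + ?r * (4 * y_radius\<^sup>2) * ?i" by simp
  have y5: "?r * ?y\<^sup>2 = 1 / \<beta> * ?y\<^sup>2 + 1 / (2 * \<beta>) * ?y\<^sup>2" using \<beta>_pos by (simp add: field_simps)
  have th: "a * ?t\<^sup>2 + 3 * A_C pb pr / (2 * \<beta>) * ?t\<^sup>2 \<le> (1 / (2 * eta R k) - L_bar pr / 2) * ?t\<^sup>2"
    using mult_right_mono[of "a + 3 * A_C pb pr / (2 * \<beta>)" "1 / (2 * eta R k) - L_bar pr / 2" "?t\<^sup>2"] eta_props(3)[of k]
    by (simp add: distrib_right)
  have "Phi pb pr R (Suc k) \<omega> \<le> Phi pb pr R k \<omega>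
      - (1 / (2 * eta R k) - L_bar pr / 2) * ?t\<^sup>2 - 1 / (2 * e) * ?x\<^sup>2 + 1 / \<beta> * ?y\<^sup>2
      + (dl k * (x_radius * ?y) + dl k * (x_coupling * ?x) + dl k * (theta_coupling * ?t) + \<beta> / 2 * x_radius\<^sup>2 * (dl k)\<^sup>2)
      + 1 / (8 * e) * ?x\<^sup>2 - 1 / (8 * e) * ?d\<^sup>2"
    using theta_descent[of k] x_descent[of k] y_ascent[of k] kernel_error_diff[of k]
    unfolding Phi_def aug_lagrangian_def dxS by linarith
  moreover have "1 / (2 * e) * ?x\<^sup>2 = 4 * (1 / (8 * e) * ?x\<^sup>2)" using e_pos by (simp add: field_simps)
  ultimately have "Phi pb pr R (Suc k) \<omega> \<le> Phi pb pr R k \<omega> - a / 2 * ?t\<^sup>2 - 1 / (8 * e) * ?x\<^sup>2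
     + (\<beta> / 2 * x_radius\<^sup>2 * (dl k)\<^sup>2 + \<beta> / 2 * x_radius\<^sup>2 * (dl k)\<^sup>2 + 2 * e * x_coupling\<^sup>2 * (dl k)\<^sup>2 + theta_coupling\<^sup>2 / (2 * a) * (dl k)\<^sup>2
      + ?r * (9 * \<kappa> ^ 4 * (norm c)\<^sup>2) * ((dl k)\<^sup>2 + (dlp k)\<^sup>2) + ?r * (4 * y_radius\<^sup>2) * ?i)"
    using th y1 y2 y3 y4 y5 by linarith
  also have "\<dots> \<le> Phi pb pr R k \<omega> - a / 2 * ?t\<^sup>2 - 1 / (8 * e) * ?x\<^sup>2
     + descent_const * ((dl k)\<^sup>2 + (dlp k)\<^sup>2 + ?i)"
  proof -
    let ?s = "(dl k)\<^sup>2 + (dlp k)\<^sup>2 + ?i"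
    have s: "(dl k)\<^sup>2 \<le> ?s" "(dl k)\<^sup>2 + (dlp k)\<^sup>2 \<le> ?s" "?i \<le> ?s" by auto
    have "descent_const * ?s = \<beta> / 2 * x_radius\<^sup>2 * ?s + \<beta> / 2 * x_radius\<^sup>2 * ?s + 2 * e * x_coupling\<^sup>2 * ?s + theta_coupling\<^sup>2 / (2 * a) * ?s
      + ?r * (9 * \<kappa> ^ 4 * (norm c)\<^sup>2) * ?s + ?r * (4 * y_radius\<^sup>2) * ?s"
      unfolding descent_const_def by (simp only: distrib_right)
    moreover have "\<beta> / 2 * x_radius\<^sup>2 * (dl k)\<^sup>2 \<le> \<beta> / 2 * x_radius\<^sup>2 * ?s" "2 * e * x_coupling\<^sup>2 * (dl k)\<^sup>2 \<le> 2 * e * x_coupling\<^sup>2 * ?s"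
      "theta_coupling\<^sup>2 / (2 * a) * (dl k)\<^sup>2 \<le> theta_coupling\<^sup>2 / (2 * a) * ?s"
      "?r * (9 * \<kappa> ^ 4 * (norm c)\<^sup>2) * ((dl k)\<^sup>2 + (dlp k)\<^sup>2) \<le> ?r * (9 * \<kappa> ^ 4 * (norm c)\<^sup>2) * ?s"
      "?r * (4 * y_radius\<^sup>2) * ?i \<le> ?r * (4 * y_radius\<^sup>2) * ?s"
      using \<beta>_pos e_pos params(7) by (intro mult_left_mono s; simp)+
    ultimately show ?thesis by linarith
  qed
  also have "\<dots> \<le> Phi pb pr R k \<omega> - descent_rate * (?t\<^sup>2 + ?x\<^sup>2) + descent_const * ((dl k)\<^sup>2 + (dlp k)\<^sup>2 + ?i)"
  proof -
    have "descent_rate * ?t\<^sup>2 \<le> a / 2 * ?t\<^sup>2" "descent_rate * ?x\<^sup>2 \<le> 1 / (8 * e) * ?x\<^sup>2"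
      by (intro mult_right_mono; simp add: descent_rate_def)+
    then show ?thesis by (simp add: distrib_left)
  qed
  finally show ?thesis .
qed

abbreviation "step_sq k \<equiv> (norm (dth k))\<^sup>2 + (norm (dxx k))\<^sup>2"

lemma sum_delta_prev: "(\<Sum>k<n. (dlp k)\<^sup>2) \<le> (\<Sum>k<n. (dl k)\<^sup>2)"
proof (cases n)
  case (Suc m)
  have "(\<Sum>k<Suc m. (dlp k)\<^sup>2) = (\<Sum>k<m. (dl k)\<^sup>2)"
    by (subst sum.lessThan_Suc_shift) (simp add: delta_prev_def)
  then show ?thesis by (simp add: Suc)
qed simp

lemma Phi_sum:
  "Phi pb pr R n \<omega> + descent_rate * (\<Sum>k<n. step_sq k) \<le> initial_Phi + descent_const + 2 * descent_const * (\<Sum>k<n. (dl k)\<^sup>2)"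
proof -
  have *: "Phi pb pr R n \<omega> + descent_rate * (\<Sum>k<n. step_sq k) \<le> initial_Phi
      + descent_const * (\<Sum>k<n. (dl k)\<^sup>2 + (dlp k)\<^sup>2 + of_bool (k = 0))"
  proof (induction n)
    case 0
    then show ?case by (simp add: Phi_def initial_Phi_def init dx_def)
  next
    case (Suc n)
    then show ?case using Phi_descent[of n] by (simp add: distrib_left)
  qed
  have "(\<Sum>k<n. (dl k)\<^sup>2 + (dlp k)\<^sup>2 + of_bool (k = 0)) \<le> 2 * (\<Sum>k<n. (dl k)\<^sup>2) + 1"
  proof -
    have "(\<Sum>k<n. of_bool (k = 0) :: real) \<le> 1"
      by (cases n) (simp_all add: sum.lessThan_Suc_shift)
    then show ?thesis using sum_delta_prev[of n] by (simp add: sum.distrib)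
  qed
  then have "descent_const * (\<Sum>k<n. (dl k)\<^sup>2 + (dlp k)\<^sup>2 + of_bool (k = 0)) \<le> descent_const * (2 * (\<Sum>k<n. (dl k)\<^sup>2) + 1)"
    by (intro mult_left_mono descent_const_nonneg)
  with * show ?thesis by (simp add: algebra_simps)
qed

lemma delta_prev_le_sum: "(dlp n)\<^sup>2 \<le> (\<Sum>k<n. (dl k)\<^sup>2)"
proof (cases n)
  case (Suc m)
  have "(dl m)\<^sup>2 \<le> (\<Sum>k<Suc m. (dl k)\<^sup>2)" by (rule member_le_sum) auto
  then show ?thesis by (simp add: Suc delta_prev_def)
qed (simp add: delta_prev_def)

text \<open>The potential is bounded below up to the last kernel error, so the telescoped descent
  bounds both the potential and the accumulated squared steps. That lower bound is available only
  from index 1 on.\<close>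

lemma Psi_bounds:
  assumes "1 \<le> n"
  shows "1 \<le> Psi pb pr R n \<omega>" "Psi pb pr R n \<omega> \<le> potential_const * (1 + (\<Sum>k<n. (dl k)\<^sup>2))"
    "descent_rate * (\<Sum>k<n. step_sq k) \<le> potential_const * (1 + (\<Sum>k<n. (dl k)\<^sup>2))"
proof -
  let ?s = "\<Sum>k<n. (dl k)\<^sup>2" and ?B = "real_of_ereal (B_C_inf pb)"
  have s: "0 \<le> ?s" by (intro sum_nonneg) auto
  have low: "?B - C0 pr * (dlp n)\<^sup>2 \<le> Phi pb pr R n \<omega>"
  proof -
    have "0 \<le> \<beta> / 4 * (norm (Fmap pb P (thp n) (xp n)))\<^sup>2 + q_x pr * (norm (dx R n \<omega>))\<^sup>2"
      using \<beta>_pos params(8) by simp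
    then show ?thesis using Phi_lower[OF assms] by linarith
  qed
  then show "1 \<le> Psi pb pr R n \<omega>" by (simp add: Psi_def)
  have C0: "\<bar>C0 pr * (dlp n)\<^sup>2\<bar> \<le> \<bar>C0 pr\<bar> * ?s"
    unfolding abs_mult using delta_prev_le_sum[of n] by (intro mult_left_mono) auto
  have S: "0 \<le> descent_rate * (\<Sum>k<n. step_sq k)"
    using descent_rate_pos by (intro mult_nonneg_nonneg sum_nonneg) auto
  have E2s: "potential_const * (1 + ?s) = \<bar>initial_Phi\<bar> + \<bar>?B\<bar> + 1 + 2 * descent_const + \<bar>C0 pr\<bar>
      + (\<bar>initial_Phi\<bar> * ?s + \<bar>?B\<bar> * ?s + ?s) + 2 * descent_const * ?s + \<bar>C0 pr\<bar> * ?s"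
    unfolding potential_const_def by (simp only: distrib_right distrib_left mult_1 mult_1_right)
  have nn: "0 \<le> \<bar>initial_Phi\<bar> * ?s + \<bar>?B\<bar> * ?s + ?s"
    by (intro add_nonneg_nonneg mult_nonneg_nonneg s abs_ge_zero)
  show "Psi pb pr R n \<omega> \<le> potential_const * (1 + ?s)"
    using Phi_sum[of n] S C0 nn descent_const_nonneg abs_ge_zero[of "C0 pr"] abs_ge_self[of initial_Phi] abs_ge_minus_self[of ?B]
    unfolding E2s Psi_def by linarith
  show "descent_rate * (\<Sum>k<n. step_sq k) \<le> potential_const * (1 + ?s)"
    using Phi_sum[of n] low C0 nn descent_const_nonneg abs_ge_zero[of "C0 pr"] abs_ge_self[of initial_Phi] abs_ge_minus_self[of ?B]
    unfolding E2s by linarith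
qed

section \<open>The KKT residual in terms of step lengths and kernel errors\<close>

definition "prev_step_sq k = (if k = 0 then 0 else step_sq (k - 1))"

text \<open>A majorant of the residual at the iterate with index \<open>Suc k\<close>, expressed
  through the step that leads there, the step before it and the two kernel errors involved.\<close>

definition "kkt_bound k = kkt_const * (step_sq k + prev_step_sq k + (dl k)\<^sup>2 + (dlp k)\<^sup>2 + of_bool (k = 0))"

lemma dx_le_prev_step_sq: "(norm (dx R k \<omega>))\<^sup>2 \<le> prev_step_sq k"
  by (cases k) (simp_all add: dx_def prev_step_sq_def)

lemma prev_step_sq_nonneg: "0 \<le> prev_step_sq k" by (simp add: prev_step_sq_def)

lemma dual_diff_sq_le: "(norm (dyy k))\<^sup>2 \<le> dual_const * (step_sq k + prev_step_sq k + (dl k)\<^sup>2 + (dlp k)\<^sup>2 + of_bool (k = 0))"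
proof -
  let ?s = "step_sq k + prev_step_sq k + (dl k)\<^sup>2 + (dlp k)\<^sup>2 + of_bool (k = 0)"
  have i: "0 \<le> (of_bool (k = 0) :: real)" by simp
  have s: "(norm (dxx k))\<^sup>2 + (norm (dx R k \<omega>))\<^sup>2 \<le> ?s" "(norm (dth k))\<^sup>2 \<le> ?s" "(dl k)\<^sup>2 + (dlp k)\<^sup>2 \<le> ?s"
    "of_bool (k = 0) \<le> ?s"
    using dx_le_prev_step_sq[of k] prev_step_sq_nonneg[of k] zero_le_power2[of "norm (dth k)"] zero_le_power2[of "norm (dxx k)"]
      zero_le_power2[of "dl k"] zero_le_power2[of "dlp k"] i by linarith+
  have "(norm (dyy k))\<^sup>2 \<le> 3 * \<kappa>\<^sup>2 / e\<^sup>2 * ?s + A_C pb pr * ?s + 9 * \<kappa> ^ 4 * (norm c)\<^sup>2 * ?s + 4 * y_radius\<^sup>2 * ?s"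
    by (rule order_trans[OF dual_diff_sq]) (intro add_mono mult_left_mono s A_C_nonneg; simp)
  then show ?thesis unfolding dual_const_def by (simp only: distrib_right)
qed

text \<open>Optimality of the policy step yields a subgradient at the new point, but with the
  gradient at the old data. Moving the gradient to the new \<theta>, x and y costs only step
  lengths: no kernel error appears, because the derivative of F in \<theta> does not involve the
  kernel.\<close>

lemma policy_residual:
  "\<exists>v \<in> limiting_subdiff (psi pb) (thp (Suc k)).
     norm (v + policy_gradient pb (thp (Suc k)) (xp (Suc k)) (yp (Suc k)))
       \<le> (\<bar>L_bar pr\<bar> + 1 / eta_low pr) * norm (dth k) + (K_deriv_bound * y_radius + K_deriv_bound * x_radius * (\<beta> * K_bound)) * norm (dxx k)"
proof -
  let ?f = "aug_term pb \<beta> (Qp k) (xp k) (yp k)"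
  let ?g = "grad ?f (thp k)" and ?g' = "grad ?f (thp (Suc k))"
  let ?pg = "policy_gradient pb (thp (Suc k))"
  let ?A = "Kmat pb (Qp k) (thp (Suc k))"
  let ?v = "- (?g + (1 / eta R k) *\<^sub>R dth k)"
  note pd = pol_differentiable[OF thp_in[of "Suc k"]]
  have "?v \<in> limiting_subdiff (psi pb) (thp (Suc k))"
  proof (rule limiting_subdiff_prox_step)
    show "\<bar>psi pb (thp (Suc k))\<bar> \<noteq> \<infinity>" by (simp add: psi_eq[OF thp_in] phi_finite)
    show "0 < eta R k" by (rule eta_props)
    fix t
    show "psi pb (thp (Suc k)) + ereal (?g \<bullet> (thp (Suc k) - thp k) + 1 / (2 * eta R k) * (norm (thp (Suc k) - thp k))\<^sup>2)
        \<le> psi pb t + ereal (?g \<bullet> (t - thp k) + 1 / (2 * eta R k) * (norm (t - thp k))\<^sup>2)"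
    proof (cases "t \<in> Theta pb")
      case True
      then show ?thesis
        unfolding psi_eq[OF thp_in] psi_eq[OF True]
        using theta_min[of k, unfolded is_arg_min_def, THEN conjunct2] not_less by blast
    qed (simp add: psi_def)
  qed
  moreover have "norm (?v + ?pg (xp (Suc k)) (yp (Suc k)))
       \<le> (\<bar>L_bar pr\<bar> + 1 / eta_low pr) * norm (dth k) + (K_deriv_bound * y_radius + K_deriv_bound * x_radius * (\<beta> * K_bound)) * norm (dxx k)"
  proof -
    let ?w = "yp k + \<beta> *\<^sub>R Fmap pb (Qp k) (thp (Suc k)) (xp k)"
    have g': "?g' = ?pg (xp k) ?w" by (rule grad_aug_term[OF pd])
    \<comment> \<open>The updated multiplier uses the new x while the policy gradient uses the old
      one; this is their entire difference.\<close>
    have w: "yp (Suc k) - ?w = \<beta> *\<^sub>R (?A *v dxx k)"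
      by (subst y_step) (simp add: Fmap_def matrix_vector_mult_diff_distrib algebra_simps)
    have eq: "?v + ?pg (xp (Suc k)) (yp (Suc k)) = (?g' - ?g) - (1 / eta R k) *\<^sub>R dth k
        + (?pg (dxx k) (yp (Suc k)) + ?pg (xp k) (\<beta> *\<^sub>R (?A *v dxx k)))"
    proof -
      have "?pg (dxx k) (yp (Suc k)) + ?pg (xp k) (yp (Suc k) - ?w) = ?pg (xp (Suc k)) (yp (Suc k)) - ?g'"
        unfolding g' by (rule policy_gradient_diff[OF pd, symmetric])
      then show ?thesis unfolding w by (simp only: minus_add_distrib) simp
    qed
    have 1: "norm (?g' - ?g) \<le> \<bar>L_bar pr\<bar> * norm (dth k)"
      using segment_lipschitz[of "Qp k" k "thp (Suc k)" "thp k"]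
        mult_right_mono[OF abs_ge_self norm_ge_zero, of "L_bar pr" "dth k"] by simp
    have 2: "norm ((1 / eta R k) *\<^sub>R dth k) \<le> 1 / eta_low pr * norm (dth k)"
    proof -
      have "norm ((1 / eta R k) *\<^sub>R dth k) = 1 / eta R k * norm (dth k)"
        using eta_props(2)[of k] by simp
      also have "\<dots> \<le> 1 / eta_low pr * norm (dth k)"
        using eta_props(1)[of k] params(6) by (intro mult_right_mono frac_le) auto
      finally show ?thesis .
    qed
    have 3: "norm (?pg (dxx k) (yp (Suc k))) \<le> K_deriv_bound * y_radius * norm (dxx k)"
    proof -
      have "norm (?pg (dxx k) (yp (Suc k))) \<le> K_deriv_bound * norm (dxx k) * norm (yp (Suc k))"
        by (rule norm_policy_gradient_le[OF pd K_deriv_bound(2)[OF thp_in]])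
      also have "\<dots> \<le> K_deriv_bound * norm (dxx k) * y_radius"
        using K_deriv_bound(1) by (intro mult_left_mono norm_yp_le) simp
      finally show ?thesis by (simp add: ac_simps)
    qed
    have 4: "norm (?pg (xp k) (\<beta> *\<^sub>R (?A *v dxx k))) \<le> K_deriv_bound * x_radius * (\<beta> * K_bound) * norm (dxx k)"
    proof -
      have A: "norm (\<beta> *\<^sub>R (?A *v dxx k)) \<le> \<beta> * (K_bound * norm (dxx k))"
        using order_trans[OF norm_matrix_vector_le mult_right_mono[OF Kmat_bound[OF Qp_stochastic thp_in] norm_ge_zero], of k "Suc k" "dxx k"]
          \<beta>_pos by simp
      have "norm (?pg (xp k) (\<beta> *\<^sub>R (?A *v dxx k))) \<le> K_deriv_bound * norm (xp k) * norm (\<beta> *\<^sub>R (?A *v dxx k))"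
        by (rule norm_policy_gradient_le[OF pd K_deriv_bound(2)[OF thp_in]])
      also have "\<dots> \<le> K_deriv_bound * x_radius * (\<beta> * (K_bound * norm (dxx k)))"
        using K_deriv_bound(1) x_radius_nonneg by (intro mult_mono A mult_left_mono norm_xp_le mult_nonneg_nonneg norm_ge_zero)
      finally show ?thesis by (simp add: ac_simps)
    qed
    have "norm (?v + ?pg (xp (Suc k)) (yp (Suc k))) \<le> norm (?g' - ?g) + norm ((1 / eta R k) *\<^sub>R dth k)
        + (norm (?pg (dxx k) (yp (Suc k))) + norm (?pg (xp k) (\<beta> *\<^sub>R (?A *v dxx k))))"
      unfolding eq by (intro order_trans[OF norm_triangle_ineq] add_mono norm_triangle_ineq norm_triangle_ineq4)
    then show ?thesis using 1 2 3 4 unfolding distrib_right by linarith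
  qed
  ultimately show ?thesis by blast
qed

text \<open>In the dual and the feasibility residual the empirical identities are exact up to a
  primal step and a dual increment; replacing the kernel adds delta times the radius of y or of
  x.\<close>

lemma G_true_le: "G_true pb R (Suc k) \<omega> \<le> ennreal (kkt_bound k)"
proof -
  let ?\<theta> = "thp (Suc k)" and ?x = "xp (Suc k)" and ?y = "yp (Suc k)"
  let ?s = "step_sq k + prev_step_sq k + (dl k)\<^sup>2 + (dlp k)\<^sup>2 + of_bool (k = 0)"
  let ?D = "Kmat pb (Qp k) ?\<theta> - Kmat pb P ?\<theta>"
  let ?S = "(\<lambda>v. v + policy_gradient pb ?\<theta> ?x ?y) ` limiting_subdiff (psi pb) ?\<theta>"
  have s: "(norm (dth k))\<^sup>2 + (norm (dxx k))\<^sup>2 \<le> ?s" "(dl k)\<^sup>2 \<le> ?s" "(norm (dxx k))\<^sup>2 \<le> ?s"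
    using prev_step_sq_nonneg[of k] by auto
  have 1: "(dist0 ?S)\<^sup>2 \<le> ennreal (policy_const * ?s)"
  proof -
    let ?p = "\<bar>L_bar pr\<bar> + 1 / eta_low pr" and ?q = "K_deriv_bound * y_radius + K_deriv_bound * x_radius * (\<beta> * K_bound)"
    let ?r = "?p * norm (dth k) + ?q * norm (dxx k)"
    obtain v where v: "v \<in> limiting_subdiff (psi pb) ?\<theta>" "norm (v + policy_gradient pb ?\<theta> ?x ?y) \<le> ?r"
      using policy_residual by blast
    have "dist0 ?S \<le> ennreal (norm (v + policy_gradient pb ?\<theta> ?x ?y))"
      using v(1) by (intro dist0_le) blast
    also have "\<dots> \<le> ennreal ?r" using v(2) by (rule ennreal_leI)
    finally have "(dist0 ?S)\<^sup>2 \<le> (ennreal ?r)\<^sup>2" by (intro power_mono) auto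
    also have "\<dots> = ennreal (?r\<^sup>2)"
      using order_trans[OF norm_ge_zero v(2)] by (simp add: ennreal_power)
    also have "\<dots> \<le> ennreal (policy_const * ?s)"
    proof (rule ennreal_leI)
      have "?r\<^sup>2 \<le> 2 * ((?p * norm (dth k))\<^sup>2 + (?q * norm (dxx k))\<^sup>2)" by (rule power2_sum2_le)
      also have "\<dots> = 2 * ?p\<^sup>2 * (norm (dth k))\<^sup>2 + 2 * ?q\<^sup>2 * (norm (dxx k))\<^sup>2"
        by (simp only: power_mult_distrib distrib_left mult.assoc)
      also have "\<dots> \<le> policy_const * (norm (dth k))\<^sup>2 + policy_const * (norm (dxx k))\<^sup>2"
        unfolding policy_const_def by (intro add_mono mult_right_mono) auto
      also have "\<dots> \<le> policy_const * ?s"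
        unfolding distrib_left[symmetric] by (intro mult_left_mono s policy_const_nonneg)
      finally show "?r\<^sup>2 \<le> policy_const * ?s" .
    qed
    finally show ?thesis .
  qed
  have 2: "(norm (c + transpose (Kmat pb P ?\<theta>) *v ?y))\<^sup>2 \<le> (2 * y_radius\<^sup>2 + 2 / e\<^sup>2) * ?s"
  proof -
    have tr: "transpose ?D *v ?y = transpose (Kmat pb (Qp k) ?\<theta>) *v ?y - transpose (Kmat pb P ?\<theta>) *v ?y"
      by (simp add: vector_matrix_mult_def vec_eq_iff algebra_simps sum_subtractf)
    have "c + transpose (Kmat pb P ?\<theta>) *v ?y = - (transpose ?D *v ?y) - (1 / e) *\<^sub>R dxx k"
      unfolding tr x_stationary by (simp del: transpose_matrix_vector)
    then have "norm (c + transpose (Kmat pb P ?\<theta>) *v ?y) \<le> norm (transpose ?D *v ?y) + norm ((1 / e) *\<^sub>R dxx k)"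
      using norm_triangle_ineq4[of "- (transpose ?D *v ?y)" "(1 / e) *\<^sub>R dxx k"] by (simp del: transpose_matrix_vector)
    also have "\<dots> \<le> dl k * y_radius + norm (dxx k) / e"
      using order_trans[OF norm_transpose_vector_le mult_mono[OF eq_refl[OF delta_eq[OF thp_in, symmetric]] norm_yp_le delta_nonneg norm_ge_zero], of k "Suc k" "Suc k"]
        e_pos by (intro add_mono) auto
    finally have "(norm (c + transpose (Kmat pb P ?\<theta>) *v ?y))\<^sup>2 \<le> (dl k * y_radius + norm (dxx k) / e)\<^sup>2"
      by (intro power_mono) auto
    also have "\<dots> \<le> 2 * ((dl k * y_radius)\<^sup>2 + (norm (dxx k) / e)\<^sup>2)" by (rule power2_sum2_le)
    also have "\<dots> = 2 * y_radius\<^sup>2 * (dl k)\<^sup>2 + 2 / e\<^sup>2 * (norm (dxx k))\<^sup>2"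
      by (simp add: power_mult_distrib power_divide)
    also have "\<dots> \<le> 2 * y_radius\<^sup>2 * ?s + 2 / e\<^sup>2 * ?s"
      by (intro add_mono mult_left_mono s) auto
    finally show ?thesis by (simp only: distrib_right)
  qed
  have 3: "(norm (Fmap pb P ?\<theta> ?x))\<^sup>2 \<le> (2 * x_radius\<^sup>2 + 2 / \<beta>\<^sup>2 * dual_const) * ?s"
  proof -
    have "Fmap pb P ?\<theta> ?x = (1 / \<beta>) *\<^sub>R dyy k - ?D *v ?x"
      unfolding Fmap_def matrix_vector_mult_diff_rdistrib Khat_xp_Suc by simp
    then have "norm (Fmap pb P ?\<theta> ?x) \<le> norm ((1 / \<beta>) *\<^sub>R dyy k) + norm (?D *v ?x)"
      by (simp only: norm_triangle_ineq4)
    also have "\<dots> \<le> norm (dyy k) / \<beta> + dl k * x_radius"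
      using order_trans[OF Khat_diff[OF thp_in] mult_left_mono[OF norm_xp_le delta_nonneg], of k "Suc k" "Suc k"] \<beta>_pos
      by (intro add_mono) auto
    finally have "(norm (Fmap pb P ?\<theta> ?x))\<^sup>2 \<le> (norm (dyy k) / \<beta> + dl k * x_radius)\<^sup>2"
      by (intro power_mono) auto
    also have "\<dots> \<le> 2 * ((norm (dyy k) / \<beta>)\<^sup>2 + (dl k * x_radius)\<^sup>2)" by (rule power2_sum2_le)
    also have "\<dots> = 2 * x_radius\<^sup>2 * (dl k)\<^sup>2 + 2 / \<beta>\<^sup>2 * (norm (dyy k))\<^sup>2"
      by (simp add: power_mult_distrib power_divide)
    also have "\<dots> \<le> 2 * x_radius\<^sup>2 * ?s + 2 / \<beta>\<^sup>2 * (dual_const * ?s)"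
      by (intro add_mono mult_left_mono s dual_diff_sq_le) auto
    finally show ?thesis by (simp only: distrib_right mult.assoc)
  qed
  have s0: "0 \<le> ?s" using prev_step_sq_nonneg[of k] by simp
  have "G_true pb R (Suc k) \<omega> = (dist0 ?S)\<^sup>2 + ennreal ((norm (c + transpose (Kmat pb P ?\<theta>) *v ?y))\<^sup>2)
      + ennreal ((norm (Fmap pb P ?\<theta> ?x))\<^sup>2)"
    by (simp only: G_true_def Let_def policy_gradient_def)
  also have "\<dots> \<le> ennreal (policy_const * ?s) + ennreal ((2 * y_radius\<^sup>2 + 2 / e\<^sup>2) * ?s) + ennreal ((2 * x_radius\<^sup>2 + 2 / \<beta>\<^sup>2 * dual_const) * ?s)"
    by (intro add_mono ennreal_leI 1 2 3)
  also have "\<dots> = ennreal (policy_const * ?s + (2 * y_radius\<^sup>2 + 2 / e\<^sup>2) * ?s + (2 * x_radius\<^sup>2 + 2 / \<beta>\<^sup>2 * dual_const) * ?s)"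
    using policy_const_nonneg dual_const_nonneg s0 by (subst ennreal_plus[symmetric]; (simp only: ennreal_plus[symmetric] add_nonneg_nonneg mult_nonneg_nonneg zero_le_power2 zero_le_divide_iff zero_le_numeral simp_thms)?)
  also have "\<dots> = ennreal (kkt_bound k)"
    by (simp only: kkt_bound_def kkt_const_def distrib_right)
  finally show ?thesis .
qed

lemma kkt_bound_nonneg: "0 \<le> kkt_bound k"
  unfolding kkt_bound_def using kkt_const_nonneg prev_step_sq_nonneg by (intro mult_nonneg_nonneg add_nonneg_nonneg) auto

lemma kkt_bound_sum:
  assumes "1 \<le> n"
  shows "(\<Sum>k<n. kkt_bound k) \<le> kkt_sum_const * (1 + (\<Sum>k<n. (dl k)\<^sup>2))"
proof -
  let ?s = "\<Sum>k<n. (dl k)\<^sup>2"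
  have s: "0 \<le> ?s" by (intro sum_nonneg) auto
  have "(\<Sum>k<n. prev_step_sq k) \<le> (\<Sum>k<n. step_sq k)"
  proof (cases n)
    case (Suc m)
    have "(\<Sum>k<Suc m. prev_step_sq k) = (\<Sum>k<m. step_sq k)"
      by (subst sum.lessThan_Suc_shift) (simp add: prev_step_sq_def)
    then show ?thesis by (simp add: Suc)
  qed simp
  moreover have "(\<Sum>k<n. step_sq k) \<le> potential_const / descent_rate * (1 + ?s)"
    using Psi_bounds(3)[OF assms] descent_rate_pos by (simp add: field_simps)
  moreover have "(\<Sum>k<n. of_bool (k = 0) :: real) \<le> 1"
    by (cases n) (simp_all add: sum.lessThan_Suc_shift)
  ultimately have "(\<Sum>k<n. step_sq k + prev_step_sq k + (dl k)\<^sup>2 + (dlp k)\<^sup>2 + of_bool (k = 0))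
      \<le> 2 * (potential_const / descent_rate * (1 + ?s)) + 2 * ?s + 1"
    using sum_delta_prev[of n] unfolding sum.distrib by linarith
  \<comment> \<open>The summand 3 covers the two sums of squared kernel errors together with the
    single contribution of the first step.\<close>
  also have "\<dots> \<le> (2 * (potential_const / descent_rate) + 3) * (1 + ?s)"
    using s by (simp add: distrib_left distrib_right)
  finally show ?thesis
    unfolding kkt_bound_def sum_distrib_left[symmetric] kkt_sum_const_def mult.assoc
    by (intro mult_left_mono kkt_const_nonneg)
qed

end

subsection \<open>Moments of the empirical kernel\<close>

lemma UNIV_step: "(UNIV :: ('s, 'a) step set) = range Reset \<union> (\<lambda>(u, s). Env u s) ` UNIV"
proof -
  have "z \<in> range Reset \<union> (\<lambda>(u, s). Env u s) ` UNIV" for z :: "('s, 'a) step"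
    by (cases z) auto
  then show ?thesis by blast
qed

lemma finite_step: "finite (UNIV :: ('s::finite, 'a::finite) step set)"
  by (subst UNIV_step) simp

lemma finite_step_lists: "finite {zs :: ('s::finite, 'a::finite) step list. length zs = n}"
  using finite_lists_length_eq[OF finite_step, of n] by simp

lemma sum_step:
  fixes g :: "('s::finite, 'a::finite) step \<Rightarrow> real"
  shows "(\<Sum>z\<in>UNIV. g z) = (\<Sum>s\<in>UNIV. g (Reset s)) + (\<Sum>u\<in>UNIV. \<Sum>s\<in>UNIV. g (Env u s))"
proof -
  have "(\<Sum>z\<in>UNIV. g z) = (\<Sum>z\<in>range Reset. g z) + (\<Sum>z\<in>(\<lambda>(u, s). Env u s) ` UNIV. g z)"
    by (subst UNIV_step, rule sum.union_disjoint) auto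
  also have "(\<Sum>z\<in>range Reset. g z) = (\<Sum>s\<in>UNIV. g (Reset s))"
    by (subst sum.reindex) (auto simp: inj_def)
  also have "(\<Sum>z\<in>(\<lambda>(u, s). Env u s) ` UNIV. g z) = (\<Sum>us\<in>UNIV. g (case us of (u, s) \<Rightarrow> Env u s))"
    by (subst sum.reindex) (auto simp: inj_def)
  also have "\<dots> = (\<Sum>u\<in>UNIV. \<Sum>s\<in>UNIV. g (Env u s))"
    by (simp add: sum.cartesian_product UNIV_Times_UNIV[symmetric] case_prod_unfold del: UNIV_Times_UNIV)
  finally show ?thesis .
qed

text \<open>Expectation under the reset chain as a finite weighted sum, the form in which the
  conditional law of a trajectory is given.\<close>

definition traj_mean :: "('s::finite, 'a::finite, 'p::finite) occ_problem \<Rightarrow> real^'p \<Rightarrow> 's \<Rightarrow> nat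
    \<Rightarrow> (('s, 'a) step list \<Rightarrow> real) \<Rightarrow> real" where
  "traj_mean pb \<theta> s n f = (\<Sum>zs | length zs = n. traj_prob pb \<theta> s zs * f zs)"

lemma traj_mean_0: "traj_mean pb \<theta> s 0 f = f []"
  by (simp add: traj_mean_def)

lemma traj_mean_Suc:
  "traj_mean pb \<theta> s (Suc n) f
     = (\<Sum>z\<in>UNIV. step_prob pb \<theta> s z * traj_mean pb \<theta> (step_target z) n (\<lambda>zs. f (z # zs)))"
proof -
  have "{zs :: ('a, 'b) step list. length zs = Suc n} = (\<lambda>(z, zs). z # zs) ` (UNIV \<times> {zs. length zs = n})"
    by (auto simp: length_Suc_conv)
  moreover have "inj_on (\<lambda>(z, zs). z # zs) (UNIV \<times> {zs :: ('a, 'b) step list. length zs = n})"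
    by (auto simp: inj_on_def)
  ultimately have "traj_mean pb \<theta> s (Suc n) f
      = (\<Sum>(z, zs)\<in>UNIV \<times> {zs. length zs = n}. traj_prob pb \<theta> s (z # zs) * f (z # zs))"
    unfolding traj_mean_def by (subst \<open>{zs. length zs = Suc n} = _\<close>, subst sum.reindex) (auto intro!: sum.cong)
  then show ?thesis
    by (simp add: traj_mean_def sum.cartesian_product[symmetric] sum_distrib_left mult.assoc)
qed

lemma traj_mean_add: "traj_mean pb \<theta> s n (\<lambda>zs. f zs + g zs) = traj_mean pb \<theta> s n f + traj_mean pb \<theta> s n g"
  by (simp add: traj_mean_def distrib_left sum.distrib)

lemma traj_mean_cmult: "traj_mean pb \<theta> s n (\<lambda>zs. r * f zs) = r * traj_mean pb \<theta> s n f"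
  by (simp add: traj_mean_def sum_distrib_left mult.left_commute)

text \<open>The centred block sum without normalization, so that removing one block from the list is
  additive.\<close>

definition block_error :: "('s::finite, 'a::finite, 'p::finite) occ_problem \<Rightarrow> real^'p \<Rightarrow> 's \<Rightarrow> 'a \<Rightarrow> 's
    \<Rightarrow> ('s, 'a) step list \<Rightarrow> real" where
  "block_error pb \<theta> s u s' zs =
     (\<Sum>j<length zs div 2. block_weight pb \<theta> zs j s u s' - true_kernel pb s u s')"

lemma block_error_Cons:
  "block_error pb \<theta> s u s' (z1 # z2 # zs)
     = (block_weight pb \<theta> [z1, z2] 0 s u s' - true_kernel pb s u s') + block_error pb \<theta> s u s' zs"
proof -
  have "block_weight pb \<theta> (z1 # z2 # zs) (Suc j) s u s' = block_weight pb \<theta> zs j s u s'" for j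
    by (simp add: block_weight_def)
  moreover have "block_weight pb \<theta> (z1 # z2 # zs) 0 s u s' = block_weight pb \<theta> [z1, z2] 0 s u s'"
    by (simp add: block_weight_def)
  moreover have "length (z1 # z2 # zs) div 2 = Suc (length zs div 2)" by simp
  ultimately show ?thesis
    unfolding block_error_def by (simp only: sum.lessThan_Suc_shift)
qed

context occ_setup
begin

definition "weight_bound = 1 / (disc pb * (1 - disc pb) * rho_min pr * pi_min pr)"

lemma weight_bound_pos: "0 < weight_bound"
  using disc params(1,3) by (simp add: weight_bound_def)

context
  fixes \<theta> assumes \<theta>: "\<theta> \<in> Theta pb" and pol_low: "\<And>s u. pi_min pr \<le> pol pb \<theta> s u"
begin

lemma anchor_weight_pos: "0 < disc pb * (1 - disc pb) * pmf (reset_pmf pb) s * pol pb \<theta> s u"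
  using disc params(1,3) less_le_trans[OF params(1) params(2)[of s]] less_le_trans[OF params(3) pol_low[of s u]]
  by (intro mult_pos_pos) auto

lemma inverse_anchor_weight_le: "1 / (disc pb * (1 - disc pb) * pmf (reset_pmf pb) s * pol pb \<theta> s u) \<le> weight_bound"
  unfolding weight_bound_def using disc params(1,3) pol_low[of s u] params(2)[of s]
  by (intro divide_left_mono mult_mono mult_pos_pos anchor_weight_pos mult_nonneg_nonneg)
    (auto intro: less_imp_le order_trans)

lemma sum_step_prob: "(\<Sum>z\<in>UNIV. step_prob pb \<theta> s z) = 1"
proof -
  have "(\<Sum>z\<in>UNIV. step_prob pb \<theta> s z) = (1 - disc pb) * (\<Sum>t\<in>UNIV. pmf (reset_pmf pb) t)
      + disc pb * (\<Sum>u\<in>UNIV. pol pb \<theta> s u * (\<Sum>t\<in>UNIV. P s u t))"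
    by (simp add: sum_step sum_distrib_left mult.assoc)
  then show ?thesis
    using stochastic_true_kernel[of pb] pol_sum[OF \<theta>]
    by (simp add: sum_pmf_eq_1 stochastic_kernel_def)
qed

lemma step_prob_nonneg: "0 \<le> step_prob pb \<theta> s z"
  using disc pol_nonneg[OF \<theta>] by (cases z) (auto simp: true_kernel_def)

lemma traj_mean_1: "traj_mean pb \<theta> s n (\<lambda>_. 1) = 1"
  by (induction n arbitrary: s) (simp_all add: traj_mean_0 traj_mean_Suc sum_step_prob)

abbreviation "mean2 s0 h \<equiv> (\<Sum>z1\<in>UNIV. step_prob pb \<theta> s0 z1 * (\<Sum>z2\<in>UNIV. step_prob pb \<theta> (step_target z1) z2 * h z1 z2))"

lemma mean2_const: "mean2 s0 (\<lambda>_ _. r) = r"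
  by (simp add: sum_distrib_right[symmetric] sum_step_prob)

lemma mean2_affine: "mean2 s0 (\<lambda>z1 z2. f z1 z2 + r * g z1 z2) = mean2 s0 f + r * mean2 s0 g"
  by (simp add: distrib_left sum.distrib sum_distrib_left mult.left_commute)

text \<open>The first step of an anchor is a reset, so its probability does not depend on the initial state.\<close>

lemma mean2_anchor:
  "mean2 s0 (\<lambda>z1 z2. of_bool (z1 = Reset s \<and> z2 = Env u s'))
     = disc pb * (1 - disc pb) * pmf (reset_pmf pb) s * pol pb \<theta> s u * P s u s'"
proof -
  have *: "(\<Sum>z2\<in>UNIV. step_prob pb \<theta> (step_target z1) z2 * of_bool (z1 = Reset s \<and> z2 = Env u s'))
      = (if z1 = Reset s then disc pb * pol pb \<theta> s u * P s u s' else 0)" for z1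
    by (auto simp: of_bool_def if_distrib sum.delta'[OF finite_step] sum.delta[OF finite_step] cong: if_cong)
  show ?thesis unfolding *
    by (simp add: if_distrib sum.delta'[OF finite_step] sum.delta[OF finite_step] cong: if_cong)
qed

text \<open>Induction over blocks for an arbitrary initial state. From whatever state a block ends
  in, the remaining error has mean zero, so cross terms vanish and variances add. With anchor weight
  w, one block has second moment p / w, hence variance p / w - p^2.\<close>

lemma block_error_moments:
  "traj_mean pb \<theta> s0 n (block_error pb \<theta> s u s') = 0 \<and>
   traj_mean pb \<theta> s0 n (\<lambda>zs. (block_error pb \<theta> s u s' zs)\<^sup>2) \<le> real (n div 2) * weight_bound"
proof (induction n arbitrary: s0 rule: induct_nat_012)
  case 0
  show ?case by (simp add: traj_mean_0 block_error_def)
next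
  case 1
  show ?case by (simp add: traj_mean_0 traj_mean_Suc block_error_def)
next
  case (ge2 n)
  let ?w = "disc pb * (1 - disc pb) * pmf (reset_pmf pb) s * pol pb \<theta> s u" and ?p = "P s u s'"
  let ?b = "\<lambda>z1 z2. of_bool (z1 = Reset s \<and> z2 = Env u s') :: real"
  let ?U = "block_error pb \<theta> s u s'"
  have w: "0 < ?w" by (rule anchor_weight_pos)
  have U: "?U (z1 # z2 # zs) = (?b z1 z2 / ?w - ?p) + ?U zs" for z1 z2 zs
    unfolding block_error_Cons by (simp add: block_weight_def)
  have m1: "traj_mean pb \<theta> t n (\<lambda>zs. (?b z1 z2 / ?w - ?p) + ?U zs) = ?b z1 z2 / ?w - ?p" for t z1 z2
    using traj_mean_cmult[of pb \<theta> t n "?b z1 z2 / ?w - ?p" "\<lambda>_. 1"] ge2(1)[of t]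
    by (simp only: traj_mean_add traj_mean_1) simp
  have "traj_mean pb \<theta> s0 (Suc (Suc n)) ?U = mean2 s0 (\<lambda>z1 z2. - ?p + (1 / ?w) * ?b z1 z2)"
    unfolding traj_mean_Suc U m1 by simp
  also have "\<dots> = - ?p + (1 / ?w) * (?w * ?p)"
    unfolding mean2_affine mean2_const mean2_anchor ..
  also have "\<dots> = 0"
  proof -
    have "- p + (1 / w) * (w * p) = 0" if "w \<noteq> 0" for w p :: real using that by simp
    then show ?thesis using less_imp_neq[OF w, symmetric] .
  qed
  finally have 1: "traj_mean pb \<theta> s0 (Suc (Suc n)) ?U = 0" .
  \<comment> \<open>The cross term is removed by the induction hypothesis on the mean. As an
    indicator equals its square, the rest is affine in it and \<open>mean2_anchor\<close>
    applies.\<close>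
  have m2: "traj_mean pb \<theta> t n (\<lambda>zs. ((?b z1 z2 / ?w - ?p) + ?U zs)\<^sup>2)
      \<le> (?p\<^sup>2 + real (n div 2) * weight_bound) + (1 / ?w\<^sup>2 - 2 * ?p / ?w) * ?b z1 z2" for t z1 z2
  proof -
    let ?d = "?b z1 z2 / ?w - ?p"
    have sq: "(d + r)\<^sup>2 = (d\<^sup>2 * 1 + (2 * d) * r) + r\<^sup>2" for d r :: real by (simp add: power2_sum)
    have "traj_mean pb \<theta> t n (\<lambda>zs. (?d + ?U zs)\<^sup>2) = ?d\<^sup>2 + traj_mean pb \<theta> t n (\<lambda>zs. (?U zs)\<^sup>2)"
      using ge2(1)[of t] unfolding sq by (simp only: traj_mean_add traj_mean_cmult traj_mean_1)
    also have "\<dots> \<le> ?d\<^sup>2 + real (n div 2) * weight_bound" using ge2(1)[of t] by simp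
    also have "?d\<^sup>2 = ?p\<^sup>2 + (1 / ?w\<^sup>2 - 2 * ?p / ?w) * ?b z1 z2"
      by (cases "z1 = Reset s \<and> z2 = Env u s'") (simp_all add: power2_diff power_divide algebra_simps)
    finally show ?thesis by simp
  qed
  have "traj_mean pb \<theta> s0 (Suc (Suc n)) (\<lambda>zs. (?U zs)\<^sup>2)
      \<le> mean2 s0 (\<lambda>z1 z2. (?p\<^sup>2 + real (n div 2) * weight_bound) + (1 / ?w\<^sup>2 - 2 * ?p / ?w) * ?b z1 z2)"
    unfolding traj_mean_Suc U by (intro sum_mono mult_left_mono m2 step_prob_nonneg)
  also have "\<dots> = (?p\<^sup>2 + real (n div 2) * weight_bound) + (1 / ?w\<^sup>2 - 2 * ?p / ?w) * (?w * ?p)"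
    unfolding mean2_affine mean2_const mean2_anchor ..
  also have "\<dots> = real (n div 2) * weight_bound + ?p * (1 / ?w) - ?p\<^sup>2"
  proof -
    have "(p\<^sup>2 + r) + (1 / w\<^sup>2 - 2 * p / w) * (w * p) = r + p * (1 / w) - p\<^sup>2" if "w \<noteq> 0" for w p r :: real
      using that by (simp add: field_simps power2_eq_square)
    then show ?thesis using less_imp_neq[OF w, symmetric] .
  qed
  also have "\<dots> \<le> real (n div 2) * weight_bound + 1 * weight_bound - 0"
    using stochastic_kernel_le_1[OF stochastic_true_kernel[of pb], of s u s'] inverse_anchor_weight_le[of s u] w weight_bound_pos
    by (intro diff_mono add_mono mult_mono) (auto simp: true_kernel_def)
  finally show ?case using 1 by (simp add: algebra_simps)
qed

lemma raw_kernel_mean_sq: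
  assumes "2 \<le> n"
  shows "traj_mean pb \<theta> s0 n (\<lambda>zs. (raw_kernel pb \<theta> zs s u s' - P s u s')\<^sup>2) \<le> 3 * weight_bound / real n"
proof -
  let ?L = "real (n div 2)"
  \<comment> \<open>Source of the factor 3 in the variance bound; n = 3 is the extremal
    case.\<close>
  have "n \<le> 3 * (n div 2)" "0 < n div 2" using assms by presburger+
  then have L: "real n \<le> 3 * ?L" "0 < ?L" by linarith+
  have raw: "(raw_kernel pb \<theta> zs s u s' - P s u s')\<^sup>2 = (1 / ?L\<^sup>2) * (block_error pb \<theta> s u s' zs)\<^sup>2"
    if "length zs = n" for zs
  proof -
    have "raw_kernel pb \<theta> zs s u s' - P s u s' = block_error pb \<theta> s u s' zs / ?L"
      using L that by (simp add: raw_kernel_def block_error_def sum_subtractf diff_divide_distrib)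
    then show ?thesis by (simp add: power_divide)
  qed
  have "traj_mean pb \<theta> s0 n (\<lambda>zs. (raw_kernel pb \<theta> zs s u s' - P s u s')\<^sup>2)
      = traj_mean pb \<theta> s0 n (\<lambda>zs. (1 / ?L\<^sup>2) * (block_error pb \<theta> s u s' zs)\<^sup>2)"
    unfolding traj_mean_def by (intro sum.cong refl) (simp add: raw)
  also have "\<dots> \<le> (1 / ?L\<^sup>2) * (?L * weight_bound)"
    unfolding traj_mean_cmult using block_error_moments by (intro mult_left_mono) auto
  also have "\<dots> = weight_bound / ?L" using L by (simp add: power2_eq_square)
  also have "\<dots> \<le> 3 * weight_bound / real n"
    using L weight_bound_pos assms by (simp add: field_simps)
  finally show ?thesis .
qed

text \<open>Stated for every list, since \<open>integral_traj_le\<close> asks for a bound over all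
  of them. Without a full block the quotient is 0 / 0, which is 0.\<close>

lemma raw_kernel_bound: "\<bar>raw_kernel pb \<theta> zs s u s'\<bar> \<le> weight_bound"
proof (cases "length zs div 2 = 0")
  case False
  let ?L = "length zs div 2"
  have "\<bar>block_weight pb \<theta> zs j s u s'\<bar> \<le> weight_bound" for j
    using anchor_weight_pos[of s u] inverse_anchor_weight_le[of s u] weight_bound_pos
    by (auto simp: block_weight_def of_bool_def)
  then have "(\<Sum>j<?L. \<bar>block_weight pb \<theta> zs j s u s'\<bar>) \<le> (\<Sum>j<?L. weight_bound)" by (intro sum_mono)
  then have "\<bar>\<Sum>j<?L. block_weight pb \<theta> zs j s u s'\<bar> \<le> real ?L * weight_bound"
    using order_trans[OF sum_abs] by simp
  then show ?thesis
    using False unfolding raw_kernel_def by (simp add: abs_mult divide_le_eq mult.commute)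
qed (use weight_bound_pos in \<open>simp add: raw_kernel_def\<close>)

text \<open>The true row lies in the simplex and is its own projection, so nonexpansiveness applies.
  Summing over all rows gives one quantity that bounds every entry.\<close>

lemma emp_kernel_error:
  "\<bar>emp_kernel pb \<theta> zs s u s' - P s u s'\<bar>
     \<le> sqrt (\<Sum>s\<in>UNIV. \<Sum>u\<in>UNIV. \<Sum>s'\<in>UNIV. (raw_kernel pb \<theta> zs s u s' - P s u s')\<^sup>2)"
proof -
  let ?r = "(\<chi> t. raw_kernel pb \<theta> zs s u t) :: real^'s" and ?p = "(\<chi> t. P s u t) :: real^'s"
  have "?p \<in> prob_simplex"
    using stochastic_true_kernel[of pb] by (simp add: prob_simplex_def stochastic_kernel_def)
  then have p: "closest_point prob_simplex ?p = ?p" by (rule closest_point_self)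
  have "\<bar>emp_kernel pb \<theta> zs s u s' - P s u s'\<bar> = \<bar>(closest_point prob_simplex ?r - closest_point prob_simplex ?p) $ s'\<bar>"
    unfolding p by (simp add: emp_kernel_def)
  also have "\<dots> \<le> dist (closest_point prob_simplex ?r) (closest_point prob_simplex ?p)"
    unfolding dist_norm by (rule component_le_norm_cart)
  also have "\<dots> \<le> dist ?r ?p"
    by (rule closest_point_lipschitz[OF prob_simplex_convex prob_simplex_closed prob_simplex_nonempty])
  also have "\<dots> = sqrt (\<Sum>t\<in>UNIV. (raw_kernel pb \<theta> zs s u t - P s u t)\<^sup>2)"
    by (simp add: dist_norm norm_vec_def L2_set_def)
  also have "\<dots> \<le> sqrt (\<Sum>s\<in>UNIV. \<Sum>u\<in>UNIV. \<Sum>s'\<in>UNIV. (raw_kernel pb \<theta> zs s u s' - P s u s')\<^sup>2)"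
  proof (rule real_sqrt_le_mono)
    have "(\<Sum>t\<in>UNIV. (raw_kernel pb \<theta> zs s u t - P s u t)\<^sup>2)
        \<le> (\<Sum>u\<in>UNIV. \<Sum>t\<in>UNIV. (raw_kernel pb \<theta> zs s u t - P s u t)\<^sup>2)"
      by (rule member_le_sum) (auto intro: sum_nonneg)
    also have "\<dots> \<le> (\<Sum>s\<in>UNIV. \<Sum>u\<in>UNIV. \<Sum>t\<in>UNIV. (raw_kernel pb \<theta> zs s u t - P s u t)\<^sup>2)"
      by (rule member_le_sum[where f="\<lambda>s. \<Sum>u\<in>UNIV. \<Sum>t\<in>UNIV. (raw_kernel pb \<theta> zs s u t - P s u t)\<^sup>2"])
        (auto intro!: sum_nonneg)
    finally show "(\<Sum>t\<in>UNIV. (raw_kernel pb \<theta> zs s u t - P s u t)\<^sup>2)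
        \<le> (\<Sum>s\<in>UNIV. \<Sum>u\<in>UNIV. \<Sum>s'\<in>UNIV. (raw_kernel pb \<theta> zs s u s' - P s u s')\<^sup>2)" .
  qed
  finally show ?thesis .
qed

lemma Kmat_emp_error_sq:
  "(spec_norm (Kmat pb (emp_kernel pb \<theta> zs) \<theta>' - Kmat pb P \<theta>'))\<^sup>2
     \<le> K_bound\<^sup>2 * (\<Sum>s\<in>UNIV. \<Sum>u\<in>UNIV. \<Sum>s'\<in>UNIV. (raw_kernel pb \<theta> zs s u s' - P s u s')\<^sup>2)"
proof -
  let ?W = "\<Sum>s\<in>UNIV. \<Sum>u\<in>UNIV. \<Sum>s'\<in>UNIV. (raw_kernel pb \<theta> zs s u s' - P s u s')\<^sup>2"
  have W: "0 \<le> ?W" by (intro sum_nonneg) auto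
  have "\<bar>disc pb * (emp_kernel pb \<theta> zs s u s' - P s u s')\<bar> \<le> 1 * sqrt ?W" for s u s'
    unfolding abs_mult using disc by (intro mult_mono emp_kernel_error) auto
  then have "\<bar>(Kmat pb (emp_kernel pb \<theta> zs) \<theta>' - Kmat pb P \<theta>') $ i $ j\<bar> \<le> sqrt ?W" for i j
    unfolding Kmat_diff_entry using W by (auto simp: abs_mult split: sum.splits prod.splits)
  then have "spec_norm (Kmat pb (emp_kernel pb \<theta> zs) \<theta>' - Kmat pb P \<theta>') \<le> K_bound * sqrt ?W"
    unfolding K_bound_def by (rule spec_norm_le_entries)
  then have "(spec_norm (Kmat pb (emp_kernel pb \<theta> zs) \<theta>' - Kmat pb P \<theta>'))\<^sup>2 \<le> (K_bound * sqrt ?W)\<^sup>2"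
    by (intro power_mono spec_norm_nonneg)
  then show ?thesis using W by (simp add: power_mult_distrib)
qed

end

end

subsection \<open>Measurability\<close>

text \<open>Strict superlevel sets are open: the lower limit controls a punctured neighbourhood, and
  the centre belongs to the set by assumption.\<close>

lemma lsc_borel_measurable:
  fixes f :: "'b::{t2_space, second_countable_topology} \<Rightarrow> ereal"
  assumes "lsc f"
  shows "f \<in> borel_measurable borel"
proof (rule borel_measurableI_greater)
  fix r
  have "open {x. r < f x}"
  proof (subst open_subopen, intro ballI)
    fix u assume "u \<in> {x. r < f x}"
    then have "r < Liminf (at u) f" using assms unfolding lsc_def by (auto intro: less_le_trans)
    then have "eventually (\<lambda>x. r < f x) (at u)" by (rule less_LiminfD)
    then have "eventually (\<lambda>x. r < f x) (nhds u)"
      using \<open>u \<in> _\<close> by (auto simp: eventually_nhds_conv_at)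
    then show "\<exists>T. open T \<and> u \<in> T \<and> T \<subseteq> {x. r < f x}"
      unfolding eventually_nhds by blast
  qed
  then show "{x \<in> space borel. r < f x} \<in> sets borel" by simp
qed

lemma borel_measurable_vec:
  fixes f :: "'w \<Rightarrow> ('a::euclidean_space)^'n"
  assumes "\<And>i. (\<lambda>\<omega>. f \<omega> $ i) \<in> borel_measurable M"
  shows "f \<in> borel_measurable M"
  unfolding borel_measurable_euclidean_space[of f]
  using assms by (auto simp: Basis_vec_def inner_axis intro!: borel_measurable_inner)

lemma borel_measurable_vec_nth:
  fixes f :: "'w \<Rightarrow> ('a::euclidean_space)^'n"
  assumes "f \<in> borel_measurable M"
  shows "(\<lambda>\<omega>. f \<omega> $ i) \<in> borel_measurable M"
proof -
  have "(\<lambda>x :: 'a^'n. x $ i) \<in> borel_measurable borel"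
    by (intro borel_measurable_continuous_onI continuous_intros)
  from measurable_compose[OF assms this] show ?thesis .
qed

lemma borel_measurable_matrix_vector:
  fixes A :: "'w \<Rightarrow> real^'n^'m"
  assumes "\<And>i j. (\<lambda>\<omega>. A \<omega> $ i $ j) \<in> borel_measurable M" "x \<in> borel_measurable M"
  shows "(\<lambda>\<omega>. A \<omega> *v x \<omega>) \<in> borel_measurable M"
  by (rule borel_measurable_vec)
    (auto simp: matrix_vector_mult_def intro!: borel_measurable_sum borel_measurable_times assms borel_measurable_vec_nth)

lemma borel_measurable_Kmat:
  fixes pb :: "('s::finite, 'a::finite, 'p::finite) occ_problem"
  assumes "\<And>s u s'. (\<lambda>\<omega>. Q \<omega> s u s') \<in> borel_measurable M" "\<And>s u. (\<lambda>\<omega>. pol pb (\<theta> \<omega>) s u) \<in> borel_measurable M"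
  shows "(\<lambda>\<omega>. Kmat pb (Q \<omega>) (\<theta> \<omega>) $ i $ j) \<in> borel_measurable M"
proof (cases i)
  case i: (Inl s')
  show ?thesis
  proof (cases j)
    case (Inl sa)
    obtain s u where "sa = (s, u)" by (cases sa)
    then show ?thesis using assms(1)[of s u s'] i Inl by (simp add: Kmat_def)
  qed (simp add: Kmat_def i)
next
  case i: (Inr sa)
  obtain s u where "sa = (s, u)" by (cases sa)
  then show ?thesis using assms(2)[of s u] i by (cases j) (simp_all add: Kmat_def)
qed

lemma countable_step_lists: "countable (UNIV :: ('s::finite, 'a::finite) step list set)"
  using countable_lists[OF countable_finite[OF finite_step]] by simp

subsection \<open>The stochastic algorithm\<close>

locale occ_random = occ_setup pb pr \<theta>0 x0 y0
  for pb :: "('s::finite, 'a::finite, 'p::finite) occ_problem" and pr \<theta>0 x0 y0 +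
  fixes M :: "'w measure" and R :: "('w, 's, 'a, 'p) run"
  assumes sampling: "sampling_ok pb pr M R" and updates: "updates_ok pb pr \<theta>0 x0 y0 M R"
    and regular: "regularity_ok pb pr M R"
begin

lemma path: "\<omega> \<in> space M \<Longrightarrow> admm_path pb pr \<theta>0 x0 y0 M R \<omega>"
  using updates regular by unfold_locales

lemma prob_space_M: "prob_space M" and filt: "filtration (space M) (filt R)"
  and subalg: "subalgebra M (filt R k)"
  and th_meas: "th R k \<in> borel_measurable (filt R k)"
  and xx_meas: "xx R k \<in> borel_measurable (filt R k)"
  and yy_meas: "yy R k \<in> borel_measurable (filt R k)"
  and traj_meas: "traj R k \<in> measurable (filt R (Suc k)) (count_space UNIV)"
  and batch_ge: "2 \<le> batch R k"
  and traj_length: "\<omega> \<in> space M \<Longrightarrow> length (traj R k \<omega>) = batch R k"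
  and pol_low: "\<omega> \<in> space M \<Longrightarrow> pi_min pr \<le> pol pb (th R k \<omega>) s u"
  and traj_law: "length zs = batch R k \<Longrightarrow>
     AE \<omega> in M. real_cond_exp M (filt R k) (indicator {\<omega>'\<in>space M. traj R k \<omega>' = zs}) \<omega>
                    = traj_prob pb (th R k \<omega>) (start R k \<omega>) zs"
proof -
  note s = sampling[unfolded sampling_ok_def]
  note s2 = s[THEN conjunct2]
  note s3 = s2[THEN conjunct2]
  note s4 = s3[THEN conjunct2]
  note s5 = s4[THEN conjunct2]
  note s6 = s5[THEN conjunct2]
  note s7 = s6[THEN conjunct2]
  show "prob_space M" by (rule s[THEN conjunct1])
  show "filtration (space M) (filt R)" by (rule s2[THEN conjunct1])
  show "subalgebra M (filt R k)" by (rule s3[THEN conjunct1, THEN spec])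
  note m = s4[THEN conjunct1, THEN spec, of k]
  show "th R k \<in> borel_measurable (filt R k)" "xx R k \<in> borel_measurable (filt R k)"
    "yy R k \<in> borel_measurable (filt R k)" "traj R k \<in> measurable (filt R (Suc k)) (count_space UNIV)"
    using m by simp_all
  show "2 \<le> batch R k" by (rule s5[THEN conjunct1, THEN spec])
  show "\<omega> \<in> space M \<Longrightarrow> length (traj R k \<omega>) = batch R k"
    by (rule bspec[OF s6[THEN conjunct1, THEN spec]])
  show "\<omega> \<in> space M \<Longrightarrow> pi_min pr \<le> pol pb (th R k \<omega>) s u"
    using bspec[OF s7[THEN conjunct1, THEN spec]] by simp
  show "length zs = batch R k \<Longrightarrow>
     AE \<omega> in M. real_cond_exp M (filt R k) (indicator {\<omega>'\<in>space M. traj R k \<omega>' = zs}) \<omega>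
                    = traj_prob pb (th R k \<omega>) (start R k \<omega>) zs"
    by (rule s7[THEN conjunct2, THEN spec, THEN spec, THEN mp])
qed

sublocale prob_space M by (rule prob_space_M)

lemma th_in: "\<omega> \<in> space M \<Longrightarrow> th R k \<omega> \<in> Theta pb"
  by (rule admm_path.thp_in[OF path])

section \<open>Measurability of the random quantities with respect to the history\<close>

lemma space_filt: "space (filt R k) = space M"
  using subalg by (simp add: subalgebra_def)

lemma filt_mono:
  assumes "j \<le> k" "f \<in> measurable (filt R j) K" shows "f \<in> measurable (filt R k) K"
  using assms filtration.sets_F_mono[OF filt assms(1)] space_filt
  unfolding measurable_def by auto

lemma filt_M: "f \<in> measurable (filt R k) K \<Longrightarrow> f \<in> measurable M K"
  by (rule measurable_from_subalg[OF subalg])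

text \<open>Continuity of the policy map is used only on \<open>Theta\<close>, so the argument
  passes through the restricted Borel space, which contains all policy iterates.\<close>

lemma pol_meas: "(\<lambda>\<omega>. pol pb (th R k \<omega>) s u) \<in> borel_measurable (filt R k)"
proof -
  have "continuous_on (Theta pb) (\<lambda>\<theta>. pol pb \<theta> s u)"
    by (intro continuous_at_imp_continuous_on ballI differentiable_imp_continuous_within pol_differentiable)
  then have "(\<lambda>\<theta>. pol pb \<theta> s u) \<in> borel_measurable (restrict_space borel (Theta pb))"
    by (rule borel_measurable_continuous_on_restrict)
  moreover have "th R k \<in> measurable (filt R k) (restrict_space borel (Theta pb))"
    using th_in by (intro measurable_restrict_space2 th_meas) (auto simp: space_filt)
  ultimately show ?thesis using measurable_compose by blast
qed

lemma raw_meas: "(\<lambda>\<omega>. raw_kernel pb (th R k \<omega>) zs s u s') \<in> borel_measurable (filt R k)"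
  unfolding raw_kernel_def block_weight_def
  by (intro borel_measurable_divide borel_measurable_sum borel_measurable_times borel_measurable_const pol_meas)

text \<open>There are countably many trajectories, and for a fixed one the kernel depends only on
  the current policy parameter.\<close>

lemma raw_traj_meas: "(\<lambda>\<omega>. raw_kernel pb (th R k \<omega>) (traj R k \<omega>) s u s') \<in> borel_measurable (filt R (Suc k))"
  by (rule measurable_compose_countable'[OF _ traj_meas countable_step_lists])
    (rule filt_mono[OF _ raw_meas], simp)

lemma Phat_meas: "(\<lambda>\<omega>. Phat pb R k \<omega> s u s') \<in> borel_measurable (filt R (Suc k))"
proof -
  have "continuous_on UNIV (closest_point (prob_simplex :: (real^'s) set))"
    by (intro continuous_on_closest_point prob_simplex_convex prob_simplex_closed prob_simplex_nonempty)
  then have cp: "closest_point (prob_simplex :: (real^'s) set) \<in> borel_measurable borel"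
    by (rule borel_measurable_continuous_onI)
  have "(\<lambda>\<omega>. (\<chi> t. raw_kernel pb (th R k \<omega>) (traj R k \<omega>) s u t) :: real^'s) \<in> borel_measurable (filt R (Suc k))"
    by (rule borel_measurable_vec) (simp add: raw_traj_meas)
  from measurable_compose[OF this cp] show ?thesis
    unfolding Phat_def emp_kernel_def by (rule borel_measurable_vec_nth)
qed

text \<open>Evaluation at \<theta>0 replaces the possibly uncountable supremum.\<close>

lemma delta_meas: "delta pb R k \<in> borel_measurable (filt R (Suc k))"
proof -
  have "(\<lambda>\<omega>. Kmat pb (Phat pb R k \<omega>) \<theta>0 - Kmat pb P \<theta>0) \<in> borel_measurable (filt R (Suc k))"
    by (intro borel_measurable_vec) (auto intro!: borel_measurable_diff borel_measurable_Kmat Phat_meas)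
  from measurable_compose[OF this borel_measurable_spec_norm]
  have "(\<lambda>\<omega>. spec_norm (Kmat pb (Phat pb R k \<omega>) \<theta>0 - Kmat pb P \<theta>0)) \<in> borel_measurable (filt R (Suc k))" .
  then show ?thesis
    by (rule measurable_cong[THEN iffD1, rotated])
      (simp add: space_filt admm_path.delta_eq[OF path \<theta>0_in])
qed

lemma delta_prev_meas: "delta_prev pb R k \<in> borel_measurable (filt R k)"
proof (cases k)
  case 0
  then have "delta_prev pb R k = (\<lambda>_. 0)" by (simp add: fun_eq_iff delta_prev_def)
  then show ?thesis by simp
next
  case (Suc j)
  then have "delta_prev pb R k = delta pb R j" by (simp add: fun_eq_iff delta_prev_def)
  then show ?thesis using delta_meas[of j] Suc by simp
qed

text \<open>Lower semicontinuity is assumed of \<open>psi\<close>, which agrees with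
  \<open>phi\<close> on \<open>Theta\<close>.\<close>

lemma phi_meas: "(\<lambda>\<omega>. real_of_ereal (phi pb (th R k \<omega>))) \<in> borel_measurable (filt R k)"
proof -
  have "(\<lambda>\<omega>. psi pb (th R k \<omega>)) \<in> borel_measurable (filt R k)"
    using measurable_compose[OF th_meas lsc_borel_measurable[OF psi_lsc]] .
  then have "(\<lambda>\<omega>. real_of_ereal (psi pb (th R k \<omega>))) \<in> borel_measurable (filt R k)"
    by (rule borel_measurable_real_of_ereal)
  then show ?thesis
    by (rule measurable_cong[THEN iffD1, rotated]) (simp add: space_filt psi_eq[OF th_in])
qed

lemma Fmap_meas: "(\<lambda>\<omega>. Fmap pb P (th R k \<omega>) (xx R k \<omega>)) \<in> borel_measurable (filt R k)"
  unfolding Fmap_def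
  by (intro borel_measurable_diff borel_measurable_matrix_vector borel_measurable_Kmat pol_meas xx_meas borel_measurable_const)

lemma dx_meas: "dx R k \<in> borel_measurable (filt R k)"
proof (cases k)
  case 0
  then have "dx R k = (\<lambda>_. 0)" by (simp add: fun_eq_iff dx_def)
  then show ?thesis by simp
next
  case (Suc j)
  then have "dx R k = (\<lambda>\<omega>. xx R k \<omega> - xx R j \<omega>)" by (simp add: fun_eq_iff dx_def)
  then show ?thesis using Suc filt_mono[of j k, OF _ xx_meas] by (simp add: borel_measurable_diff xx_meas)
qed

lemma Psi_meas: "Psi pb pr R k \<in> borel_measurable (filt R k)"
proof -
  have "(\<lambda>\<omega>. Psi pb pr R k \<omega>) \<in> borel_measurable (filt R k)"
    unfolding Psi_def Phi_def aug_lagrangian_def aug_term_def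
    by (intro borel_measurable_add borel_measurable_diff borel_measurable_times borel_measurable_power
        measurable_compose[OF Fmap_meas borel_measurable_norm] measurable_compose[OF dx_meas borel_measurable_norm]
        borel_measurable_inner borel_measurable_const phi_meas Fmap_meas
        delta_prev_meas yy_meas xx_meas)
  then show ?thesis by simp
qed

section \<open>Expected kernel error\<close>

lemma integrable_bounded:
  assumes "f \<in> borel_measurable M" "\<And>\<omega>. \<omega> \<in> space M \<Longrightarrow> \<bar>f \<omega> :: real\<bar> \<le> B"
  shows "integrable M f"
  by (rule integrable_const_bound[of _ B]) (use assms in auto)

lemma cond_exp_subalgebra: "sigma_finite_subalgebra M (filt R k)"
  by (intro finite_measure_subalgebra_is_sigma_finite finite_measure_subalgebra.intro
      finite_measure_subalgebra_axioms.intro subalg finite_measure_axioms)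

text \<open>Disintegration over the finitely many trajectories of the given length: for a fixed list
  the integrand is known from the history, so the indicator of that list can be replaced by its
  conditional probability, which turns the sum into \<open>traj_mean\<close>.\<close>

lemma integral_traj_le:
  fixes g :: "('s, 'a) step list \<Rightarrow> 'w \<Rightarrow> real"
  assumes g: "\<And>zs. g zs \<in> borel_measurable (filt R k)" and B: "\<And>zs \<omega>. \<omega> \<in> space M \<Longrightarrow> \<bar>g zs \<omega>\<bar> \<le> B"
    and mean: "\<And>\<omega>. \<omega> \<in> space M \<Longrightarrow>
      traj_mean pb (th R k \<omega>) (start R k \<omega>) (batch R k) (\<lambda>zs. g zs \<omega>) \<le> r"
  shows "(\<integral>\<omega>. g (traj R k \<omega>) \<omega> \<partial>M) \<le> r"
proof -
  let ?Z = "{zs :: ('s, 'a) step list. length zs = batch R k}"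
  let ?I = "\<lambda>zs. indicator {\<omega>'\<in>space M. traj R k \<omega>' = zs} :: 'w \<Rightarrow> real"
  interpret ce: sigma_finite_subalgebra M "filt R k" by (rule cond_exp_subalgebra)
  have Im: "?I zs \<in> borel_measurable M" for zs
  proof -
    have "traj R k -` {zs} \<inter> space M \<in> sets M"
      by (rule measurable_sets[OF filt_M[OF traj_meas]]) simp
    also have "traj R k -` {zs} \<inter> space M = {\<omega>'\<in>space M. traj R k \<omega>' = zs}" by auto
    finally show ?thesis by (rule borel_measurable_indicator)
  qed
  have int: "integrable M (\<lambda>\<omega>. g zs \<omega> * ?I zs \<omega>)" for zs
  proof (rule integrable_bounded)
    show "(\<lambda>\<omega>. g zs \<omega> * ?I zs \<omega>) \<in> borel_measurable M"
      by (intro borel_measurable_times Im filt_M[OF g])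
    show "\<bar>g zs \<omega> * ?I zs \<omega>\<bar> \<le> B" if "\<omega> \<in> space M" for \<omega>
      using B[OF that, of zs] by (auto simp: indicator_def)
  qed
  have "(\<integral>\<omega>. g (traj R k \<omega>) \<omega> \<partial>M) = (\<integral>\<omega>. (\<Sum>zs\<in>?Z. g zs \<omega> * ?I zs \<omega>) \<partial>M)"
  proof (rule Bochner_Integration.integral_cong[OF refl])
    fix \<omega> assume \<omega>: "\<omega> \<in> space M"
    have "(\<Sum>zs\<in>?Z. g zs \<omega> * ?I zs \<omega>) = (\<Sum>zs\<in>?Z. if zs = traj R k \<omega> then g zs \<omega> else 0)"
      using \<omega> by (intro sum.cong) (auto simp: indicator_def)
    also have "\<dots> = g (traj R k \<omega>) \<omega>"
      by (subst sum.delta[OF finite_step_lists]) (simp add: traj_length[OF \<omega>])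
    finally show "g (traj R k \<omega>) \<omega> = (\<Sum>zs\<in>?Z. g zs \<omega> * ?I zs \<omega>)" by simp
  qed
  also have "\<dots> = (\<Sum>zs\<in>?Z. \<integral>\<omega>. g zs \<omega> * ?I zs \<omega> \<partial>M)"
    by (rule Bochner_Integration.integral_sum) (rule int)
  also have "\<dots> = (\<Sum>zs\<in>?Z. \<integral>\<omega>. g zs \<omega> * real_cond_exp M (filt R k) (?I zs) \<omega> \<partial>M)"
    by (intro sum.cong refl ce.real_cond_exp_intg(2)[symmetric] int g Im)
  also have "\<dots> = (\<integral>\<omega>. (\<Sum>zs\<in>?Z. g zs \<omega> * real_cond_exp M (filt R k) (?I zs) \<omega>) \<partial>M)"
    by (rule Bochner_Integration.integral_sum[symmetric]) (intro ce.real_cond_exp_intg(1) int g Im)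
  also have "\<dots> \<le> (\<integral>\<omega>. r \<partial>M)"
  proof (rule integral_mono_AE)
    show "integrable M (\<lambda>\<omega>. \<Sum>zs\<in>?Z. g zs \<omega> * real_cond_exp M (filt R k) (?I zs) \<omega>)"
      by (intro Bochner_Integration.integrable_sum ce.real_cond_exp_intg(1) int g Im)
    have "AE \<omega> in M. \<forall>zs\<in>?Z. real_cond_exp M (filt R k) (?I zs) \<omega>
        = traj_prob pb (th R k \<omega>) (start R k \<omega>) zs"
      by (rule AE_finite_allI[OF finite_step_lists]) (simp add: traj_law)
    then show "AE \<omega> in M. (\<Sum>zs\<in>?Z. g zs \<omega> * real_cond_exp M (filt R k) (?I zs) \<omega>) \<le> r"
      using AE_space
    proof eventually_elim
      case (elim \<omega>)
      then have "(\<Sum>zs\<in>?Z. g zs \<omega> * real_cond_exp M (filt R k) (?I zs) \<omega>)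
          = traj_mean pb (th R k \<omega>) (start R k \<omega>) (batch R k) (\<lambda>zs. g zs \<omega>)"
        unfolding traj_mean_def by (intro sum.cong refl) (simp add: mult.commute)
      with mean[OF elim(2)] show ?case by simp
    qed
  qed simp
  finally show ?thesis by (simp add: prob_space)
qed

definition "sampling_const = K_bound\<^sup>2 * (real (CARD('s)) * (real (CARD('a)) * (real (CARD('s)) * (3 * weight_bound))))"

lemma sampling_const_nonneg: "0 \<le> sampling_const" using weight_bound_pos by (simp add: sampling_const_def)

lemma delta_sq_integrable: "integrable M (\<lambda>\<omega>. (delta pb R k \<omega>)\<^sup>2)"
proof (rule integrable_bounded)
  show "(\<lambda>\<omega>. (delta pb R k \<omega>)\<^sup>2) \<in> borel_measurable M"
    by (intro borel_measurable_power filt_M[OF delta_meas])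
  show "\<bar>(delta pb R k \<omega>)\<^sup>2\<bar> \<le> (2 * K_bound)\<^sup>2" if "\<omega> \<in> space M" for \<omega>
    using power_mono[OF admm_path.delta_le[OF path[OF that]] admm_path.delta_nonneg[OF path[OF that]], of k 2]
    by simp
qed

lemma delta_sq_mean: "(\<integral>\<omega>. (delta pb R k \<omega>)\<^sup>2 \<partial>M) \<le> sampling_const * (1 / real (batch R k))"
proof -
  define g where "g s u s' zs \<omega> = (raw_kernel pb (th R k \<omega>) zs s u s' - P s u s')\<^sup>2" for s u s' zs \<omega>
  have g_meas: "g s u s' zs \<in> borel_measurable (filt R k)" for s u s' zs
    unfolding g_def by (intro borel_measurable_power borel_measurable_diff raw_meas borel_measurable_const)
  have g_bound: "\<bar>g s u s' zs \<omega>\<bar> \<le> (weight_bound + 1)\<^sup>2" if \<omega>: "\<omega> \<in> space M" for s u s' zs \<omega>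
  proof -
    have "\<bar>raw_kernel pb (th R k \<omega>) zs s u s' - P s u s'\<bar> \<le> weight_bound + 1"
      using raw_kernel_bound[OF th_in[OF \<omega>] pol_low[OF \<omega>], of k zs s u s']
        stochastic_kernel_le_1[OF stochastic_true_kernel[of pb], of s u s'] by linarith
    from power_mono[OF this, of 2] show ?thesis by (simp add: g_def)
  qed
  have g_traj_meas: "(\<lambda>\<omega>. g s u s' (traj R k \<omega>) \<omega>) \<in> borel_measurable M" for s u s'
    unfolding g_def by (intro borel_measurable_power borel_measurable_diff filt_M[OF raw_traj_meas] borel_measurable_const)
  have g_int: "integrable M (\<lambda>\<omega>. g s u s' (traj R k \<omega>) \<omega>)" for s u s'
    by (rule integrable_bounded[OF g_traj_meas g_bound])
  have g_mean: "(\<integral>\<omega>. g s u s' (traj R k \<omega>) \<omega> \<partial>M) \<le> 3 * weight_bound / real (batch R k)" for s u s'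
  proof (rule integral_traj_le[OF g_meas g_bound])
    fix \<omega> assume \<omega>: "\<omega> \<in> space M"
    show "traj_mean pb (th R k \<omega>) (start R k \<omega>) (batch R k) (\<lambda>zs. g s u s' zs \<omega>) \<le> 3 * weight_bound / real (batch R k)"
      unfolding g_def by (rule raw_kernel_mean_sq[OF th_in[OF \<omega>] pol_low[OF \<omega>] batch_ge])
  qed
  have "(\<integral>\<omega>. (delta pb R k \<omega>)\<^sup>2 \<partial>M)
      \<le> (\<integral>\<omega>. K_bound\<^sup>2 * (\<Sum>s\<in>UNIV. \<Sum>u\<in>UNIV. \<Sum>s'\<in>UNIV. g s u s' (traj R k \<omega>) \<omega>) \<partial>M)"
  proof (rule integral_mono)
    fix \<omega> assume \<omega>: "\<omega> \<in> space M"
    show "(delta pb R k \<omega>)\<^sup>2 \<le> K_bound\<^sup>2 * (\<Sum>s\<in>UNIV. \<Sum>u\<in>UNIV. \<Sum>s'\<in>UNIV. g s u s' (traj R k \<omega>) \<omega>)"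
      unfolding admm_path.delta_eq[OF path[OF \<omega>] \<theta>0_in] g_def Phat_def
      by (rule Kmat_emp_error_sq[OF th_in[OF \<omega>] pol_low[OF \<omega>]])
  qed (intro delta_sq_integrable integrable_mult_right Bochner_Integration.integrable_sum g_int)+
  also have "\<dots> = K_bound\<^sup>2 * (\<Sum>s\<in>UNIV. \<Sum>u\<in>UNIV. \<Sum>s'\<in>UNIV. \<integral>\<omega>. g s u s' (traj R k \<omega>) \<omega> \<partial>M)"
    by (simp add: Bochner_Integration.integral_sum Bochner_Integration.integrable_sum g_int)
  also have "\<dots> \<le> K_bound\<^sup>2 * (\<Sum>s\<in>(UNIV :: 's set). \<Sum>u\<in>(UNIV :: 'a set). \<Sum>s'\<in>(UNIV :: 's set). 3 * weight_bound / real (batch R k))"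
    by (intro mult_left_mono sum_mono g_mean) simp
  also have "\<dots> = sampling_const * (1 / real (batch R k))"
    by (simp add: sampling_const_def)
  finally show ?thesis .
qed

lemma delta_sum_mean: "(\<integral>\<omega>. (\<Sum>k<n. (delta pb R k \<omega>)\<^sup>2) \<partial>M) \<le> sampling_const * (\<Sum>k<n. 1 / real (batch R k))"
  using delta_sq_mean by (simp add: Bochner_Integration.integral_sum delta_sq_integrable sum_distrib_left sum_mono)

lemma affine_delta_sum_integrable: "integrable M (\<lambda>\<omega>. r * (1 + (\<Sum>k<n. (delta pb R k \<omega>)\<^sup>2)))"
  by (intro integrable_mult_right Bochner_Integration.integrable_add Bochner_Integration.integrable_sum
      delta_sq_integrable integrable_const)

lemma affine_delta_sum_mean:
  assumes "0 \<le> r"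
  shows "(\<integral>\<omega>. r * (1 + (\<Sum>k<n. (delta pb R k \<omega>)\<^sup>2)) \<partial>M) \<le> r * (1 + sampling_const * (\<Sum>k<n. 1 / real (batch R k)))"
proof -
  have "(\<integral>\<omega>. r * (1 + (\<Sum>k<n. (delta pb R k \<omega>)\<^sup>2)) \<partial>M) = r * (1 + (\<integral>\<omega>. (\<Sum>k<n. (delta pb R k \<omega>)\<^sup>2) \<partial>M))"
    by (simp add: Bochner_Integration.integral_add Bochner_Integration.integrable_sum delta_sq_integrable prob_space)
  also have "\<dots> \<le> r * (1 + sampling_const * (\<Sum>k<n. 1 / real (batch R k)))"
    by (intro mult_left_mono add_left_mono delta_sum_mean assms)
  finally show ?thesis .
qed

lemma delta_sum_bound: "\<omega> \<in> space M \<Longrightarrow> (\<Sum>k<n. (delta pb R k \<omega>)\<^sup>2) \<le> real n * (2 * K_bound)\<^sup>2"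
  using sum_bounded_above[of "{..<n}" "\<lambda>k. (delta pb R k \<omega>)\<^sup>2" "(2 * K_bound)\<^sup>2"]
    power_mono[OF admm_path.delta_le[OF path] admm_path.delta_nonneg[OF path], of \<omega> _ 2] by simp

section \<open>Expectation of the potential\<close>

lemma Psi_integrable:
  assumes "1 \<le> k" shows "integrable M (Psi pb pr R k)"
proof (rule integrable_bounded[OF filt_M[OF Psi_meas]])
  fix \<omega> assume \<omega>: "\<omega> \<in> space M"
  have "Psi pb pr R k \<omega> \<le> potential_const * (1 + (\<Sum>j<k. (delta pb R j \<omega>)\<^sup>2))"
    by (rule admm_path.Psi_bounds(2)[OF path[OF \<omega>] assms])
  also have "\<dots> \<le> potential_const * (1 + real k * (2 * K_bound)\<^sup>2)"
    by (intro mult_left_mono add_left_mono delta_sum_bound \<omega> potential_const_nonneg)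
  finally show "\<bar>Psi pb pr R k \<omega>\<bar> \<le> potential_const * (1 + real k * (2 * K_bound)\<^sup>2)"
    using admm_path.Psi_bounds(1)[OF path[OF \<omega>] assms] by linarith
qed

lemma Psi_mean:
  assumes "1 \<le> k" "k \<le> T"
  shows "(\<integral>\<omega>. Psi pb pr R k \<omega> \<partial>M) \<le> potential_const + potential_const * sampling_const * (\<Sum>j<T. 1 / real (batch R j))"
proof -
  have "(\<integral>\<omega>. Psi pb pr R k \<omega> \<partial>M) \<le> (\<integral>\<omega>. potential_const * (1 + (\<Sum>j<k. (delta pb R j \<omega>)\<^sup>2)) \<partial>M)"
    by (rule integral_mono[OF Psi_integrable[OF assms(1)] affine_delta_sum_integrable])
      (rule admm_path.Psi_bounds(2)[OF path assms(1)])
  also have "\<dots> \<le> potential_const * (1 + sampling_const * (\<Sum>j<k. 1 / real (batch R j)))"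
    by (rule affine_delta_sum_mean[OF potential_const_nonneg])
  also have "\<dots> \<le> potential_const * (1 + sampling_const * (\<Sum>j<T. 1 / real (batch R j)))"
    using assms(2) by (intro mult_left_mono add_left_mono sum_mono2 sampling_const_nonneg potential_const_nonneg) auto
  finally show ?thesis by (simp add: algebra_simps)
qed

section \<open>Expected residual at a random index\<close>

text \<open>The majorant as a function of the sample point, which is a fixed parameter inside
  \<open>admm_path\<close>.\<close>

definition "kkt_bound_rv k \<omega> = admm_path.kkt_bound pb pr x0 y0 R \<omega> k"

lemma kkt_bound_rv_eq:
  assumes "\<omega> \<in> space M"
  shows "kkt_bound_rv k \<omega> = kkt_const * ((norm (th R (Suc k) \<omega> - th R k \<omega>))\<^sup>2 + (norm (xx R (Suc k) \<omega> - xx R k \<omega>))\<^sup>2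
    + (if k = 0 then 0 else (norm (th R (Suc (k - 1)) \<omega> - th R (k - 1) \<omega>))\<^sup>2 + (norm (xx R (Suc (k - 1)) \<omega> - xx R (k - 1) \<omega>))\<^sup>2)
    + (delta pb R k \<omega>)\<^sup>2 + (delta_prev pb R k \<omega>)\<^sup>2 + of_bool (k = 0))"
  unfolding kkt_bound_rv_def admm_path.kkt_bound_def[OF path[OF assms]] admm_path.prev_step_sq_def[OF path[OF assms]] ..

lemma kkt_bound_rv_meas: "kkt_bound_rv k \<in> borel_measurable (filt R (Suc k))"
proof -
  have d: "(\<lambda>\<omega>. (norm (f \<omega> - g \<omega>))\<^sup>2) \<in> borel_measurable (filt R (Suc k))"
    if "f \<in> borel_measurable (filt R (Suc k))" "g \<in> borel_measurable (filt R (Suc k))"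
    for f g :: "'w \<Rightarrow> real^'n"
    by (intro borel_measurable_power measurable_compose[OF borel_measurable_diff[OF that] borel_measurable_norm])
  have m: "th R j \<in> borel_measurable (filt R (Suc k))" "xx R j \<in> borel_measurable (filt R (Suc k))" if "j \<le> Suc k" for j
    using filt_mono[OF that] th_meas xx_meas by blast+
  have S: "(\<lambda>\<omega>. (norm (th R (Suc j) \<omega> - th R j \<omega>))\<^sup>2) \<in> borel_measurable (filt R (Suc k))"
    "(\<lambda>\<omega>. (norm (xx R (Suc j) \<omega> - xx R j \<omega>))\<^sup>2) \<in> borel_measurable (filt R (Suc k))" if "j \<le> k" for j
    using that by (intro d m; simp)+
  have prev: "(\<lambda>\<omega>. if k = 0 then 0 else (norm (th R (Suc (k - 1)) \<omega> - th R (k - 1) \<omega>))\<^sup>2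
      + (norm (xx R (Suc (k - 1)) \<omega> - xx R (k - 1) \<omega>))\<^sup>2) \<in> borel_measurable (filt R (Suc k))"
    using borel_measurable_add[OF S(1)[of "k - 1"] S(2)[of "k - 1"]] by (cases "k = 0") simp_all
  have "(\<lambda>\<omega>. kkt_const * ((norm (th R (Suc k) \<omega> - th R k \<omega>))\<^sup>2 + (norm (xx R (Suc k) \<omega> - xx R k \<omega>))\<^sup>2
    + (if k = 0 then 0 else (norm (th R (Suc (k - 1)) \<omega> - th R (k - 1) \<omega>))\<^sup>2 + (norm (xx R (Suc (k - 1)) \<omega> - xx R (k - 1) \<omega>))\<^sup>2)
    + (delta pb R k \<omega>)\<^sup>2 + (delta_prev pb R k \<omega>)\<^sup>2 + of_bool (k = 0))) \<in> borel_measurable (filt R (Suc k))"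
    by (intro borel_measurable_times borel_measurable_add borel_measurable_const S prev borel_measurable_power delta_meas
          filt_mono[OF _ delta_prev_meas]) simp_all
  then show ?thesis
    by (rule measurable_cong[THEN iffD1, rotated]) (simp add: space_filt kkt_bound_rv_eq)
qed

lemma kkt_bound_rv_nonneg: "\<omega> \<in> space M \<Longrightarrow> 0 \<le> kkt_bound_rv k \<omega>"
  unfolding kkt_bound_rv_def by (rule admm_path.kkt_bound_nonneg[OF path])

lemma kkt_bound_rv_sum: "\<omega> \<in> space M \<Longrightarrow> 1 \<le> n \<Longrightarrow> (\<Sum>k<n. kkt_bound_rv k \<omega>) \<le> kkt_sum_const * (1 + (\<Sum>k<n. (delta pb R k \<omega>)\<^sup>2))"
  unfolding kkt_bound_rv_def by (rule admm_path.kkt_bound_sum[OF path])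

lemma kkt_sum_const_nonneg: "0 \<le> kkt_sum_const"
  using kkt_const_nonneg potential_const_nonneg descent_rate_pos by (simp add: kkt_sum_const_def)

lemma kkt_bound_rv_bound:
  assumes \<omega>: "\<omega> \<in> space M"
  shows "\<bar>kkt_bound_rv k \<omega>\<bar> \<le> kkt_sum_const * (1 + real (Suc k) * (2 * K_bound)\<^sup>2)"
proof -
  \<comment> \<open>All terms are nonnegative, so the bound for the sum also bounds a single
    term.\<close>
  have "kkt_bound_rv k \<omega> \<le> (\<Sum>j<Suc k. kkt_bound_rv j \<omega>)"
    by (rule member_le_sum) (auto intro: kkt_bound_rv_nonneg \<omega>)
  also have "\<dots> \<le> kkt_sum_const * (1 + (\<Sum>j<Suc k. (delta pb R j \<omega>)\<^sup>2))"
    by (rule kkt_bound_rv_sum[OF \<omega>]) simp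
  also have "\<dots> \<le> kkt_sum_const * (1 + real (Suc k) * (2 * K_bound)\<^sup>2)"
    by (intro mult_left_mono add_left_mono delta_sum_bound \<omega> kkt_sum_const_nonneg)
  finally show ?thesis using kkt_bound_rv_nonneg[OF \<omega>, of k] by simp
qed

lemma kkt_bound_rv_integrable: "integrable M (kkt_bound_rv k)"
  by (rule integrable_bounded[OF filt_M[OF kkt_bound_rv_meas] kkt_bound_rv_bound])

text \<open>Independence of the index from the whole filtration makes the conditional probability of
  the event that it equals j the constant 1 / T, so the expectation factors.\<close>

lemma uniform_index_factor:
  assumes \<kappa>: "uniform_index M R T \<iota>" and T: "1 \<le> T" and j: "j \<in> {1..T}"
    and f: "f \<in> borel_measurable (filt R n)" "\<And>\<omega>. \<omega> \<in> space M \<Longrightarrow> \<bar>f \<omega>\<bar> \<le> B"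
  shows "integrable M (\<lambda>\<omega>. f \<omega> * indicator {\<omega> \<in> space M. \<iota> \<omega> = j} \<omega>)"
    "(\<integral>\<omega>. f \<omega> * indicator {\<omega> \<in> space M. \<iota> \<omega> = j} \<omega> \<partial>M) = 1 / real T * (\<integral>\<omega>. f \<omega> \<partial>M)"
proof -
  let ?J = "{\<omega> \<in> space M. \<iota> \<omega> = j}"
  interpret ce: sigma_finite_subalgebra M "filt R n" by (rule cond_exp_subalgebra)
  have meas: "\<iota> \<in> measurable M (count_space UNIV)"
    and distr: "distr M (count_space UNIV) \<iota> = measure_pmf (pmf_of_set {1..T})"
    and ind: "indep_set {\<iota> -` B \<inter> space M |B. True} (sigma_sets (space M) (\<Union>k. sets (filt R k)))"
    using \<kappa> unfolding uniform_index_def by auto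
  have J_eq: "?J = \<iota> -` {j} \<inter> space M" by auto
  have J: "?J \<in> sets M" unfolding J_eq by (rule measurable_sets[OF meas]) simp
  have "prob ?J = measure (distr M (count_space UNIV) \<iota>) {j}"
    unfolding J_eq by (rule measure_distr[OF meas, symmetric]) simp
  also have "\<dots> = pmf (pmf_of_set {1..T}) j" unfolding distr by (simp add: pmf.rep_eq)
  also have "\<dots> = 1 / real T" using j by (subst pmf_of_set) auto
  finally have pJ: "prob ?J = 1 / real T" .
  show int: "integrable M (\<lambda>\<omega>. f \<omega> * indicator ?J \<omega>)"
  proof (rule integrable_bounded)
    show "(\<lambda>\<omega>. f \<omega> * indicator ?J \<omega>) \<in> borel_measurable M"
      by (intro borel_measurable_times filt_M[OF f(1)] borel_measurable_indicator J)
    show "\<bar>f \<omega> * indicator ?J \<omega>\<bar> \<le> B" if "\<omega> \<in> space M" for \<omega>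
      using f(2)[OF that] by (auto simp: indicator_def)
  qed
  have iJ: "integrable M (indicator ?J :: 'w \<Rightarrow> real)"
    using J by (intro integrable_real_indicator) (auto simp: emeasure_eq_measure)
  \<comment> \<open>A constant is recognized as the conditional expectation by testing it on events
    of the history, where independence gives a product of probabilities.\<close>
  have ce: "AE \<omega> in M. real_cond_exp M (filt R n) (indicator ?J) \<omega> = 1 / real T"
  proof (rule ce.real_cond_exp_charact[OF _ iJ])
    fix A assume A: "A \<in> sets (filt R n)"
    then have AM: "A \<in> sets M" using subalg[of n] by (auto simp: subalgebra_def)
    have "A \<in> sigma_sets (space M) (\<Union>k. sets (filt R k))" using A by (intro sigma_sets.Basic) blast
    then have "prob (?J \<inter> A) = prob ?J * prob A"
      unfolding J_eq by (intro indep_setD[OF ind]) auto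
    then have "measure M (A \<inter> ?J) = 1 / real T * measure M A" by (simp add: pJ Int_commute)
    then show "(\<integral>\<omega>\<in>A. indicator ?J \<omega> \<partial>M) = (\<integral>\<omega>\<in>A. 1 / real T \<partial>M)"
      using AM J by (simp add: set_lebesgue_integral_def indicator_inter_arith[symmetric] sets.Int_space_eq2 Int_absorb2 sets.sets_into_space)
  qed simp_all
  have "(\<integral>\<omega>. f \<omega> * indicator ?J \<omega> \<partial>M) = (\<integral>\<omega>. f \<omega> * real_cond_exp M (filt R n) (indicator ?J) \<omega> \<partial>M)"
    by (rule ce.real_cond_exp_intg(2)[symmetric, OF int f(1)]) (rule borel_measurable_indicator[OF J])
  also have "\<dots> = (\<integral>\<omega>. f \<omega> * (1 / real T) \<partial>M)"
  proof (rule integral_cong_AE)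
    show "(\<lambda>\<omega>. f \<omega> * real_cond_exp M (filt R n) (indicator ?J) \<omega>) \<in> borel_measurable M"
      by (intro borel_measurable_times filt_M[OF f(1)] borel_measurable_cond_exp2)
    show "(\<lambda>\<omega>. f \<omega> * (1 / real T)) \<in> borel_measurable M"
      by (intro borel_measurable_times filt_M[OF f(1)] borel_measurable_const)
    show "AE \<omega> in M. f \<omega> * real_cond_exp M (filt R n) (indicator ?J) \<omega> = f \<omega> * (1 / real T)"
      using ce by eventually_elim simp
  qed
  finally show "(\<integral>\<omega>. f \<omega> * indicator ?J \<omega> \<partial>M) = 1 / real T * (\<integral>\<omega>. f \<omega> \<partial>M)" by simp
qed

text \<open>The residual at the random index is dominated by the sum of the majorants, each cut off
  to the event that selects it. Factoring out 1 / T leaves the expected sum over all iterations,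
  which is bounded pathwise.\<close>

lemma G_mean:
  assumes \<iota>: "uniform_index M R T \<iota>" and T: "1 \<le> T"
  shows "(\<integral>\<^sup>+\<omega>. G_true pb R (\<iota> \<omega>) \<omega> \<partial>M)
    \<le> ennreal (1 / real T * (kkt_sum_const * (1 + sampling_const * (\<Sum>k<T. 1 / real (batch R k)))))"
proof -
  let ?f = "\<lambda>k \<omega>. kkt_bound_rv k \<omega> * indicator {\<omega> \<in> space M. \<iota> \<omega> = Suc k} \<omega>"
  have meas: "\<iota> \<in> measurable M (count_space UNIV)"
    and distr: "distr M (count_space UNIV) \<iota> = measure_pmf (pmf_of_set {1..T})"
    using \<iota> unfolding uniform_index_def by auto
  have fint: "integrable M (?f k)" and fmean: "(\<integral>\<omega>. ?f k \<omega> \<partial>M) = 1 / real T * (\<integral>\<omega>. kkt_bound_rv k \<omega> \<partial>M)" if "k < T" for k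
    using uniform_index_factor[OF \<iota> T _ kkt_bound_rv_meas kkt_bound_rv_bound, of "Suc k" k] that by auto
  \<comment> \<open>The index lies in the range 1 to T only almost surely; index 0 must be excluded
    because \<open>G_true_le\<close> starts at 1.\<close>
  have "AE i in distr M (count_space UNIV) \<iota>. i \<in> {1..T}"
    unfolding distr using T by (simp add: AE_measure_pmf_iff)
  then have "AE \<omega> in M. \<iota> \<omega> \<in> {1..T}" by (subst (asm) AE_distr_iff[OF meas]) auto
  then have "AE \<omega> in M. G_true pb R (\<iota> \<omega>) \<omega> \<le> ennreal (\<Sum>k<T. ?f k \<omega>)"
    using AE_space
  proof eventually_elim
    case (elim \<omega>)
    then obtain k where k: "\<iota> \<omega> = Suc k" "k < T" by (cases "\<iota> \<omega>") auto
    have "(\<Sum>k<T. ?f k \<omega>) = (\<Sum>j<T. if j = k then kkt_bound_rv j \<omega> else 0)"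
      using elim(2) k(1) by (intro sum.cong) (auto simp: indicator_def)
    also have "\<dots> = kkt_bound_rv k \<omega>" using k(2) by (simp add: sum.delta)
    finally show ?case
      using admm_path.G_true_le[OF path[OF elim(2)], of k] by (simp add: k(1) kkt_bound_rv_def)
  qed
  then have "(\<integral>\<^sup>+\<omega>. G_true pb R (\<iota> \<omega>) \<omega> \<partial>M) \<le> (\<integral>\<^sup>+\<omega>. ennreal (\<Sum>k<T. ?f k \<omega>) \<partial>M)"
    by (rule nn_integral_mono_AE)
  also have "\<dots> = ennreal (\<integral>\<omega>. (\<Sum>k<T. ?f k \<omega>) \<partial>M)"
  proof (rule nn_integral_eq_integral)
    show "integrable M (\<lambda>\<omega>. \<Sum>k<T. ?f k \<omega>)"
      by (intro Bochner_Integration.integrable_sum fint) simp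
    show "AE \<omega> in M. 0 \<le> (\<Sum>k<T. ?f k \<omega>)"
      by (intro AE_I2 sum_nonneg mult_nonneg_nonneg kkt_bound_rv_nonneg) auto
  qed
  also have "\<dots> \<le> ennreal (1 / real T * (kkt_sum_const * (1 + sampling_const * (\<Sum>k<T. 1 / real (batch R k)))))"
  proof (rule ennreal_leI)
    have "(\<integral>\<omega>. (\<Sum>k<T. ?f k \<omega>) \<partial>M) = (\<Sum>k<T. 1 / real T * (\<integral>\<omega>. kkt_bound_rv k \<omega> \<partial>M))"
      using fint by (subst Bochner_Integration.integral_sum) (auto simp: fmean)
    also have "\<dots> = 1 / real T * (\<integral>\<omega>. (\<Sum>k<T. kkt_bound_rv k \<omega>) \<partial>M)"
      by (simp add: Bochner_Integration.integral_sum kkt_bound_rv_integrable sum_distrib_left)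
    also have "\<dots> \<le> 1 / real T * (\<integral>\<omega>. kkt_sum_const * (1 + (\<Sum>k<T. (delta pb R k \<omega>)\<^sup>2)) \<partial>M)"
      using T by (intro mult_left_mono integral_mono Bochner_Integration.integrable_sum kkt_bound_rv_integrable
          affine_delta_sum_integrable kkt_bound_rv_sum) auto
    also have "\<dots> \<le> 1 / real T * (kkt_sum_const * (1 + sampling_const * (\<Sum>k<T. 1 / real (batch R k))))"
      by (intro mult_left_mono affine_delta_sum_mean kkt_sum_const_nonneg) simp
    finally show "(\<integral>\<omega>. (\<Sum>k<T. ?f k \<omega>) \<partial>M) \<le> 1 / real T * (kkt_sum_const * (1 + sampling_const * (\<Sum>k<T. 1 / real (batch R k))))" .
  qed
  finally show ?thesis .
qed

end

theorem theoremH9: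
  fixes pb :: "('s::finite, 'a::finite, 'p::finite) occ_problem"
    and pr :: admm_params
    and \<theta>0 :: "real^'p"
    and x0 :: "real^(('s \<times> 'a) + 's)"
    and y0 :: "real^('s + ('s \<times> 'a))"
  assumes "problem_ok pb"
    and "params_ok pb pr"
    and "psi pb \<theta>0 < \<infinity>"
  shows "\<exists>C1 C2 C3 Cinit :: real.
    \<forall>(M :: 'w measure) R.
      sampling_ok pb pr M R \<and> updates_ok pb pr \<theta>0 x0 y0 M R \<and> regularity_ok pb pr M R \<longrightarrow>
      (\<forall>T\<ge>1. let A = (\<Sum>k<T. 1 / real (batch R k)) in
         (\<forall>k\<in>{1..T}. integrable M (Psi pb pr R k)) \<and>
         (SUP k\<in>{1..T}. (\<integral>\<omega>. Psi pb pr R k \<omega> \<partial>M)) \<le> exp (C1 * A) * (Cinit + C2 * A) \<and>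
         (\<forall>\<kappa>. uniform_index M R T \<kappa> \<longrightarrow>
            (\<integral>\<^sup>+\<omega>. G_true pb R (\<kappa> \<omega>) \<omega> \<partial>M)
              \<le> ennreal (C3 * exp (C1 * A) * (1 + A) * (1 / real T + A / real T))))"
proof -
  interpret occ_setup pb pr \<theta>0 x0 y0 using assms by unfold_locales
  \<comment> \<open>This constant of the stochastic locale depends on \<open>pb\<close> and
    \<open>pr\<close> only, so it can be fixed before the probability space and the run are
    quantified.\<close>
  define sampling_const where "sampling_const = occ_random.sampling_const pb pr"
  show ?thesis
  proof (rule exI[of _ 0], rule exI[of _ "potential_const * sampling_const"], rule exI[of _ "kkt_sum_const * (1 + sampling_const)"], rule exI[of _ potential_const],
      intro allI impI)
    fix M :: "'w measure" and R :: "('w, 's, 'a, 'p) run" and T :: nat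
    assume ok: "sampling_ok pb pr M R \<and> updates_ok pb pr \<theta>0 x0 y0 M R \<and> regularity_ok pb pr M R" and T: "1 \<le> T"
    interpret r: occ_random pb pr \<theta>0 x0 y0 M R using ok by unfold_locales auto
    define A where "A = (\<Sum>k<T. 1 / real (batch R k))"
    have A: "0 \<le> A" unfolding A_def by (intro sum_nonneg) simp
    have sampling_const: "0 \<le> sampling_const" unfolding sampling_const_def by (rule r.sampling_const_nonneg)
    have "integrable M (Psi pb pr R k)" if "k \<in> {1..T}" for k
      using that by (intro r.Psi_integrable) simp
    moreover have "(SUP k\<in>{1..T}. (\<integral>\<omega>. Psi pb pr R k \<omega> \<partial>M)) \<le> exp (0 * A) * (potential_const + potential_const * sampling_const * A)"
      using T r.Psi_mean[of _ T] by (intro cSUP_least) (auto simp: A_def sampling_const_def)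
    moreover have "(\<integral>\<^sup>+\<omega>. G_true pb R (\<iota> \<omega>) \<omega> \<partial>M)
        \<le> ennreal (kkt_sum_const * (1 + sampling_const) * exp (0 * A) * (1 + A) * (1 / real T + A / real T))"
      if "uniform_index M R T \<iota>" for \<iota>
    proof -
      \<comment> \<open>The bound obtained is affine in A; the stated product of (1 + A) and (1 / T
        + A / T) is (1 + A)^2 / T, which leaves a nonnegative slack.\<close>
      have "1 / real T * (kkt_sum_const * (1 + sampling_const * A)) \<le> 1 / real T * (kkt_sum_const * ((1 + sampling_const) * ((1 + A) * (1 + A))))"
      proof (intro mult_left_mono r.kkt_sum_const_nonneg)
        have "0 \<le> A + sampling_const + A * (1 + A) + sampling_const * A * (1 + A)" using A sampling_const by (intro add_nonneg_nonneg mult_nonneg_nonneg) auto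
        also have "\<dots> = (1 + sampling_const) * ((1 + A) * (1 + A)) - (1 + sampling_const * A)" by (simp add: algebra_simps)
        finally show "1 + sampling_const * A \<le> (1 + sampling_const) * ((1 + A) * (1 + A))" by simp
      qed simp
      also have "\<dots> = kkt_sum_const * (1 + sampling_const) * exp (0 * A) * (1 + A) * (1 / real T + A / real T)"
        by (simp add: add_divide_distrib[symmetric])
      finally show ?thesis
        using r.G_mean[OF that T] unfolding A_def[symmetric] sampling_const_def[symmetric]
        by (meson ennreal_leI order_trans)
    qed
    ultimately show "let A = (\<Sum>k<T. 1 / real (batch R k)) in
         (\<forall>k\<in>{1..T}. integrable M (Psi pb pr R k)) \<and>
         (SUP k\<in>{1..T}. (\<integral>\<omega>. Psi pb pr R k \<omega> \<partial>M)) \<le> exp (0 * A) * (potential_const + potential_const * sampling_const * A) \<and>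
         (\<forall>\<kappa>. uniform_index M R T \<kappa> \<longrightarrow>
            (\<integral>\<^sup>+\<omega>. G_true pb R (\<kappa> \<omega>) \<omega> \<partial>M)
              \<le> ennreal (kkt_sum_const * (1 + sampling_const) * exp (0 * A) * (1 + A) * (1 / real T + A / real T)))"
      unfolding Let_def A_def[symmetric] by blast
  qed
qed

end
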